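(* Let $s\in(0,1]$ and $p\in[1,+\infty]$ be such that $sp>N$. Let $\Omega\subset\mathbb{R}^N$ be an open and bounded domain with Lipschitz boundary. Let $\widetilde s\in[0,1]$ and $\widetilde p\in[1,+\infty]$. If $\widetilde s$ and $\widetilde p$ do not satisfy $$\text{either}\quad\begin{cases}0\le\widetilde s\le\dfrac{sp-N}{p},\\ 1\le\widetilde p\le+\infty,\end{cases}\qquad\text{or}\qquad\begin{cases}\dfrac{sp-N}{p}<\widetilde s<s,\\ 1\le\widetilde p<\dfrac{Np}{N-(s-\widetilde s)p},\end{cases}$$ then the space $W^{s,p}(\Omega)$ is not compactly embedded in $W^{\widetilde s,\widetilde p}(\Omega)$.
   Context: $N\ge1$ is an integer and functions are real-valued and measurable. For $s\in[0,1]$ and $p\in[1,+\infty)$ define $[u]_{W^{0,p}(\Omega)}:=\|u\|_{L^p(\Omega)}$, $[u]_{W^{1,p}(\Omega)}:=\|\nabla u\|_{L^p(\Omega)}$ (weak gradient) and, for $s\in(0,1)$, $$[u]_{W^{s,p}(\Omega)}:=\left(c_{N,s,p}\iint_{\Omega\times\Omega}\frac{|u(x)-u(y)|^p}{|x-y|^{N+sp}}\,dx\,dy\right)^{1/p},\qquad c_{N,s,p}:=\frac{s\,2^{2s-1}\,\Gamma\left(\frac{ps+p+N-2}{2}\right)}{\pi^{N/2}\,\Gamma(1-s)}.$$ Set $W^{s,p}(\Omega):=\{u\in L^p(\Omega):[u]_{W^{s,p}(\Omega)}<+\infty\}$, with norm $\|u\|_{W^{0,p}(\Omega)}:=\|u\|_{L^p(\Omega)}$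 if $s=0$ and $\|u\|_{W^{s,p}(\Omega)}:=\big([u]^p_{W^{s,p}(\Omega)}+\|u\|^p_{L^p(\Omega)}\big)^{1/p}$ if $s\in(0,1]$. For $p=+\infty$: $W^{0,\infty}(\Omega):=L^\infty(\Omega)$ and, for $s\in(0,1]$, $W^{s,\infty}(\Omega):=C^{0,s}(\Omega)$ with norm $\|u\|_{L^\infty(\Omega)}+\sup_{x\neq y\in\Omega}\frac{|u(x)-u(y)|}{|x-y|^s}$ (functions being identified up to a.e. equality). Convention: $\frac{sp-N}{p}$ means $s-\frac Np$ with $\frac N\infty=0$ (so if $p=+\infty$ it equals $s$, the condition $sp>N$ holds, and the second alternative is empty). *)

theory Defs
  imports "HOL-Analysis.Analysis" "HOL-Probability.Essential_Supremum"
begin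

text \<open>
  The space \<open>\<real>\<^sup>N\<close> is \<^typ>\<open>real^'n\<close> with \<open>N = CARD('n)\<close>. Functions on \<open>\<Omega>\<close> are functions
  \<^typ>\<open>real^'n \<Rightarrow> real\<close> whose values outside \<open>\<Omega>\<close> are irrelevant, and the identification of a.e. equal
  functions is handled by working with extended-valued (semi)norms that depend only on the
  a.e.-equivalence class. Integrability exponents in \<open>[1,+\<infinity>]\<close> are extended reals.
\<close>

section \<open>Lipschitz domains\<close>

text \<open>
  Near each boundary point, \<open>\<Omega>\<close> is the strict epigraph, in some unit direction \<open>e\<close>, of a
  Lipschitz function on the hyperplane orthogonal to \<open>e\<close>
  (\<open>e\<close> plays the role of the last axis after a rotation;
  \<open>y - (y \<bullet> e) *\<^sub>R e\<close> is the orthogonal projection of \<open>y\<close> to the hyperplane).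
\<close>

definition lipschitz_boundary :: "('a::euclidean_space) set \<Rightarrow> bool" where
  "lipschitz_boundary \<Omega> \<longleftrightarrow>
     (\<forall>x\<in>frontier \<Omega>. \<exists>r>0. \<exists>e L \<gamma>. norm e = 1 \<and> L-lipschitz_on {v. v \<bullet> e = 0} \<gamma> \<and>
        \<Omega> \<inter> ball x r = {y \<in> ball x r. y \<bullet> e > \<gamma> (y - (y \<bullet> e) *\<^sub>R e)})"

definition bounded_lipschitz_domain :: "('a::euclidean_space) set \<Rightarrow> bool" where
  "bounded_lipschitz_domain \<Omega> \<longleftrightarrow>
     \<Omega> \<noteq> {} \<and> open \<Omega> \<and> connected \<Omega> \<and> bounded \<Omega> \<and> lipschitz_boundary \<Omega>"


section \<open>Lebesgue norms\<close>

text \<open>Real powers of extended nonnegative reals, only used with exponent \<open>a > 0\<close>.\<close>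

definition enn_powr :: "ennreal \<Rightarrow> real \<Rightarrow> ennreal" where
  "enn_powr x a = (if x = \<infinity> then \<infinity> else ennreal (enn2real x powr a))"

definition Lp_norm :: "real \<Rightarrow> (real^'n) set \<Rightarrow> (real^'n \<Rightarrow> real) \<Rightarrow> ennreal" where
  "Lp_norm p \<Omega> u = enn_powr (\<integral>\<^sup>+x. ennreal (\<bar>u x\<bar> powr p) \<partial>lebesgue_on \<Omega>) (1 / p)"

definition Linf_norm :: "(real^'n) set \<Rightarrow> (real^'n \<Rightarrow> real) \<Rightarrow> ennreal" where
  "Linf_norm \<Omega> u = esssup (lebesgue_on \<Omega>) (\<lambda>x. ennreal \<bar>u x\<bar>)"


section \<open>Weak gradients\<close>

definition partial_deriv :: "'n \<Rightarrow> (real^'n \<Rightarrow> real) \<Rightarrow> real^'n \<Rightarrow> real" where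
  "partial_deriv i \<phi> x = frechet_derivative \<phi> (at x) (axis i 1)"

primrec Ck :: "nat \<Rightarrow> (real^'n \<Rightarrow> real) \<Rightarrow> bool" where
  "Ck 0 \<phi> \<longleftrightarrow> continuous_on UNIV \<phi>"
| "Ck (Suc k) \<phi> \<longleftrightarrow> (\<forall>x. \<phi> differentiable (at x)) \<and> (\<forall>i. Ck k (partial_deriv i \<phi>))"

definition test_function :: "(real^'n) set \<Rightarrow> (real^'n \<Rightarrow> real) \<Rightarrow> bool" where
  "test_function \<Omega> \<phi> \<longleftrightarrow> (\<forall>k. Ck k \<phi>) \<and>
     compact (closure {x. \<phi> x \<noteq> 0}) \<and> closure {x. \<phi> x \<noteq> 0} \<subseteq> \<Omega>"

definition locally_integrable :: "(real^'n) set \<Rightarrow> (real^'n \<Rightarrow> real) \<Rightarrow> bool" where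
  "locally_integrable \<Omega> u \<longleftrightarrow> (\<forall>K. compact K \<and> K \<subseteq> \<Omega> \<longrightarrow> set_integrable lebesgue K u)"

definition has_weak_gradient ::
    "(real^'n) set \<Rightarrow> (real^'n \<Rightarrow> real) \<Rightarrow> (real^'n \<Rightarrow> real^'n) \<Rightarrow> bool" where
  "has_weak_gradient \<Omega> u g \<longleftrightarrow> locally_integrable \<Omega> u \<and> (\<forall>i. locally_integrable \<Omega> (\<lambda>x. g x $ i)) \<and>
     (\<forall>\<phi> i. test_function \<Omega> \<phi> \<longrightarrow>
        (LINT x|lebesgue_on \<Omega>. u x * partial_deriv i \<phi> x) = - (LINT x|lebesgue_on \<Omega>. g x $ i * \<phi> x))"


section \<open>Fractional Sobolev spaces\<close>

definition gagliardo_const :: "nat \<Rightarrow> real \<Rightarrow> real \<Rightarrow> real" where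
  "gagliardo_const N s p =
     s * 2 powr (2 * s - 1) * Gamma ((p * s + p + real N - 2) / 2)
       / (pi powr (real N / 2) * Gamma (1 - s))"

text \<open>
  For \<open>s = 1\<close>, weak gradients are unique up to a null set, so the infimum is taken over at most
  one value; it is \<open>\<infinity>\<close> when no weak gradient exists. For \<open>0 < s < 1\<close>, the integrand
  vanishes on the diagonal because \<open>0 / 0 = 0\<close>.
\<close>

definition sobolev_seminorm :: "real \<Rightarrow> real \<Rightarrow> (real^'n) set \<Rightarrow> (real^'n \<Rightarrow> real) \<Rightarrow> ennreal" where
  "sobolev_seminorm s p \<Omega> u =
     (if s = 0 then Lp_norm p \<Omega> u
      else if s = 1 then (INF g\<in>{g. has_weak_gradient \<Omega> u g}. Lp_norm p \<Omega> (\<lambda>x. norm (g x)))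
      else enn_powr
        (ennreal (gagliardo_const CARD('n) s p) *
          (\<integral>\<^sup>+(x, y). ennreal (\<bar>u x - u y\<bar> powr p / norm (x - y) powr (real CARD('n) + s * p))
             \<partial>(lebesgue_on \<Omega> \<Otimes>\<^sub>M lebesgue_on \<Omega>)))
        (1 / p))"

definition holder_norm :: "real \<Rightarrow> (real^'n) set \<Rightarrow> (real^'n \<Rightarrow> real) \<Rightarrow> ennreal" where
  "holder_norm s \<Omega> v = Linf_norm \<Omega> v +
     (SUP (x, y)\<in>{(x, y). x \<in> \<Omega> \<and> y \<in> \<Omega> \<and> x \<noteq> y}. ennreal (\<bar>v x - v y\<bar> / norm (x - y) powr s))"

text \<open>
  For \<open>p = \<infinity>\<close> and \<open>s > 0\<close>, the infimum over the a.e.-equivalence class of \<open>u\<close> is the Hoelder norm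
  of the unique continuous representative if that is Hoelder continuous, and \<open>\<infinity>\<close> otherwise.
\<close>

definition sobolev_norm :: "real \<Rightarrow> ereal \<Rightarrow> (real^'n) set \<Rightarrow> (real^'n \<Rightarrow> real) \<Rightarrow> ennreal" where
  "sobolev_norm s p \<Omega> u =
     (if p = \<infinity> then
        (if s = 0 then Linf_norm \<Omega> u
         else (INF v\<in>{v. AE x in lebesgue_on \<Omega>. u x = v x}. holder_norm s \<Omega> v))
      else let q = real_of_ereal p in
        (if s = 0 then Lp_norm q \<Omega> u
         else enn_powr
           (enn_powr (sobolev_seminorm s q \<Omega> u) q + enn_powr (Lp_norm q \<Omega> u) q) (1 / q)))"

definition sobolev_space :: "real \<Rightarrow> ereal \<Rightarrow> (real^'n) set \<Rightarrow> (real^'n \<Rightarrow> real) set" where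
  "sobolev_space s p \<Omega> = {u. u \<in> borel_measurable (lebesgue_on \<Omega>) \<and>
     (if p = \<infinity> then sobolev_norm s p \<Omega> u < \<infinity>
      else Lp_norm (real_of_ereal p) \<Omega> u < \<infinity> \<and> sobolev_seminorm s (real_of_ereal p) \<Omega> u < \<infinity>)}"


section \<open>Compact embeddings\<close>

text \<open>
  \<open>X\<close> with norm \<open>nX\<close> is contained in \<open>Y\<close> with norm \<open>nY\<close>, the inclusion is bounded, and every
  sequence bounded in \<open>X\<close> has a subsequence converging in \<open>Y\<close>.
\<close>

definition compactly_embedded ::
    "('a \<Rightarrow> real) set \<Rightarrow> (('a \<Rightarrow> real) \<Rightarrow> ennreal) \<Rightarrow>
     ('a \<Rightarrow> real) set \<Rightarrow> (('a \<Rightarrow> real) \<Rightarrow> ennreal) \<Rightarrow> bool" where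
  "compactly_embedded X nX Y nY \<longleftrightarrow>
     X \<subseteq> Y \<and>
     (\<exists>C::real. \<forall>u\<in>X. nY u \<le> ennreal C * nX u) \<and>
     (\<forall>u :: nat \<Rightarrow> 'a \<Rightarrow> real. (\<forall>k. u k \<in> X) \<and> (\<exists>M::real. \<forall>k. nX (u k) \<le> ennreal M) \<longrightarrow>
        (\<exists>v\<in>Y. \<exists>r. strict_mono r \<and> (\<lambda>k. nY (\<lambda>x. u (r k) x - v x)) \<longlonglongrightarrow> 0))"

end

theory Submission
  imports Defs
begin

text \<open>
  If \<open>st \<ge> s\<close>, the waves \<open>lam\<^sup>-\<^sup>s sin (lam x\<^sub>i + th)\<close> are bounded in \<open>W\<^sup>s\<^sup>,\<^sup>p\<close> and tend to \<open>0\<close> uniformly as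
  \<open>lam \<rightarrow> \<infinity>\<close>, but for one of the phases \<open>th \<in> {0, \<pi>/2}\<close> their \<open>W\<^sup>s\<^sup>t\<^sup>,\<^sup>p\<^sup>t\<close> norm stays away
  from \<open>0\<close>, because \<open>\<bar>sin a - sin b\<bar>\<close> and \<open>\<bar>cos a - cos b\<bar>\<close> are not both small when
  \<open>a - b\<close> is close to \<open>\<pi>\<close>; for \<open>pt = \<infinity>\<close> the phase is chosen so that a crest sits at a given point.
  If \<open>s - N/p < st < s\<close> and \<open>pt\<close> is at least critical, the same holds for the
  concentrating bumps \<open>lam\<^sup>N\<^sup>/\<^sup>p\<^sup>-\<^sup>s \<phi> (lam (x - x0))\<close>. Uniform convergence forces every
  limit in the target space to vanish a.e., which contradicts the lower bound.
\<close>

text \<open>For \<open>pt = \<infinity>\<close> or \<open>st = 1\<close> the target norm is an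
  infimum, over representatives or over weak gradients, and a limit in the target space is only
  known to vanish a.e. Hence every lower bound is proved for all \<open>w\<close> that agree a.e.
  with the constructed function, not just for that function. In the source space with finite
  \<open>p = P\<close> one estimate serves waves and bumps alike: amplitude \<open>M\<close>,
  frequency \<open>lam\<close> and support of measure \<open>m\<close> cost
  \<open>m * M powr P * lam powr (s * P)\<close>. For waves \<open>m\<close> is fixed, which
  dictates the amplitude \<open>lam powr (- s)\<close>; for bumps \<open>m\<close> is of order
  \<open>lam powr (- N)\<close>, which dictates \<open>lam powr (N / P - s)\<close>. The assumption
  \<open>s * p > N\<close> makes the second exponent negative, so even concentrating bumps tend to
  zero uniformly. With target exponent \<open>q\<close>, the Gagliardo energy of the bumps is
  bounded below by a multiple of \<open>lam powr ((N / P - s + st) * q - N)\<close>; the critical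
  exponent is the \<open>q\<close> at which this power stops decaying.\<close>

section \<open>Calculus of \<open>Ck\<close> functions\<close>

lemma partial_deriv_eqI:
  assumes "(f has_derivative D) (at x)"
  shows "partial_deriv i f x = D (axis i 1)"
  unfolding partial_deriv_def using frechet_derivative_at[OF assms] by simp

lemma partial_deriv_add:
  assumes "f differentiable (at x)" "g differentiable (at x)"
  shows "partial_deriv i (\<lambda>x. f x + g x) x = partial_deriv i f x + partial_deriv i g x"
proof -
  have "((\<lambda>x. f x + g x) has_derivative
      (\<lambda>h. frechet_derivative f (at x) h + frechet_derivative g (at x) h)) (at x)"
    using assms by (intro has_derivative_add) (simp_all add: frechet_derivative_works)
  from partial_deriv_eqI[OF this] show ?thesis by (simp add: partial_deriv_def)
qed

lemma partial_deriv_mult: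
  assumes "f differentiable (at x)" "g differentiable (at x)"
  shows "partial_deriv i (\<lambda>x. f x * g x) x = f x * partial_deriv i g x + partial_deriv i f x * g x"
proof -
  have "((\<lambda>x. f x * g x) has_derivative
      (\<lambda>h. f x * frechet_derivative g (at x) h + frechet_derivative f (at x) h * g x)) (at x)"
    using assms by (intro has_derivative_mult) (simp_all add: frechet_derivative_works)
  from partial_deriv_eqI[OF this] show ?thesis by (simp add: partial_deriv_def)
qed

lemma Ck_differentiable: "Ck (Suc k) f \<Longrightarrow> f differentiable (at x)"
  by simp

lemma Ck_Suc_imp_Ck: "Ck (Suc k) f \<Longrightarrow> Ck k f"
proof (induction k arbitrary: f)
  case 0
  then show ?case
    by (simp add: continuous_at_imp_continuous_on differentiable_imp_continuous_within)
qed auto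

lemma Ck_continuous: "Ck k f \<Longrightarrow> continuous_on UNIV f"
proof (induction k)
  case (Suc k)
  then show ?case using Ck_Suc_imp_Ck by blast
qed simp

lemma Ck_add: "Ck k f \<Longrightarrow> Ck k g \<Longrightarrow> Ck k (\<lambda>x. f x + g x)"
proof (induction k arbitrary: f g)
  case 0
  then show ?case by (simp add: continuous_on_add)
next
  case (Suc k)
  have "partial_deriv i (\<lambda>x. f x + g x) = (\<lambda>x. partial_deriv i f x + partial_deriv i g x)" for i
    using Suc.prems by (intro ext partial_deriv_add) auto
  then show ?case using Suc by auto
qed

lemma Ck_mult: "Ck k f \<Longrightarrow> Ck k g \<Longrightarrow> Ck k (\<lambda>x. f x * g x)"
proof (induction k arbitrary: f g)
  case 0
  then show ?case by (simp add: continuous_on_mult)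
next
  case (Suc k)
  have "partial_deriv i (\<lambda>x. f x * g x) = (\<lambda>x. f x * partial_deriv i g x + partial_deriv i f x * g x)" for i
    using Suc.prems by (intro ext partial_deriv_mult) auto
  moreover have "Ck k f" "Ck k g" using Suc.prems Ck_Suc_imp_Ck by blast+
  ultimately show ?case using Suc by (auto intro!: Ck_add)
qed

lemma Ck_const: "Ck k (\<lambda>x::real^'n. c)"
proof (induction k arbitrary: c)
  case (Suc k)
  have "partial_deriv i (\<lambda>x. c) = (\<lambda>x. 0)" for i :: 'n
    by (intro ext partial_deriv_eqI) simp
  then show ?case using Suc by simp
qed simp

lemma Ck_prod: "finite I \<Longrightarrow> (\<And>i. i \<in> I \<Longrightarrow> Ck k (f i)) \<Longrightarrow> Ck k (\<lambda>x. \<Prod>i\<in>I. f i x)"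
  by (induction I rule: finite_induct) (auto intro: Ck_const Ck_mult)

lemma has_derivative_affine_coordinate:
  fixes x :: "real^'n"
  assumes "(g has_real_derivative d) (at (a * x $ j + b))"
  shows "((\<lambda>x. g (a * x $ j + b)) has_derivative (\<lambda>h. d * (a * h $ j))) (at x)"
proof -
  have "((\<lambda>x. a * x $ j + b) has_derivative (\<lambda>h. a * h $ j)) (at x)"
    by (auto intro!: derivative_eq_intros bounded_linear.has_derivative[OF bounded_linear_vec_nth])
  from has_derivative_compose[OF this assms[unfolded has_field_derivative_def]]
  show ?thesis .
qed

text \<open>The sequence \<open>g\<close> is a function together with all its derivatives. Keeping
  \<open>m\<close> arbitrary closes the induction on \<open>k\<close>: a partial derivative of the
  \<open>m\<close>-th composition is a constant times the \<open>Suc m\<close>-th.\<close>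

lemma Ck_affine_coordinate:
  fixes g :: "nat \<Rightarrow> real \<Rightarrow> real" and j :: "'n::finite"
  assumes "\<And>m t. (g m has_real_derivative g (Suc m) t) (at t)"
  shows "Ck k (\<lambda>x::real^'n. g m (a * x $ j + b))"
proof (induction k arbitrary: m)
  case 0
  have "continuous_on UNIV (g m)"
    by (meson assms DERIV_isCont continuous_at_imp_continuous_on)
  then have "continuous_on UNIV (\<lambda>x::real^'n. g m (a * x $ j + b))"
    by (rule continuous_on_compose2) (intro continuous_intros, simp)
  then show ?case by simp
next
  case (Suc k)
  note D = has_derivative_affine_coordinate[OF assms]
  have P: "partial_deriv i (\<lambda>x. g m (a * x $ j + b)) =
      (\<lambda>x. (if i = j then a else 0) * g (Suc m) (a * x $ j + b))" for i
    by (intro ext, subst partial_deriv_eqI[OF D]) (auto simp: axis_def)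
  have "(\<lambda>x. g m (a * x $ j + b)) differentiable (at x)" for x :: "real^'n"
    using D unfolding differentiable_def by blast
  moreover have "Ck k (\<lambda>x::real^'n. (if i = j then a else 0) * g (Suc m) (a * x $ j + b))" for i
    by (intro Ck_mult Ck_const Suc)
  ultimately show ?case by (simp add: P)
qed

section \<open>Smooth bumps on cubes, built from the flat function\<close>

primrec exp_flat_poly :: "nat \<Rightarrow> real poly" where
  "exp_flat_poly 0 = 1"
| "exp_flat_poly (Suc m) = [:0, 0, 1:] * (exp_flat_poly m - pderiv (exp_flat_poly m))"

text \<open>The polynomials are those in the \<open>m\<close>-th derivative \<open>exp_flat m\<close> of the flat function \<open>exp (-1/t)\<close>.\<close>

definition exp_flat :: "nat \<Rightarrow> real \<Rightarrow> real" where
  "exp_flat m t = (if t > 0 then poly (exp_flat_poly m) (1 / t) * exp (- (1 / t)) else 0)"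

lemma poly_times_exp_minus_tendsto_0:
  fixes q :: "real poly"
  shows "((\<lambda>y. poly q y * exp (- y)) \<longlongrightarrow> 0) at_top"
proof -
  have "((\<lambda>y. coeff q i * (y ^ i / exp y)) \<longlongrightarrow> coeff q i * 0) at_top" for i
    by (intro tendsto_mult tendsto_const tendsto_power_div_exp_0)
  then have "((\<lambda>y. \<Sum>i\<le>degree q. coeff q i * (y ^ i / exp y)) \<longlongrightarrow> (\<Sum>i\<le>degree q. coeff q i * 0)) at_top"
    by (intro tendsto_sum) simp
  then show ?thesis
    by (simp add: poly_altdef sum_distrib_right exp_minus divide_inverse mult.assoc)
qed

lemma has_derivative_exp_flat: "(exp_flat m has_real_derivative exp_flat (Suc m) t) (at t)"
proof -
  consider "t > 0" | "t < 0" | "t = 0" by linarith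
  then show ?thesis
  proof cases
    case 1
    \<comment> \<open>With \<open>y = 1 / t\<close> and \<open>dy/dt = - y^2\<close>, the derivative
      of \<open>q(y) * exp (- y)\<close> is \<open>y^2 * (q - q')(y) * exp (- y)\<close>, which is
      the recursion of \<open>exp_flat_poly\<close>.\<close>
    have "((\<lambda>t. poly (exp_flat_poly m) (1 / t) * exp (- (1 / t))) has_real_derivative exp_flat (Suc m) t) (at t)"
      using 1 by (auto intro!: derivative_eq_intros DERIV_chain2[OF poly_DERIV]
          simp: exp_flat_def field_simps power2_eq_square)
    moreover have E: "\<forall>\<^sub>F t in nhds t. exp_flat m t = poly (exp_flat_poly m) (1 / t) * exp (- (1 / t))"
      using eventually_nhds_in_open[OF open_greaterThan, of t 0] 1
      by (auto simp: exp_flat_def elim!: eventually_mono)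
    ultimately show ?thesis by (subst DERIV_cong_ev[OF refl E refl])
  next
    case 2
    have "((\<lambda>t. 0) has_real_derivative exp_flat (Suc m) t) (at t)"
      using 2 by (simp add: exp_flat_def)
    moreover have E: "\<forall>\<^sub>F t in nhds t. exp_flat m t = 0"
      using eventually_nhds_in_open[OF open_lessThan, of t 0] 2
      by (auto simp: exp_flat_def elim!: eventually_mono)
    ultimately show ?thesis by (subst DERIV_cong_ev[OF refl E refl])
  next
    case 3
    \<comment> \<open>The difference quotient at 0 from the right is again a polynomial times
      \<open>exp (- y)\<close> in \<open>y = 1 / h\<close>; the factor \<open>[:0, 1:]\<close>
      accounts for the division by \<open>h\<close>.\<close>
    have "((\<lambda>h. poly ([:0, 1:] * exp_flat_poly m) (inverse h) * exp (- inverse h)) \<longlongrightarrow> 0) (at_right 0)"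
      by (rule filterlim_compose[OF poly_times_exp_minus_tendsto_0 filterlim_inverse_at_top_right])
    moreover have "\<forall>\<^sub>F h in at_right 0. poly ([:0, 1:] * exp_flat_poly m) (inverse h) * exp (- inverse h) = exp_flat m h / h"
      by (auto simp: exp_flat_def eventually_at_filter field_simps)
    ultimately have "((\<lambda>h. exp_flat m h / h) \<longlongrightarrow> 0) (at_right 0)"
      by (rule Lim_transform_eventually)
    moreover have "((\<lambda>h. exp_flat m h / h) \<longlongrightarrow> 0) (at_left 0)"
      by (rule tendsto_eventually) (auto simp: exp_flat_def eventually_at_filter)
    ultimately have "((\<lambda>h. exp_flat m h / h) \<longlongrightarrow> 0) (at 0)"
      by (simp add: filterlim_split_at)
    then show ?thesis using 3 by (simp add: has_field_derivative_iff exp_flat_def)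
  qed
qed

lemma exp_flat_0_bounds: "0 \<le> exp_flat 0 t" "exp_flat 0 t \<le> 1" "exp_flat 0 t = 0 \<longleftrightarrow> t \<le> 0"
  by (auto simp: exp_flat_def)

text \<open>The arguments are \<open>1 + (x $ i - a $ i) / r\<close> and
  \<open>1 - (x $ i - a $ i) / r\<close>, expanded to the affine form that
  \<open>Ck_affine_coordinate\<close> expects. Smoothness thus reduces to functions of one
  coordinate, at the price of a support that is a cube.\<close>

definition box_bump :: "real^'n \<Rightarrow> real \<Rightarrow> real^'n \<Rightarrow> real" where
  "box_bump a r x = (\<Prod>i\<in>UNIV. exp_flat 0 (1 / r * x $ i + (1 - a $ i / r)) *
     exp_flat 0 ((- 1 / r) * x $ i + (1 + a $ i / r)))"

lemma Ck_box_bump: "Ck k (box_bump a r)"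
  unfolding box_bump_def
  by (intro Ck_prod Ck_mult Ck_affine_coordinate has_derivative_exp_flat) auto

lemma box_bump_bounds: "0 \<le> box_bump a r x" "box_bump a r x \<le> 1"
  by (auto simp: box_bump_def exp_flat_0_bounds intro!: prod_nonneg prod_le_1 mult_le_one)

lemma box_bump_nonzero_iff:
  assumes "r > 0"
  shows "box_bump a r x \<noteq> 0 \<longleftrightarrow> (\<forall>i. \<bar>x $ i - a $ i\<bar> < r)"
proof -
  have "box_bump a r x \<noteq> 0 \<longleftrightarrow> (\<forall>i. 0 < 1 / r * x $ i + (1 - a $ i / r) \<and>
      0 < (- 1 / r) * x $ i + (1 + a $ i / r))"
    unfolding box_bump_def by (simp add: exp_flat_0_bounds(3) not_le)
  also have "\<dots> \<longleftrightarrow> (\<forall>i. \<bar>x $ i - a $ i\<bar> < r)"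
  proof (intro all_cong1)
    fix i
    show "(0 < 1 / r * x $ i + (1 - a $ i / r) \<and> 0 < (- 1 / r) * x $ i + (1 + a $ i / r)) \<longleftrightarrow> \<bar>x $ i - a $ i\<bar> < r"
    proof -
      have "1 / r * x $ i + (1 - a $ i / r) = (r - (a $ i - x $ i)) / r"
        "(- 1 / r) * x $ i + (1 + a $ i / r) = (r - (x $ i - a $ i)) / r"
        using assms by (simp_all add: field_simps)
      then show ?thesis using assms by (auto simp: zero_less_divide_iff abs_less_iff)
    qed
  qed
  finally show ?thesis .
qed

section \<open>Dyadic estimate of the singular kernel\<close>

lemma exists_dyadic_ge_1:
  fixes t :: real
  assumes "1 \<le> t"
  shows "\<exists>j. 2 ^ j \<le> t \<and> t < 2 ^ Suc j"
proof -
  obtain n where n: "t < 2 ^ n" using real_arch_pow[of 2 t] by auto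
  define m where "m = (LEAST n. t < 2 ^ n)"
  have m: "t < 2 ^ m" unfolding m_def by (rule LeastI[of _ n]) (rule n)
  have "m \<noteq> 0" using m assms by (metis not_le power_0)
  then obtain j where j: "m = Suc j" using not0_implies_Suc by blast
  have "\<not> t < 2 ^ j" using not_less_Least[of j "\<lambda>n. t < 2 ^ n"] j unfolding m_def by auto
  then show ?thesis using m j by (intro exI[of _ j]) auto
qed

lemma suminf_ennreal_geometric:
  assumes "0 \<le> B" "0 \<le> q" "q < 1"
  shows "(\<Sum>j. ennreal (B * q ^ j)) = ennreal (B / (1 - q))"
proof -
  have "(\<lambda>j. B * q ^ j) sums (B * (1 / (1 - q)))"
    using assms by (intro sums_mult geometric_sums) auto
  then show ?thesis
    using assms by (subst suminf_ennreal2) (auto simp: sums_iff)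
qed

lemma emeasure_lebesgue_cball:
  fixes x :: "'a::euclidean_space"
  assumes "0 \<le> r"
  shows "emeasure lebesgue (cball x r) = ennreal (unit_ball_vol DIM('a) * r ^ DIM('a))"
  using emeasure_cball[OF assms, of x] by simp

lemma cball_sets_lebesgue [measurable]: "cball x r \<in> sets lebesgue"
  by simp

text \<open>A ball of radius \<open>r j / lam\<close> has volume of order
  \<open>(r j / lam) ^ N\<close>, so the last hypothesis makes the integrated series geometric. The
  abstract weights serve both the shrinking balls near the diagonal and the growing balls far from
  it.\<close>

lemma dyadic_kernel_sum:
  fixes x :: "real^'n"
  assumes "0 < lam" "\<And>j. 0 \<le> c j" "\<And>j. 0 \<le> r j" "0 \<le> q" "q < 1" "0 \<le> B"
    and "\<And>j. c j * r j ^ CARD('n) = B * q ^ j"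
  shows "(\<integral>\<^sup>+y. (\<Sum>j. ennreal (c j) * indicator (cball x (r j / lam)) y) \<partial>lebesgue)
    \<le> ennreal (unit_ball_vol (real CARD('n)) * (B / (1 - q)) / lam ^ CARD('n))"
proof -
  have "(\<integral>\<^sup>+y. (\<Sum>j. ennreal (c j) * indicator (cball x (r j / lam)) y) \<partial>lebesgue)
      = (\<Sum>j. \<integral>\<^sup>+y. ennreal (c j) * indicator (cball x (r j / lam)) y \<partial>lebesgue)"
    by (intro nn_integral_suminf) measurable
  also have "\<dots> = (\<Sum>j. ennreal (c j) * ennreal (unit_ball_vol (real CARD('n)) * (r j / lam) ^ CARD('n)))"
    using assms emeasure_lebesgue_cball[of "r j / lam" x for j]
    by (simp add: nn_integral_cmult_indicator)
  also have "\<dots> = (\<Sum>j. ennreal (unit_ball_vol (real CARD('n)) * B / lam ^ CARD('n) * q ^ j))"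
  proof (intro suminf_cong)
    fix j
    have "c j * (unit_ball_vol (real CARD('n)) * (r j / lam) ^ CARD('n))
        = unit_ball_vol (real CARD('n)) * (c j * r j ^ CARD('n)) / lam ^ CARD('n)"
      by (simp add: power_divide)
    then show "ennreal (c j) * ennreal (unit_ball_vol (real CARD('n)) * (r j / lam) ^ CARD('n)) =
        ennreal (unit_ball_vol (real CARD('n)) * B / lam ^ CARD('n) * q ^ j)"
      using assms by (simp add: ennreal_mult'[symmetric])
  qed
  also have "\<dots> = ennreal (unit_ball_vol (real CARD('n)) * B / lam ^ CARD('n) / (1 - q))"
    using assms by (intro suminf_ennreal_geometric) auto
  finally show ?thesis by (simp add: field_simps)
qed

lemma term_le_suminf_ennreal:
  fixes f :: "nat \<Rightarrow> ennreal"
  shows "f j \<le> (\<Sum>j. f j)"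
  using sum_le_suminf[of f "{j}"] by auto

text \<open>Scaling out \<open>lam\<close> leaves
  \<open>min 1 t powr P / t powr (N + \<sigma> * P)\<close>, which is integrable near 0 because
  \<open>\<sigma> < 1\<close> and at infinity because \<open>\<sigma> * P > 0\<close>. Dyadic shells
  in \<open>t = lam * norm (x - y)\<close> make this quantitative, with \<open>K\<close> independent
  of \<open>x\<close> and \<open>lam\<close>.\<close>

lemma kernel_integral_le:
  fixes \<sigma> P :: real
  assumes "0 < \<sigma>" "\<sigma> < 1" "0 < P"
  obtains K where "0 \<le> K" and "\<And>lam (x :: real^'n). 0 < lam \<Longrightarrow>
    (\<integral>\<^sup>+y. ennreal (min 1 (lam * norm (x - y)) powr P / norm (x - y) powr (real CARD('n) + \<sigma> * P)) \<partial>lebesgue)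
      \<le> ennreal (K * lam powr (\<sigma> * P))"
proof -
  define N where "N = CARD('n)"
  define A where "A = real N + \<sigma> * P"
  define V where "V = unit_ball_vol (real N)"
  define q1 where "q1 = 2 powr (- ((1 - \<sigma>) * P))"
  define q2 where "q2 = 2 powr (- (\<sigma> * P))"
  define K where "K = V * (2 powr A / (1 - q1)) + V * (2 ^ N / (1 - q2))"
  have A: "A > 0" using assms by (auto simp: A_def intro: add_nonneg_pos)
  have q1: "0 \<le> q1" "q1 < 1" using assms by (auto simp: q1_def powr_less_one)
  have q2: "0 \<le> q2" "q2 < 1" using assms by (auto simp: q2_def powr_less_one)
  have V: "V \<ge> 0" by (simp add: V_def)
  have le: "(\<integral>\<^sup>+y. ennreal (min 1 (lam * norm (x - y)) powr P / norm (x - y) powr A) \<partial>lebesgue)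
      \<le> ennreal (K * lam powr (\<sigma> * P))" if lam: "0 < lam" for lam and x :: "real^'n"
  proof -
    \<comment> \<open>On the shell \<open>2 powr (- (j + 1)) \<le> t \<le> 2 powr (- j)\<close> the
      numerator is at most \<open>2 powr (- j * P)\<close> and the denominator at least
      \<open>2 powr (- (j + 1) * A)\<close>, which gives \<open>c\<close>. On
      \<open>2 ^ j \<le> t < 2 ^ Suc j\<close> the numerator is at most 1, which gives
      \<open>d\<close>. Enlarging each shell to a full ball is harmless for an upper bound.\<close>
    define c where "c j = lam powr A * (2 powr A * 2 powr (- real j * (P - A)))" for j :: nat
    define d where "d j = lam powr A * 2 powr (- real j * A)" for j :: nat
    define F where "F y = (\<Sum>j. ennreal (c j) * indicator (cball x ((1/2) ^ j / lam)) y)" for y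
    define G where "G y = (\<Sum>j. ennreal (d j) * indicator (cball x (2 ^ Suc j / lam)) y)" for y
    have two: "2 powr (- real j) = (1/2) ^ j" "2 powr real j = 2 ^ j" for j
      by (simp_all add: powr_minus powr_realpow power_divide inverse_eq_divide)
    have meas: "F \<in> borel_measurable lebesgue" "G \<in> borel_measurable lebesgue"
      unfolding F_def G_def by measurable
    have pt: "ennreal (min 1 (lam * norm (x - y)) powr P / norm (x - y) powr A) \<le> F y + G y" for y
    proof -
      define t where "t = lam * norm (x - y)"
      have n: "norm (x - y) = t / lam" using lam by (simp add: t_def)
      have "t \<ge> 0" using lam by (simp add: t_def)
      have eq: "min 1 (lam * norm (x - y)) powr P / norm (x - y) powr A = lam powr A * (min 1 t powr P / t powr A)"
        using lam \<open>t \<ge> 0\<close> by (simp add: t_def[symmetric] n powr_divide)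
      consider "t = 0" | "0 < t" "t < 1" | "1 \<le> t" using \<open>t \<ge> 0\<close> by linarith
      then show ?thesis
      proof cases
        case 1
        then show ?thesis unfolding eq by simp
      next
        case 2
        then obtain j where j: "2 ^ j \<le> 1 / t" "1 / t < 2 ^ Suc j"
          using exists_dyadic_ge_1[of "1 / t"] by auto
        have b: "t \<le> 2 powr (- real j)" "2 powr (- real (Suc j)) \<le> t"
          using j 2 by (auto simp: powr_minus powr_realpow field_simps simp del: power_Suc of_nat_Suc)
        have "min 1 t powr P \<le> (2 powr (- real j)) powr P"
          using b 2 assms by (intro powr_mono2) auto
        moreover have "(2 powr (- real (Suc j))) powr A \<le> t powr A"
          using b A by (intro powr_mono2) auto
        ultimately have "min 1 t powr P / t powr A \<le> (2 powr (- real j)) powr P / (2 powr (- real (Suc j))) powr A"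
          using 2 by (intro frac_le) auto
        also have "\<dots> = 2 powr A * 2 powr (- real j * (P - A))"
          by (simp add: powr_powr powr_diff[symmetric] powr_add[symmetric] algebra_simps)
        finally have "lam powr A * (min 1 t powr P / t powr A) \<le> c j"
          unfolding c_def by (intro mult_left_mono) auto
        moreover have "y \<in> cball x ((1/2) ^ j / lam)"
          using b lam unfolding two by (simp add: dist_norm n field_simps)
        ultimately have "ennreal (lam powr A * (min 1 t powr P / t powr A)) \<le> F y"
          unfolding F_def
          by (intro order.trans[OF _ term_le_suminf_ennreal[of _ j]]) (auto simp: ennreal_leI)
        then show ?thesis unfolding eq by (simp add: add_increasing2)
      next
        case 3
        then obtain j where j: "2 ^ j \<le> t" "t < 2 ^ Suc j"
          using exists_dyadic_ge_1[of t] by auto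
        have b: "2 powr real j \<le> t" using j by (simp add: powr_realpow)
        have "(2 powr real j) powr A \<le> t powr A"
          using b A by (intro powr_mono2) auto
        then have "min 1 t powr P / t powr A \<le> 1 / (2 powr real j) powr A"
          using 3 by (intro frac_le) auto
        also have "\<dots> = 2 powr (- real j * A)"
          by (simp add: powr_powr powr_minus_divide)
        finally have "lam powr A * (min 1 t powr P / t powr A) \<le> d j"
          unfolding d_def by (intro mult_left_mono) auto
        moreover have "y \<in> cball x (2 ^ Suc j / lam)"
          using j lam by (simp add: dist_norm n field_simps)
        ultimately have "ennreal (lam powr A * (min 1 t powr P / t powr A)) \<le> G y"
          unfolding G_def
          by (intro order.trans[OF _ term_le_suminf_ennreal[of _ j]]) (auto simp: ennreal_leI simp del: power_Suc)
        then show ?thesis unfolding eq by (simp add: add_increasing)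
      qed
    qed
    \<comment> \<open>The exponent \<open>P - A + N\<close> equals
      \<open>(1 - \<sigma>) * P\<close>, whence the ratio \<open>q1 < 1\<close>.\<close>
    have "c j * ((1/2) ^ j) ^ CARD('n) = (lam powr A * 2 powr A) * q1 ^ j" for j
    proof -
      have "((1/2) ^ j) ^ CARD('n) = 2 powr (- real j * real N)"
        by (simp add: two[symmetric] powr_power N_def mult.commute)
      moreover have "q1 ^ j = 2 powr (- real j * ((1 - \<sigma>) * P))"
        by (simp add: q1_def powr_power)
      moreover have "2 powr (- real j * (P - A)) * 2 powr (- real j * real N) = 2 powr (- real j * ((1 - \<sigma>) * P))"
        unfolding powr_add[symmetric] by (simp add: A_def algebra_simps)
      ultimately show ?thesis by (simp add: c_def mult.assoc)
    qed
    then have F: "(\<integral>\<^sup>+y. F y \<partial>lebesgue) \<le> ennreal (V * ((lam powr A * 2 powr A) / (1 - q1)) / lam ^ N)"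
      unfolding F_def V_def N_def
      using q1 lam by (intro dyadic_kernel_sum) (auto simp: c_def)
    have "d j * (2 ^ Suc j) ^ CARD('n) = (lam powr A * 2 ^ N) * q2 ^ j" for j
    proof -
      have "(2 ^ Suc j) ^ CARD('n) = 2 ^ N * 2 powr (real j * real N)"
        by (simp add: two[symmetric] powr_power N_def mult.commute power_mult_distrib)
      moreover have "q2 ^ j = 2 powr (- real j * (\<sigma> * P))"
        by (simp add: q2_def powr_power)
      moreover have "2 powr (- real j * A) * 2 powr (real j * real N) = 2 powr (- real j * (\<sigma> * P))"
        unfolding powr_add[symmetric] by (simp add: A_def algebra_simps)
      ultimately show ?thesis by (simp add: d_def)
    qed
    then have G: "(\<integral>\<^sup>+y. G y \<partial>lebesgue) \<le> ennreal (V * ((lam powr A * 2 ^ N) / (1 - q2)) / lam ^ N)"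
      unfolding G_def V_def N_def
      using q2 lam by (intro dyadic_kernel_sum) (auto simp: d_def simp del: power_Suc)
    have l: "lam powr A / lam ^ N = lam powr (\<sigma> * P)"
      using lam by (simp add: A_def powr_add powr_realpow)
    have "(\<integral>\<^sup>+y. ennreal (min 1 (lam * norm (x - y)) powr P / norm (x - y) powr A) \<partial>lebesgue)
        \<le> (\<integral>\<^sup>+y. F y + G y \<partial>lebesgue)"
      by (intro nn_integral_mono pt)
    also have "\<dots> = (\<integral>\<^sup>+y. F y \<partial>lebesgue) + (\<integral>\<^sup>+y. G y \<partial>lebesgue)"
      by (intro nn_integral_add meas)
    also have "\<dots> \<le> ennreal (V * ((lam powr A * 2 powr A) / (1 - q1)) / lam ^ N)
        + ennreal (V * ((lam powr A * 2 ^ N) / (1 - q2)) / lam ^ N)"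
      by (intro add_mono F G)
    also have "\<dots> = ennreal (K * lam powr (\<sigma> * P))"
    proof -
      have e: "V * (lam powr A * b / (1 - q)) / lam ^ N = V * (b / (1 - q)) * lam powr (\<sigma> * P)" for b q
        unfolding l[symmetric] by simp
      show ?thesis
        unfolding e using V q1 q2 by (subst ennreal_plus[symmetric]) (auto simp: K_def distrib_right)
    qed
    finally show ?thesis .
  qed
  show ?thesis
    by (rule that[of K]) (use le V q1 q2 in \<open>auto simp: K_def A_def N_def\<close>)
qed

section \<open>Gagliardo energies: Tonelli, null sets and an upper bound\<close>

lemma enn_powr_mono: "0 \<le> a \<Longrightarrow> x \<le> y \<Longrightarrow> enn_powr x a \<le> enn_powr y a"
  by (cases x; cases y)
    (auto simp: enn_powr_def top_unique intro!: ennreal_leI powr_mono2)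

lemma enn_powr_ennreal: "0 \<le> x \<Longrightarrow> enn_powr (ennreal x) a = ennreal (x powr a)"
  by (simp add: enn_powr_def)

lemma enn_powr_inverse: "0 < a \<Longrightarrow> enn_powr (enn_powr x a) (1 / a) = x"
  by (cases x) (auto simp: enn_powr_def powr_powr)

lemma sigma_finite_lebesgue_on:
  assumes "\<Omega> \<in> lmeasurable"
  shows "sigma_finite_measure (lebesgue_on \<Omega>)"
  using finite_measure_lebesgue_on[OF assms] by (rule finite_measure.axioms)

lemma measurable_gagliardo_kernel:
  fixes \<Omega> :: "(real^'n) set"
  assumes "u \<in> borel_measurable (lebesgue_on \<Omega>)"
  shows "(\<lambda>(x, y). ennreal (\<bar>u x - u y\<bar> powr p / norm (x - y) powr b))
    \<in> borel_measurable (lebesgue_on \<Omega> \<Otimes>\<^sub>M lebesgue_on \<Omega>)"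
proof -
  have [measurable]: "(\<lambda>x. x) \<in> lebesgue_on \<Omega> \<rightarrow>\<^sub>M (borel :: (real^'n) measure)"
    by (intro measurable_restrict_space1 measurable_completion) simp
  have [measurable]: "(\<lambda>z. fst z :: real^'n) \<in> borel_measurable (lebesgue_on \<Omega> \<Otimes>\<^sub>M lebesgue_on \<Omega>)"
    "(\<lambda>z. snd z :: real^'n) \<in> borel_measurable (lebesgue_on \<Omega> \<Otimes>\<^sub>M lebesgue_on \<Omega>)"
    by (auto intro: measurable_compose[OF measurable_fst] measurable_compose[OF measurable_snd])
  note assms[measurable]
  have [measurable]: "(\<lambda>z. u (fst z)) \<in> borel_measurable (lebesgue_on \<Omega> \<Otimes>\<^sub>M lebesgue_on \<Omega>)"
    "(\<lambda>z. u (snd z)) \<in> borel_measurable (lebesgue_on \<Omega> \<Otimes>\<^sub>M lebesgue_on \<Omega>)"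
    by (auto intro: measurable_compose[OF measurable_fst] measurable_compose[OF measurable_snd] assms)
  show ?thesis unfolding case_prod_beta by measurable
qed

lemma gagliardo_integral_iterated:
  fixes \<Omega> :: "(real^'n) set"
  assumes "\<Omega> \<in> lmeasurable" "u \<in> borel_measurable (lebesgue_on \<Omega>)"
  shows "(\<integral>\<^sup>+(x, y). ennreal (\<bar>u x - u y\<bar> powr p / norm (x - y) powr b) \<partial>(lebesgue_on \<Omega> \<Otimes>\<^sub>M lebesgue_on \<Omega>))
    = (\<integral>\<^sup>+x. (\<integral>\<^sup>+y. ennreal (\<bar>u x - u y\<bar> powr p / norm (x - y) powr b) \<partial>lebesgue_on \<Omega>) \<partial>lebesgue_on \<Omega>)"
  using sigma_finite_measure.nn_integral_fst[OF sigma_finite_lebesgue_on[OF assms(1)] measurable_gagliardo_kernel[OF assms(2)], symmetric]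
  by (simp add: case_prod_beta)

text \<open>In iterated form the exceptional null set is discarded once in each variable, so no null
  set of the product measure has to be described.\<close>

lemma gagliardo_integral_AE_cong:
  fixes \<Omega> :: "(real^'n) set"
  assumes "\<Omega> \<in> lmeasurable" "u \<in> borel_measurable (lebesgue_on \<Omega>)" "w \<in> borel_measurable (lebesgue_on \<Omega>)"
    and "AE x in lebesgue_on \<Omega>. w x = u x"
  shows "(\<integral>\<^sup>+(x, y). ennreal (\<bar>w x - w y\<bar> powr p / norm (x - y) powr b) \<partial>(lebesgue_on \<Omega> \<Otimes>\<^sub>M lebesgue_on \<Omega>))
    = (\<integral>\<^sup>+(x, y). ennreal (\<bar>u x - u y\<bar> powr p / norm (x - y) powr b) \<partial>(lebesgue_on \<Omega> \<Otimes>\<^sub>M lebesgue_on \<Omega>))"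
proof -
  have "(\<integral>\<^sup>+y. ennreal (\<bar>w x - w y\<bar> powr p / norm (x - y) powr b) \<partial>lebesgue_on \<Omega>)
      = (\<integral>\<^sup>+y. ennreal (\<bar>u x - u y\<bar> powr p / norm (x - y) powr b) \<partial>lebesgue_on \<Omega>)" if "w x = u x" for x
    using assms(4) by (intro nn_integral_cong_AE) (auto simp: that)
  then have "AE x in lebesgue_on \<Omega>. (\<integral>\<^sup>+y. ennreal (\<bar>w x - w y\<bar> powr p / norm (x - y) powr b) \<partial>lebesgue_on \<Omega>)
      = (\<integral>\<^sup>+y. ennreal (\<bar>u x - u y\<bar> powr p / norm (x - y) powr b) \<partial>lebesgue_on \<Omega>)"
    using assms(4) by (auto elim: AE_mp)
  then show ?thesis
    unfolding gagliardo_integral_iterated[OF assms(1,2)] gagliardo_integral_iterated[OF assms(1,3)]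
    by (rule nn_integral_cong_AE)
qed

text \<open>The integrand vanishes unless \<open>x\<close> or \<open>y\<close> lies in
  \<open>A\<close>. Both cases are covered by \<open>F x y + F y x\<close>, where \<open>F\<close>
  carries the indicator of \<open>A\<close> in its first variable. Each summand integrates to at
  most \<open>m * M powr P\<close> times the kernel bound, whence the factor 2.\<close>

lemma gagliardo_integral_le:
  fixes \<Omega> :: "(real^'n) set" and P \<sigma> :: real
  assumes \<Omega>: "\<Omega> \<in> lmeasurable" and u: "u \<in> borel_measurable (lebesgue_on \<Omega>)"
    and A: "A \<in> sets lebesgue" "emeasure lebesgue A \<le> ennreal m" and "0 \<le> m" "0 \<le> M" "0 < lam" "0 < P"
    and bd: "\<And>x y. x \<in> \<Omega> \<Longrightarrow> y \<in> \<Omega> \<Longrightarrow> \<bar>u x - u y\<bar> \<le> M * min 1 (lam * norm (x - y))"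
    and off: "\<And>x. x \<in> \<Omega> - A \<Longrightarrow> u x = 0"
    and K: "0 \<le> K" "\<And>x :: real^'n. (\<integral>\<^sup>+y. ennreal (min 1 (lam * norm (x - y)) powr P / norm (x - y) powr (real CARD('n) + \<sigma> * P)) \<partial>lebesgue)
      \<le> ennreal (K * lam powr (\<sigma> * P))"
  shows "(\<integral>\<^sup>+(x, y). ennreal (\<bar>u x - u y\<bar> powr P / norm (x - y) powr (real CARD('n) + \<sigma> * P)) \<partial>(lebesgue_on \<Omega> \<Otimes>\<^sub>M lebesgue_on \<Omega>))
    \<le> ennreal (2 * m * M powr P * K * lam powr (\<sigma> * P))"
proof -
  let ?L = "lebesgue_on \<Omega>"
  define k where "k x y = ennreal (min 1 (lam * norm (x - y)) powr P / norm (x - y) powr (real CARD('n) + \<sigma> * P))" for x y :: "real^'n"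
  define F where "F x y = ennreal (M powr P) * (indicator A x * k x y)" for x y
  have [measurable]: "(\<lambda>x. x) \<in> ?L \<rightarrow>\<^sub>M (borel :: (real^'n) measure)"
    by (intro measurable_restrict_space1 measurable_completion) simp
  have [measurable]: "(\<lambda>z. fst z :: real^'n) \<in> borel_measurable (?L \<Otimes>\<^sub>M ?L)"
    "(\<lambda>z. snd z :: real^'n) \<in> borel_measurable (?L \<Otimes>\<^sub>M ?L)"
    by (auto intro: measurable_compose[OF measurable_fst] measurable_compose[OF measurable_snd])
  have ind: "indicator A \<in> borel_measurable ?L"
    using A(1) by (intro measurable_restrict_space1 borel_measurable_indicator)
  have [measurable]: "(\<lambda>z. indicator A (fst z) :: ennreal) \<in> borel_measurable (?L \<Otimes>\<^sub>M ?L)"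
    by (rule measurable_compose[OF measurable_fst ind])
  have [measurable]: "(\<lambda>z. k (fst z) (snd z)) \<in> borel_measurable (?L \<Otimes>\<^sub>M ?L)"
    unfolding k_def by measurable
  have F[measurable]: "(\<lambda>z. F (fst z) (snd z)) \<in> borel_measurable (?L \<Otimes>\<^sub>M ?L)"
    unfolding F_def by measurable
  have swap: "(\<lambda>z. F (snd z) (fst z)) \<in> borel_measurable (?L \<Otimes>\<^sub>M ?L)"
    using measurable_compose[OF measurable_pair_swap' F] by (simp add: case_prod_beta)
  interpret L: sigma_finite_measure ?L by (rule sigma_finite_lebesgue_on[OF \<Omega>])
  interpret LL: pair_sigma_finite ?L ?L ..
  have pt: "ennreal (\<bar>u x - u y\<bar> powr P / norm (x - y) powr (real CARD('n) + \<sigma> * P)) \<le> F x y + F y x"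
    if "x \<in> \<Omega>" "y \<in> \<Omega>" for x y
  proof (cases "x \<in> A \<or> y \<in> A")
    case False
    then show ?thesis using off that \<open>0 < P\<close> by simp
  next
    case True
    have ksym: "k y x = k x y" by (simp add: k_def norm_minus_commute)
    have "\<bar>u x - u y\<bar> powr P \<le> (M * min 1 (lam * norm (x - y))) powr P"
      using bd[OF that] \<open>0 < P\<close> by (intro powr_mono2) auto
    also have "\<dots> = M powr P * min 1 (lam * norm (x - y)) powr P"
      using \<open>0 \<le> M\<close> \<open>0 < lam\<close> by (intro powr_mult)
    finally have "\<bar>u x - u y\<bar> powr P / norm (x - y) powr (real CARD('n) + \<sigma> * P)
        \<le> M powr P * (min 1 (lam * norm (x - y)) powr P / norm (x - y) powr (real CARD('n) + \<sigma> * P))"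
      by (simp add: divide_right_mono)
    then have "ennreal (\<bar>u x - u y\<bar> powr P / norm (x - y) powr (real CARD('n) + \<sigma> * P)) \<le> ennreal (M powr P) * k x y"
      unfolding k_def by (subst ennreal_mult[symmetric]) (auto intro: ennreal_leI)
    moreover have "ennreal (M powr P) * k x y \<le> F x y + F y x"
      using True by (auto simp: F_def ksym indicator_def)
    ultimately show ?thesis by (rule order.trans)
  qed
  have one: "(\<integral>\<^sup>+x. (\<integral>\<^sup>+y. F x y \<partial>?L) \<partial>?L) \<le> ennreal (m * M powr P * K * lam powr (\<sigma> * P))"
  proof -
    have "(\<integral>\<^sup>+y. k x y \<partial>?L) \<le> ennreal (K * lam powr (\<sigma> * P))" for x
    proof -
      have "(\<integral>\<^sup>+y. k x y \<partial>?L) = (\<integral>\<^sup>+y. k x y * indicator \<Omega> y \<partial>lebesgue)"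
        using fmeasurableD[OF \<Omega>] by (intro nn_integral_restrict_space) simp
      also have "\<dots> \<le> (\<integral>\<^sup>+y. k x y \<partial>lebesgue)"
        by (intro nn_integral_mono) (auto simp: indicator_def)
      also have "\<dots> \<le> ennreal (K * lam powr (\<sigma> * P))" unfolding k_def by (rule K)
      finally show ?thesis .
    qed
    moreover have "(\<integral>\<^sup>+y. F x y \<partial>?L) = ennreal (M powr P) * (indicator A x * (\<integral>\<^sup>+y. k x y \<partial>?L))" for x
    proof -
      have "(\<lambda>y. k x y) \<in> borel_measurable ?L" unfolding k_def by measurable
      then show ?thesis unfolding F_def by (simp add: nn_integral_cmult)
    qed
    ultimately have "(\<integral>\<^sup>+x. (\<integral>\<^sup>+y. F x y \<partial>?L) \<partial>?L) \<le>
        (\<integral>\<^sup>+x. ennreal (M powr P) * (indicator A x * ennreal (K * lam powr (\<sigma> * P))) \<partial>?L)"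
      by (intro nn_integral_mono) (auto intro!: mult_left_mono)
    also have "\<dots> = (\<integral>\<^sup>+x. ennreal (M powr P) * (indicator A x * ennreal (K * lam powr (\<sigma> * P))) * indicator \<Omega> x \<partial>lebesgue)"
      using fmeasurableD[OF \<Omega>] by (intro nn_integral_restrict_space) simp
    also have "\<dots> \<le> (\<integral>\<^sup>+x. (ennreal (M powr P) * ennreal (K * lam powr (\<sigma> * P))) * indicator A x \<partial>lebesgue)"
      by (intro nn_integral_mono) (auto simp: indicator_def)
    also have "\<dots> = (ennreal (M powr P) * ennreal (K * lam powr (\<sigma> * P))) * emeasure lebesgue A"
      using A by (intro nn_integral_cmult_indicator)
    also have "\<dots> \<le> (ennreal (M powr P) * ennreal (K * lam powr (\<sigma> * P))) * ennreal m"
      by (intro mult_left_mono A) simp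
    also have "\<dots> = ennreal (m * M powr P * K * lam powr (\<sigma> * P))"
      using K \<open>0 \<le> m\<close> by (simp add: ennreal_mult[symmetric] mult_ac)
    finally show ?thesis .
  qed
  have "(\<integral>\<^sup>+(x, y). ennreal (\<bar>u x - u y\<bar> powr P / norm (x - y) powr (real CARD('n) + \<sigma> * P)) \<partial>(?L \<Otimes>\<^sub>M ?L))
      \<le> (\<integral>\<^sup>+z. F (fst z) (snd z) + F (snd z) (fst z) \<partial>(?L \<Otimes>\<^sub>M ?L))"
    by (intro nn_integral_mono) (auto simp: space_pair_measure intro!: pt)
  also have "\<dots> = (\<integral>\<^sup>+z. F (fst z) (snd z) \<partial>(?L \<Otimes>\<^sub>M ?L)) + (\<integral>\<^sup>+z. F (snd z) (fst z) \<partial>(?L \<Otimes>\<^sub>M ?L))"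
    by (intro nn_integral_add F swap)
  also have "\<dots> = (\<integral>\<^sup>+x. (\<integral>\<^sup>+y. F x y \<partial>?L) \<partial>?L) + (\<integral>\<^sup>+x. (\<integral>\<^sup>+y. F x y \<partial>?L) \<partial>?L)"
    using L.nn_integral_fst[OF F] LL.nn_integral_snd[OF swap[folded case_prod_beta]]
    by (simp add: case_prod_beta)
  also have "\<dots> \<le> ennreal (m * M powr P * K * lam powr (\<sigma> * P)) + ennreal (m * M powr P * K * lam powr (\<sigma> * P))"
    by (intro add_mono one)
  also have "\<dots> = ennreal (2 * m * M powr P * K * lam powr (\<sigma> * P))"
    using K \<open>0 \<le> m\<close> by (subst ennreal_plus[symmetric]) auto
  finally show ?thesis .
qed

section \<open>Integration by parts and weak gradients of C1 functions\<close>

lemma integrable_continuous_bounded_support: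
  fixes h :: "'a::euclidean_space \<Rightarrow> real"
  assumes "continuous_on UNIV h" "\<And>x. x \<notin> cball 0 R \<Longrightarrow> h x = 0"
  shows "integrable lborel h"
proof -
  have "integrable lborel (\<lambda>x. indicator (cball 0 R) x *\<^sub>R h x)"
    using assms(1) by (intro borel_integrable_compact continuous_on_subset[OF assms(1)]) auto
  moreover have "(\<lambda>x. indicator (cball 0 R) x *\<^sub>R h x) = h"
    using assms(2) by (auto simp: fun_eq_iff indicator_def)
  ultimately show ?thesis by simp
qed

lemma integrable_lborel_translation:
  fixes f :: "'a::euclidean_space \<Rightarrow> real"
  assumes "integrable lborel f"
  shows "integrable lborel (\<lambda>x. f (x + c))"
proof -
  have "integrable (distr lborel borel ((+) c)) f"
    using assms by (simp add: lborel_distr_plus)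
  then have "integrable lborel (\<lambda>x. f (c + x))"
    by (rule integrable_distr[rotated]) simp
  then show ?thesis by (simp only: add.commute)
qed

lemma integral_lborel_translation:
  fixes f :: "'a::euclidean_space \<Rightarrow> real"
  assumes "f \<in> borel_measurable borel"
  shows "(LINT x|lborel. f (x + c)) = (LINT x|lborel. f x)"
proof -
  have "(LINT x|distr lborel borel ((+) c). f x) = (LINT x|lborel. f (c + x))"
    using assms by (intro integral_distr) auto
  then show ?thesis by (simp only: lborel_distr_plus add.commute)
qed

text \<open>
  The integral of a difference quotient vanishes by translation invariance, and the difference
  quotients are dominated because \<open>f\<close> has bounded support.
\<close>

lemma integral_directional_derivative_eq_0:
  fixes f :: "'a::euclidean_space \<Rightarrow> real"
  assumes f: "\<And>x. (f has_derivative f' x) (at x)" and c: "continuous_on UNIV (\<lambda>x. f' x e)"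
    and e: "norm e = 1" and supp: "\<And>x. x \<notin> cball 0 R \<Longrightarrow> f x = 0"
  shows "(LINT x|lborel. f' x e) = 0"
proof -
  have cf: "continuous_on UNIV f"
    by (intro continuous_at_imp_continuous_on ballI has_derivative_continuous[OF f])
  have intf: "integrable lborel f"
    by (rule integrable_continuous_bounded_support[OF cf supp])
  have line: "((\<lambda>t. f (x + t *\<^sub>R e)) has_real_derivative f' (x + t *\<^sub>R e) e) (at t)" for x t
  proof -
    have "((\<lambda>t. x + t *\<^sub>R e) has_derivative (\<lambda>t. t *\<^sub>R e)) (at t)"
      by (auto intro!: derivative_eq_intros)
    from has_derivative_compose[OF this f]
    have "((\<lambda>t. f (x + t *\<^sub>R e)) has_derivative (\<lambda>h. f' (x + t *\<^sub>R e) (h *\<^sub>R e))) (at t)" .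
    moreover have "f' (x + t *\<^sub>R e) (h *\<^sub>R e) = f' (x + t *\<^sub>R e) e * h" for h
      using linear_cmul[OF has_derivative_linear[OF f]] by simp
    ultimately show ?thesis by (simp add: has_field_derivative_def)
  qed
  \<comment> \<open>The steps \<open>h n\<close> are at most 1, so all difference quotients are
    supported in \<open>cball 0 (R + 1)\<close>. The mean value theorem evaluates the derivative up
    to distance 1 further out, hence the radius \<open>R + 2\<close>.\<close>
  have "compact ((\<lambda>x. f' x e) ` cball 0 (R + 2))"
    by (intro compact_continuous_image continuous_on_subset[OF c]) auto
  then have "bounded ((\<lambda>x. f' x e) ` cball 0 (R + 2))"
    by (rule compact_imp_bounded)
  then obtain L where "\<forall>x\<in>cball 0 (R + 2). \<bar>f' x e\<bar> \<le> L"
    unfolding bounded_iff real_norm_def ball_simps by blast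
  then have L: "\<bar>f' x e\<bar> \<le> L" if "x \<in> cball 0 (R + 2)" for x using that by blast
  define h where "h n = inverse (real (Suc n))" for n
  have h: "0 < h n" "h n \<le> 1" for n by (simp_all add: h_def field_simps)
  define g where "g n x = (f (x + h n *\<^sub>R e) - f x) / h n" for n x
  have lim: "(\<lambda>n. g n x) \<longlonglongrightarrow> f' x e" for x
  proof -
    have "(\<lambda>t. (f (x + t *\<^sub>R e) - f x) / t) \<midarrow>0\<rightarrow> f' x e"
      using line[of x 0] by (simp add: has_field_derivative_iff)
    moreover have "filterlim h (at 0) sequentially"
      unfolding filterlim_at
    proof
      show "\<forall>\<^sub>F n in sequentially. h n \<in> UNIV \<and> h n \<noteq> 0"
        using h(1) by (intro always_eventually) (metis UNIV_I less_irrefl)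
      show "h \<longlonglongrightarrow> 0" unfolding h_def by (rule LIMSEQ_inverse_real_of_nat)
    qed
    ultimately show ?thesis unfolding g_def by (rule filterlim_compose)
  qed
  have bound: "\<bar>g n x\<bar> \<le> indicator (cball 0 (R + 1)) x *\<^sub>R L" for n x
  proof (cases "x \<in> cball 0 (R + 1)")
    case False
    have "norm (h n *\<^sub>R e) \<le> 1" using h[of n] e by (simp add: less_imp_le)
    then have "norm x - 1 \<le> norm (x + h n *\<^sub>R e)" using norm_diff_ineq[of x "h n *\<^sub>R e"] by linarith
    then have "x \<notin> cball 0 R" "x + h n *\<^sub>R e \<notin> cball 0 R"
      using False by (simp_all add: not_le)
    then have "g n x = 0" by (simp add: g_def supp)
    moreover have "indicator (cball 0 (R + 1)) x = (0::real)"
      using False by (rule indicator_simps)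
    ultimately show ?thesis by simp
  next
    case True
    have "\<exists>z>0. z < h n \<and> f (x + h n *\<^sub>R e) - f (x + 0 *\<^sub>R e) = (h n - 0) * f' (x + z *\<^sub>R e) e"
      by (rule MVT2[OF h(1) line])
    then obtain z where z: "0 < z" "z < h n" "f (x + h n *\<^sub>R e) - f (x + 0 *\<^sub>R e) = (h n - 0) * f' (x + z *\<^sub>R e) e"
      by blast
    have "norm (x + z *\<^sub>R e) \<le> norm x + norm (z *\<^sub>R e)" by (rule norm_triangle_ineq)
    moreover have "norm (z *\<^sub>R e) \<le> 1" using z h[of n] e by simp
    ultimately have "norm (x + z *\<^sub>R e) \<le> R + 2" using True by simp
    then have "\<bar>f' (x + z *\<^sub>R e) e\<bar> \<le> L" by (intro L) simp
    moreover have "g n x = f' (x + z *\<^sub>R e) e"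
      unfolding g_def using z(3) h(1)[of n] by (simp add: less_imp_neq[symmetric])
    moreover have "indicator (cball 0 (R + 1)) x = (1::real)"
      using True by (rule indicator_simps)
    ultimately show ?thesis by simp
  qed
  have [measurable]: "(\<lambda>x. f' x e) \<in> borel_measurable borel" "f \<in> borel_measurable borel"
    by (intro borel_measurable_continuous_onI c cf)+
  have "(\<lambda>n. LINT x|lborel. g n x) \<longlonglongrightarrow> (LINT x|lborel. f' x e)"
  proof (rule integral_dominated_convergence)
    show "integrable lborel (\<lambda>x::'a. indicator (cball 0 (R + 1)) x *\<^sub>R L)"
      by (intro borel_integrable_compact) auto
    show "g n \<in> borel_measurable lborel" for n unfolding g_def by measurable
  qed (use lim bound in auto)
  moreover have "(LINT x|lborel. g n x) = 0" for n
  proof -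
    have "integrable lborel (\<lambda>x. f (x + h n *\<^sub>R e))"
      "(LINT x|lborel. f (x + h n *\<^sub>R e)) = (LINT x|lborel. f x)"
      by (intro integrable_lborel_translation intf, intro integral_lborel_translation) measurable
    then show ?thesis unfolding g_def using intf by simp
  qed
  ultimately have "(\<lambda>n. 0) \<longlonglongrightarrow> (LINT x|lborel. f' x e)" by simp
  then show ?thesis by (simp add: LIMSEQ_const_iff)
qed

lemma locally_integrable_continuous:
  assumes "continuous_on UNIV u"
  shows "locally_integrable \<Omega> u"
  unfolding locally_integrable_def set_integrable_def
proof (intro allI impI)
  fix K assume K: "compact K \<and> K \<subseteq> \<Omega>"
  then have "integrable lborel (\<lambda>x. indicator K x *\<^sub>R u x)"
    using assms by (intro borel_integrable_compact) (auto intro: continuous_on_subset)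
  then show "integrable lebesgue (\<lambda>x. indicator K x *\<^sub>R u x)"
    using borel_measurable_integrable integrable_completion by blast
qed

text \<open>The complement of the support is open, so the derivative vanishes there too. This lets
  integrals over \<Omega> against a test function be taken over the whole space.\<close>

lemma test_function_zero_outside:
  assumes "test_function \<Omega> \<phi>" "x \<notin> \<Omega>"
  shows "\<phi> x = 0" "partial_deriv i \<phi> x = 0"
proof -
  let ?S = "closure {x. \<phi> x \<noteq> 0}"
  have x: "x \<in> - ?S" using assms unfolding test_function_def by blast
  have z: "\<phi> y = 0" if "y \<in> - ?S" for y
  proof (rule ccontr)
    assume "\<phi> y \<noteq> 0"
    then have "y \<in> ?S" by (intro subsetD[OF closure_subset]) simp
    with that show False by simp
  qed
  from z[OF x] show "\<phi> x = 0" .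
  have "((\<lambda>x. 0) has_derivative (\<lambda>h. 0)) (at x)" by simp
  then have "(\<phi> has_derivative (\<lambda>h. 0)) (at x)"
    by (rule has_derivative_transform_within_open[OF _ open_Compl[OF closed_closure] x z[symmetric]])
  from partial_deriv_eqI[OF this] show "partial_deriv i \<phi> x = 0" .
qed

lemma integral_lebesgue_on_eq_lborel:
  fixes h :: "'a::euclidean_space \<Rightarrow> real"
  assumes "\<Omega> \<in> sets lebesgue" "continuous_on UNIV h" "\<And>x. x \<notin> \<Omega> \<Longrightarrow> h x = 0"
  shows "(LINT x|lebesgue_on \<Omega>. h x) = (LINT x|lborel. h x)"
proof -
  have "(LINT x|lebesgue_on \<Omega>. h x) = (LINT x|lebesgue. indicator \<Omega> x *\<^sub>R h x)"
    using assms(1) by (intro integral_restrict_space) simp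
  also have "(\<lambda>x. indicator \<Omega> x *\<^sub>R h x) = h"
    using assms(3) by (auto simp: fun_eq_iff indicator_def)
  also have "(LINT x|lebesgue. h x) = (LINT x|lborel. h x)"
    using borel_measurable_continuous_onI[OF assms(2)] by (intro integral_completion) simp
  finally show ?thesis .
qed

text \<open>By the product rule the claim says that the \<open>i\<close>-th partial derivative of
  \<open>u * \<phi>\<close> integrates to 0. All integrals move to the whole space, where this
  product is C1 with bounded support and the translation argument applies.\<close>

lemma has_weak_gradient_C1:
  fixes \<Omega> :: "(real^'n) set"
  assumes \<Omega>: "\<Omega> \<in> sets lebesgue" and u: "\<And>x. (u has_derivative (\<lambda>h. Du x \<bullet> h)) (at x)"
    and Du: "continuous_on UNIV Du"
  shows "has_weak_gradient \<Omega> u Du"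
proof -
  have cu: "continuous_on UNIV u"
    by (intro continuous_at_imp_continuous_on ballI has_derivative_continuous[OF u])
  have cDu: "continuous_on UNIV (\<lambda>x. Du x $ i)" for i
    by (intro continuous_intros Du)
  have "(LINT x|lebesgue_on \<Omega>. u x * partial_deriv i \<phi> x) = - (LINT x|lebesgue_on \<Omega>. Du x $ i * \<phi> x)"
    if t: "test_function \<Omega> \<phi>" for \<phi> i
  proof -
    have "Ck 1 \<phi>" using t unfolding test_function_def by blast
    then have d\<phi>: "\<phi> differentiable (at x)" and cd\<phi>: "continuous_on UNIV (partial_deriv i \<phi>)" for x
      by auto
    have c\<phi>: "continuous_on UNIV \<phi>"
      by (intro continuous_at_imp_continuous_on ballI differentiable_imp_continuous_within[OF d\<phi>])
    have "bounded {x. \<phi> x \<noteq> 0}"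
      using t bounded_subset[OF compact_imp_bounded closure_subset] unfolding test_function_def by blast
    then obtain R where R: "{x. \<phi> x \<noteq> 0} \<subseteq> ball 0 R"
      using bounded_subset_ballD by blast
    have "\<phi> x = 0" if "x \<notin> ball 0 R" for x using R that by auto
    then have s0: "\<phi> x = 0" if "x \<notin> cball 0 R" for x using that by auto
    have s1: "partial_deriv i \<phi> x = 0" if "x \<notin> cball 0 R" for x
    proof -
      have "closure {x. \<phi> x \<noteq> 0} \<subseteq> cball 0 R"
        using s0 by (intro closure_minimal subsetI) (blast, rule closed_cball)
      \<comment> \<open>The ball contains the support of \<phi>, so \<phi> is a test function on it
        as well and its derivatives vanish outside.\<close>
      then have "test_function (cball 0 R) \<phi>" using t unfolding test_function_def by blast
      from test_function_zero_outside(2)[OF this that] show ?thesis .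
    qed
    define D where "D x h = u x * frechet_derivative \<phi> (at x) h + (Du x \<bullet> h) * \<phi> x" for x h
    have "((\<lambda>x. u x * \<phi> x) has_derivative D x) (at x)" for x
      unfolding D_def using has_derivative_mult[OF u d\<phi>[unfolded frechet_derivative_works]] .
    moreover have Deq: "D x (axis i 1) = u x * partial_deriv i \<phi> x + Du x $ i * \<phi> x" for x
      by (simp add: D_def partial_deriv_def inner_axis)
    moreover have "continuous_on UNIV (\<lambda>x. D x (axis i 1))"
      unfolding Deq by (intro continuous_intros cu cDu c\<phi> cd\<phi>)
    ultimately have "(LINT x|lborel. u x * partial_deriv i \<phi> x + Du x $ i * \<phi> x) = 0"
      using integral_directional_derivative_eq_0[of "\<lambda>x. u x * \<phi> x" D "axis i 1" R] s0
      by simp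
    moreover have "integrable lborel (\<lambda>x. u x * partial_deriv i \<phi> x)"
      by (rule integrable_continuous_bounded_support[of _ R]) (auto intro!: continuous_on_mult cu cd\<phi> simp: s1)
    moreover have "integrable lborel (\<lambda>x. Du x $ i * \<phi> x)"
      by (rule integrable_continuous_bounded_support[of _ R]) (auto intro!: continuous_on_mult cDu c\<phi> simp: s0)
    ultimately have "(LINT x|lborel. u x * partial_deriv i \<phi> x) = - (LINT x|lborel. Du x $ i * \<phi> x)"
      by simp
    moreover have "(LINT x|lebesgue_on \<Omega>. u x * partial_deriv i \<phi> x) = (LINT x|lborel. u x * partial_deriv i \<phi> x)"
      using test_function_zero_outside[OF t] by (intro integral_lebesgue_on_eq_lborel \<Omega> continuous_on_mult cu cd\<phi>) auto
    moreover have "(LINT x|lebesgue_on \<Omega>. Du x $ i * \<phi> x) = (LINT x|lborel. Du x $ i * \<phi> x)"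
      using test_function_zero_outside[OF t] by (intro integral_lebesgue_on_eq_lborel \<Omega> continuous_on_mult cDu c\<phi>) auto
    ultimately show ?thesis by simp
  qed
  with locally_integrable_continuous[OF cu] locally_integrable_continuous[OF cDu] show ?thesis
    unfolding has_weak_gradient_def by blast
qed

section \<open>Upper bounds in the source space\<close>

text \<open>Since \<open>p + N \<ge> 2\<close>, the argument of the Gamma function in the numerator
  is at least \<open>p * s / 2 > 0\<close>.\<close>

lemma gagliardo_const_pos:
  assumes "0 < s" "s < 1" "1 \<le> p" "1 \<le> N"
  shows "0 < gagliardo_const N s p"
proof -
  have "0 < p * s" "1 \<le> real N" using assms by simp_all
  then have "0 < (p * s + p + real N - 2) / 2" using assms(3) by (intro divide_pos_pos) linarith+
  then show ?thesis using assms unfolding gagliardo_const_def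
    by (intro divide_pos_pos mult_pos_pos Gamma_real_pos) auto
qed

lemma measurable_lebesgue_on_continuous:
  fixes f :: "'a::euclidean_space \<Rightarrow> 'b::topological_space"
  assumes "continuous_on UNIV f"
  shows "f \<in> borel_measurable (lebesgue_on \<Omega>)"
  using borel_measurable_continuous_onI[OF assms]
  by (intro measurable_restrict_space1 measurable_completion) simp

lemma lipschitz_of_gradient_bound:
  fixes u :: "'a::euclidean_space \<Rightarrow> real"
  assumes "\<And>x. (u has_derivative (\<lambda>h. Du x \<bullet> h)) (at x)" "\<And>x. norm (Du x) \<le> B"
  shows "\<bar>u x - u y\<bar> \<le> B * norm (x - y)"
proof -
  have "norm (u x - u y) \<le> B * norm (x - y)"
  proof (rule differentiable_bound[of UNIV u "\<lambda>x h. Du x \<bullet> h"])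
    fix z
    have "norm (Du z \<bullet> h) \<le> B * norm h" for h
      using Cauchy_Schwarz_ineq2[of "Du z" h] mult_right_mono[OF assms(2)[of z] norm_ge_zero[of h]]
      by simp
    then show "onorm (\<lambda>h. Du z \<bullet> h) \<le> B"
      by (intro onorm_le)
  qed (auto intro: assms)
  then show ?thesis by simp
qed

lemma Lp_norm_le_bounded_support:
  fixes \<Omega> :: "(real^'n) set"
  assumes \<Omega>: "\<Omega> \<in> lmeasurable" and A: "A \<in> sets lebesgue" "emeasure lebesgue A \<le> ennreal m" and "0 \<le> m" "0 < P"
    and f: "\<And>x. \<bar>f x\<bar> \<le> B" "\<And>x. x \<in> \<Omega> - A \<Longrightarrow> f x = 0"
  shows "Lp_norm P \<Omega> f \<le> ennreal ((m * B powr P) powr (1 / P))"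
proof -
  have "0 \<le> B" using f(1)[of 0] by linarith
  have "(\<integral>\<^sup>+x. ennreal (\<bar>f x\<bar> powr P) \<partial>lebesgue_on \<Omega>) = (\<integral>\<^sup>+x. ennreal (\<bar>f x\<bar> powr P) * indicator \<Omega> x \<partial>lebesgue)"
    using fmeasurableD[OF \<Omega>] by (intro nn_integral_restrict_space) simp
  also have "\<dots> \<le> (\<integral>\<^sup>+x. ennreal (B powr P) * indicator A x \<partial>lebesgue)"
  proof (intro nn_integral_mono)
    fix x
    show "ennreal (\<bar>f x\<bar> powr P) * indicator \<Omega> x \<le> ennreal (B powr P) * indicator A x"
    proof (cases "x \<in> \<Omega> - A")
      case True
      then show ?thesis using f(2)[OF True] \<open>0 < P\<close> by simp
    next
      case False
      have "\<bar>f x\<bar> powr P \<le> B powr P" using f(1) \<open>0 < P\<close> by (intro powr_mono2) auto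
      then show ?thesis using False by (auto simp: indicator_def ennreal_leI)
    qed
  qed
  also have "\<dots> = ennreal (B powr P) * emeasure lebesgue A"
    using A by (intro nn_integral_cmult_indicator)
  also have "\<dots> \<le> ennreal (B powr P) * ennreal m"
    by (intro mult_left_mono A) simp
  also have "\<dots> = ennreal (m * B powr P)"
    using \<open>0 \<le> m\<close> by (simp add: ennreal_mult[symmetric] mult.commute)
  finally have "Lp_norm P \<Omega> f \<le> enn_powr (ennreal (m * B powr P)) (1 / P)"
    unfolding Lp_norm_def using \<open>0 < P\<close> by (intro enn_powr_mono) auto
  then show ?thesis using \<open>0 \<le> m\<close> by (simp add: enn_powr_ennreal)
qed

lemma sobolev_norm_finite_le:
  fixes \<Omega> :: "(real^'n) set"
  assumes "0 < s" "0 < P" "0 \<le> a" "0 \<le> b"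
    and "sobolev_seminorm s P \<Omega> u \<le> ennreal (a powr (1 / P))" "Lp_norm P \<Omega> u \<le> ennreal (b powr (1 / P))"
  shows "sobolev_norm s (ereal P) \<Omega> u \<le> ennreal ((a + b) powr (1 / P))"
proof -
  have "enn_powr (sobolev_seminorm s P \<Omega> u) P \<le> enn_powr (ennreal (a powr (1 / P))) P"
    "enn_powr (Lp_norm P \<Omega> u) P \<le> enn_powr (ennreal (b powr (1 / P))) P"
    using assms by (intro enn_powr_mono; simp)+
  then have "enn_powr (sobolev_seminorm s P \<Omega> u) P + enn_powr (Lp_norm P \<Omega> u) P \<le> ennreal a + ennreal b"
    using assms by (intro add_mono) (simp_all add: enn_powr_ennreal powr_powr)
  then have "enn_powr (enn_powr (sobolev_seminorm s P \<Omega> u) P + enn_powr (Lp_norm P \<Omega> u) P) (1 / P)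
      \<le> enn_powr (ennreal (a + b)) (1 / P)"
    using assms by (intro enn_powr_mono) auto
  then show ?thesis
    using assms by (simp add: sobolev_norm_def enn_powr_ennreal del: ennreal_plus)
qed

lemma sobolev_norm_ge:
  assumes "0 < s" "0 < P"
  shows "sobolev_seminorm s P \<Omega> u \<le> sobolev_norm s (ereal P) \<Omega> u"
    and "Lp_norm P \<Omega> u \<le> sobolev_norm s (ereal P) \<Omega> u"
proof -
  have "enn_powr x P \<le> y \<Longrightarrow> x \<le> enn_powr y (1 / P)" for x y
    using enn_powr_mono[of "1 / P" "enn_powr x P" y] assms by (simp add: enn_powr_inverse)
  then show "sobolev_seminorm s P \<Omega> u \<le> sobolev_norm s (ereal P) \<Omega> u"
    "Lp_norm P \<Omega> u \<le> sobolev_norm s (ereal P) \<Omega> u"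
    using assms by (simp_all add: sobolev_norm_def)
qed

text \<open>
  A profile of amplitude \<open>M\<close> and frequency \<open>lam\<close> whose support has measure \<open>m\<close> has \<open>s\<close>-energy of order
  \<open>m M\<^sup>P lam\<^sup>s\<^sup>P\<close>.
\<close>

lemma sobolev_norm_profile_bound:
  fixes \<Omega> :: "(real^'n) set"
  assumes s: "0 < s" "s \<le> 1" and P: "1 \<le> P" and \<Omega>: "\<Omega> \<in> lmeasurable" and "0 \<le> C"
  obtains R where "\<And>M lam m A u Du. \<lbrakk>0 \<le> M; 1 \<le> lam; 0 \<le> m; A \<in> sets lebesgue; emeasure lebesgue A \<le> ennreal m;
      m * M powr P * lam powr (s * P) \<le> C; \<And>x. (u has_derivative (\<lambda>h. Du x \<bullet> h)) (at x); continuous_on UNIV Du;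
      \<And>x. \<bar>u x\<bar> \<le> M; \<And>x. norm (Du x) \<le> 2 * M * lam; \<And>x. x \<in> \<Omega> - A \<Longrightarrow> u x = 0 \<and> Du x = 0\<rbrakk>
    \<Longrightarrow> u \<in> sobolev_space s (ereal P) \<Omega> \<and> sobolev_norm s (ereal P) \<Omega> u \<le> ennreal R"
proof -
  \<comment> \<open>The kernel bound is available for \<open>s < 1\<close> only. For
    \<open>s = 1\<close> the value 0 is a placeholder, and the seminorm is estimated through the
    gradient.\<close>
  obtain K where K: "0 \<le> K" "s < 1 \<Longrightarrow> 0 < lam \<Longrightarrow>
    (\<integral>\<^sup>+y. ennreal (min 1 (lam * norm (x - y)) powr P / norm (x - y) powr (real CARD('n) + s * P)) \<partial>lebesgue)
      \<le> ennreal (K * lam powr (s * P))" for lam and x :: "real^'n"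
  proof (cases "s < 1")
    case True
    obtain K where "0 \<le> K" "\<And>lam (x :: real^'n). 0 < lam \<Longrightarrow>
      (\<integral>\<^sup>+y. ennreal (min 1 (lam * norm (x - y)) powr P / norm (x - y) powr (real CARD('n) + s * P)) \<partial>lebesgue)
        \<le> ennreal (K * lam powr (s * P))"
      using kernel_integral_le[of s P, where 'n='n] s P True by auto
    then show ?thesis using that by blast
  next
    case False
    then show ?thesis using that[of 0] by simp
  qed
  define G where "G = \<bar>gagliardo_const CARD('n) s P\<bar>"
  \<comment> \<open>A bound for the \<open>P\<close>-th power of the seminorm. The factor
    \<open>2 powr P\<close> stems from \<open>2 * M * lam\<close> if \<open>s = 1\<close>, and
    otherwise from the oscillation bound \<open>2 * M\<close>; the other 2 is that of
    \<open>gagliardo_integral_le\<close>.\<close>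
  define a where "a = (if s = 1 then 2 powr P * C else G * (2 * 2 powr P * K * C))"
  have a: "0 \<le> a" using \<open>0 \<le> C\<close> K by (auto simp: a_def G_def)
  show ?thesis
  proof (rule that[of "(a + C) powr (1 / P)"])
    fix M lam m :: real and A and u :: "real^'n \<Rightarrow> real" and Du
    assume M: "0 \<le> M" and lam: "1 \<le> lam" and m: "0 \<le> m" and A: "A \<in> sets lebesgue" "emeasure lebesgue A \<le> ennreal m"
      and C: "m * M powr P * lam powr (s * P) \<le> C"
      and D: "\<And>x. (u has_derivative (\<lambda>h. Du x \<bullet> h)) (at x)" "continuous_on UNIV Du"
      and b: "\<And>x. \<bar>u x\<bar> \<le> M" "\<And>x. norm (Du x) \<le> 2 * M * lam"
      and off: "\<And>x. x \<in> \<Omega> - A \<Longrightarrow> u x = 0 \<and> Du x = 0"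
    have cu: "continuous_on UNIV u"
      by (intro continuous_at_imp_continuous_on ballI has_derivative_continuous[OF D(1)])
    have meas: "u \<in> borel_measurable (lebesgue_on \<Omega>)"
      by (rule measurable_lebesgue_on_continuous[OF cu])
    have diff: "\<bar>u x - u y\<bar> \<le> 2 * M * min 1 (lam * norm (x - y))" for x y
    proof -
      have "\<bar>u x - u y\<bar> \<le> 2 * M" using b(1)[of x] b(1)[of y] by linarith
      moreover have "\<bar>u x - u y\<bar> \<le> 2 * M * (lam * norm (x - y))"
        using lipschitz_of_gradient_bound[OF D(1) b(2), of x y] by (simp add: mult.assoc)
      ultimately show ?thesis by (simp add: min_def)
    qed
    \<comment> \<open>Because \<open>lam \<ge> 1\<close>, the hypothesis on the
      \<open>s\<close>-energy also controls the \<open>L^P\<close> energy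
      \<open>m * M powr P\<close>.\<close>
    have l1: "1 \<le> lam powr (s * P)" using lam s P by (intro ge_one_powr_ge_zero) auto
    have "m * M powr P * 1 \<le> m * M powr P * lam powr (s * P)"
      using m l1 by (intro mult_left_mono) auto
    then have "m * M powr P \<le> C" using C by simp
    then have "(m * M powr P) powr (1 / P) \<le> C powr (1 / P)"
      using m P by (intro powr_mono2) auto
    then have L: "Lp_norm P \<Omega> u \<le> ennreal (C powr (1 / P))"
      using Lp_norm_le_bounded_support[OF \<Omega> A m, of P u M] b off P
      by (auto intro: order.trans ennreal_leI)
    have S: "sobolev_seminorm s P \<Omega> u \<le> ennreal (a powr (1 / P))"
    proof (cases "s = 1")
      case True
      have wg: "has_weak_gradient \<Omega> u Du"
        by (rule has_weak_gradient_C1[OF fmeasurableD[OF \<Omega>] D])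
      have "m * (2 * M * lam) powr P = 2 powr P * (m * M powr P * lam powr (s * P))"
        using M lam True by (simp add: powr_mult)
      also have "\<dots> \<le> a" using C True by (simp add: a_def)
      finally have "(m * (2 * M * lam) powr P) powr (1 / P) \<le> a powr (1 / P)"
        using m P by (intro powr_mono2) auto
      then have "Lp_norm P \<Omega> (\<lambda>x. norm (Du x)) \<le> ennreal (a powr (1 / P))"
        using Lp_norm_le_bounded_support[OF \<Omega> A m, of P "\<lambda>x. norm (Du x)" "2 * M * lam"] b off P
        by (auto intro: order.trans ennreal_leI)
      then show ?thesis
        using True wg by (auto simp: sobolev_seminorm_def intro: INF_lower2)
    next
      case False
      let ?I = "\<integral>\<^sup>+(x, y). ennreal (\<bar>u x - u y\<bar> powr P / norm (x - y) powr (real CARD('n) + s * P)) \<partial>(lebesgue_on \<Omega> \<Otimes>\<^sub>M lebesgue_on \<Omega>)"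
      have I: "?I \<le> ennreal (2 * m * (2 * M) powr P * K * lam powr (s * P))"
        using lam P M False s off
        by (intro gagliardo_integral_le[OF \<Omega> meas A m _ _ _ diff _ K(1)] K(2)) auto
      have "2 * m * (2 * M) powr P * K * lam powr (s * P) = 2 * 2 powr P * K * (m * M powr P * lam powr (s * P))"
        using M by (simp add: powr_mult)
      also have "\<dots> \<le> 2 * 2 powr P * K * C"
        using K by (intro mult_left_mono C) auto
      finally have "?I \<le> ennreal (2 * 2 powr P * K * C)"
        using I by (rule order.trans[OF _ ennreal_leI, rotated])
      then have "ennreal (gagliardo_const CARD('n) s P) * ?I \<le> ennreal G * ennreal (2 * 2 powr P * K * C)"
        by (intro mult_mono) (auto simp: G_def intro: ennreal_leI)
      also have "\<dots> = ennreal a"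
        using False K \<open>0 \<le> C\<close> by (simp add: a_def G_def ennreal_mult[symmetric])
      finally have "enn_powr (ennreal (gagliardo_const CARD('n) s P) * ?I) (1 / P) \<le> enn_powr (ennreal a) (1 / P)"
        using P by (intro enn_powr_mono) auto
      then show ?thesis
        using False s a by (simp add: sobolev_seminorm_def enn_powr_ennreal)
    qed
    have "Lp_norm P \<Omega> u < \<infinity>" "sobolev_seminorm s P \<Omega> u < \<infinity>"
      using L S by (auto intro: le_less_trans)
    then have "u \<in> sobolev_space s (ereal P) \<Omega>"
      using meas by (simp add: sobolev_space_def)
    moreover have "sobolev_norm s (ereal P) \<Omega> u \<le> ennreal ((a + C) powr (1 / P))"
      using s P a \<open>0 \<le> C\<close> by (intro sobolev_norm_finite_le S L) auto
    ultimately show "u \<in> sobolev_space s (ereal P) \<Omega> \<and> sobolev_norm s (ereal P) \<Omega> u \<le> ennreal ((a + C) powr (1 / P))"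
      by blast
  qed
qed

text \<open>With \<open>t = lam * norm (x - y)\<close> the oscillation is at most
  \<open>2 * M * min 1 t\<close>, hence at most \<open>2 * M * t powr s\<close>. The constant 3 adds
  the supremum bound 1 and the Hoelder quotient bound 2.\<close>

lemma holder_norm_profile_bound:
  fixes \<Omega> :: "(real^'n) set"
  assumes s: "0 < s" "s \<le> 1" and M: "0 \<le> M" "M \<le> 1" and lam: "0 < lam" and "M * lam powr s \<le> 1"
    and D: "\<And>x. (u has_derivative (\<lambda>h. Du x \<bullet> h)) (at x)" 
    and b: "\<And>x. \<bar>u x\<bar> \<le> M" "\<And>x. norm (Du x) \<le> 2 * M * lam"
  shows "u \<in> sobolev_space s \<infinity> \<Omega> \<and> sobolev_norm s \<infinity> \<Omega> u \<le> ennreal 3"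
proof -
  have cu: "continuous_on UNIV u"
    by (intro continuous_at_imp_continuous_on ballI has_derivative_continuous[OF D(1)])
  have meas: "u \<in> borel_measurable (lebesgue_on \<Omega>)"
    by (rule measurable_lebesgue_on_continuous[OF cu])
  have "Linf_norm \<Omega> u \<le> ennreal 1"
    unfolding Linf_norm_def using meas b(1) M
    by (intro esssup_I AE_I2 ennreal_leI) (auto intro: order.trans)
  moreover have "\<bar>u x - u y\<bar> / norm (x - y) powr s \<le> 2" if "x \<noteq> y" for x y
  proof -
    define t where "t = lam * norm (x - y)"
    have t: "0 < t" using lam that by (simp add: t_def)
    have "\<bar>u x - u y\<bar> \<le> 2 * M" using b(1)[of x] b(1)[of y] by linarith
    moreover have "\<bar>u x - u y\<bar> \<le> 2 * M * t"
      using lipschitz_of_gradient_bound[OF D(1) b(2), of x y] by (simp add: t_def mult.assoc)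
    moreover have "1 \<le> t powr s \<or> t \<le> t powr s"
    proof (cases "1 \<le> t")
      case True
      then show ?thesis using s by (simp add: ge_one_powr_ge_zero)
    next
      case False
      then have "t powr 1 \<le> t powr s" using s t by (intro powr_mono') auto
      then show ?thesis using t by simp
    qed
    ultimately have "\<bar>u x - u y\<bar> \<le> 2 * M * t powr s"
    proof (elim disjE)
      assume "1 \<le> t powr s" "\<bar>u x - u y\<bar> \<le> 2 * M"
      then show ?thesis using M mult_left_mono[of 1 "t powr s" "2 * M"] by simp
    next
      assume "t \<le> t powr s" "\<bar>u x - u y\<bar> \<le> 2 * M * t"
      then show ?thesis using M mult_left_mono[of t "t powr s" "2 * M"] by simp
    qed
    also have "\<dots> = 2 * (M * lam powr s) * norm (x - y) powr s"
      using lam by (simp add: t_def powr_mult)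
    also have "\<dots> \<le> 2 * norm (x - y) powr s"
      using assms(6) by (intro mult_right_mono) auto
    finally show ?thesis using that by (simp add: divide_le_eq)
  qed
  then have "(SUP (x, y)\<in>{(x, y). x \<in> \<Omega> \<and> y \<in> \<Omega> \<and> x \<noteq> y}. ennreal (\<bar>u x - u y\<bar> / norm (x - y) powr s)) \<le> ennreal 2"
    by (intro SUP_least) (auto intro!: ennreal_leI simp del: ennreal_numeral)
  ultimately have "holder_norm s \<Omega> u \<le> ennreal 1 + ennreal 2"
    unfolding holder_norm_def by (rule add_mono)
  also have "\<dots> = ennreal 3" by (subst ennreal_plus[symmetric]) auto
  finally have "holder_norm s \<Omega> u \<le> ennreal 3" .
  then have n: "sobolev_norm s \<infinity> \<Omega> u \<le> ennreal 3"
    using s unfolding sobolev_norm_def by (auto intro!: INF_lower2[of u])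
  then have "sobolev_norm s \<infinity> \<Omega> u < \<infinity>" by (rule le_less_trans) simp
  with n meas show ?thesis by (simp add: sobolev_space_def)
qed

section \<open>Lower bounds that survive changes on null sets\<close>

lemma AE_obtain_in_open:
  fixes \<Omega> :: "'a::euclidean_space set"
  assumes ae: "AE x in lebesgue_on \<Omega>. Q x" and \<Omega>: "\<Omega> \<in> sets lebesgue"
    and S: "open S" "S \<noteq> {}" "S \<subseteq> \<Omega>"
  shows "\<exists>x\<in>S. Q x"
proof (rule ccontr)
  assume "\<not> ?thesis"
  moreover have "AE x in lebesgue. x \<in> \<Omega> \<longrightarrow> Q x"
    using ae \<Omega> by (simp add: AE_restrict_space_iff)
  ultimately have "AE x in lebesgue. x \<notin> S"
    using S(3) by (auto elim!: eventually_mono)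
  moreover have "S \<in> sets lebesgue" using S(1) by simp
  ultimately have "S \<in> null_sets lebesgue" using AE_iff_null_sets by blast
  then have "negligible S" by (simp add: negligible_iff_null_sets)
  then show False using S open_not_negligible by blast
qed

text \<open>The norm is an infimum over representatives \<open>v\<close>, which may differ from
  \<open>u\<close> at \<open>a\<close> and \<open>b\<close>. The strict inequality for the quotient
  of \<open>u\<close> persists on a neighbourhood \<open>S1 \<times> S2\<close> of
  \<open>(a, b)\<close>, and each factor meets \<Omega> in a nonempty open set, which contains a
  point where \<open>v\<close> and \<open>u\<close> agree.\<close>

lemma sobolev_norm_infinity_ge:
  fixes \<Omega> :: "(real^'n) set"
  assumes \<Omega>: "open \<Omega>" and st: "0 < st" and u: "continuous_on UNIV u"
    and ab: "a \<in> \<Omega>" "b \<in> \<Omega>" "a \<noteq> b" "c < \<bar>u a - u b\<bar> / norm (a - b) powr st"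
    and w: "AE x in lebesgue_on \<Omega>. w x = u x"
  shows "ennreal c \<le> sobolev_norm st \<infinity> \<Omega> w"
proof -
  have "ennreal c \<le> holder_norm st \<Omega> v" if v: "AE x in lebesgue_on \<Omega>. w x = v x" for v
  proof -
    have vu: "AE x in lebesgue_on \<Omega>. v x = u x" using v w by eventually_elim simp
    define r where "r z = \<bar>u (fst z) - u (snd z)\<bar> / norm (fst z - snd z) powr st" for z
    have cu: "isCont u x" for x using u by (simp add: continuous_on_eq_continuous_at)
    have f: "(fst \<longlongrightarrow> a) (nhds (a, b))" and g: "(snd \<longlongrightarrow> b) (nhds (a, b))"
      using tendsto_fst[OF filterlim_ident, of "(a, b)"] tendsto_snd[OF filterlim_ident, of "(a, b)"] by auto
    have "(r \<longlongrightarrow> \<bar>u a - u b\<bar> / norm (a - b) powr st) (nhds (a, b))"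
      unfolding r_def using ab(3)
      by (intro tendsto_divide tendsto_rabs tendsto_diff tendsto_powr tendsto_const tendsto_norm f g
          isCont_tendsto_compose[OF cu]) auto
    then have "\<forall>\<^sub>F z in nhds (a, b). c < r z" using ab(4) by (rule order_tendstoD(1))
    moreover have "\<forall>\<^sub>F z in nhds (a, b). fst z \<noteq> snd z"
    proof -
      have "open {z :: (real^'n) \<times> (real^'n). fst z \<noteq> snd z}"
        by (intro open_Collect_neq continuous_intros)
      from eventually_nhds_in_open[OF this, of "(a, b)"] ab show ?thesis by simp
    qed
    ultimately have "\<forall>\<^sub>F z in nhds (a, b). c < r z \<and> fst z \<noteq> snd z" by eventually_elim simp
    then obtain S where S: "open S" "(a, b) \<in> S" "\<And>z. z \<in> S \<Longrightarrow> c < r z \<and> fst z \<noteq> snd z"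
      unfolding eventually_nhds by blast
    obtain S1 S2 where S12: "open S1" "open S2" "(a, b) \<in> S1 \<times> S2" "S1 \<times> S2 \<subseteq> S"
      using open_prod_elim[OF S(1,2)] .
    have m: "\<Omega> \<in> sets lebesgue" using \<Omega> by simp
    obtain x where x: "x \<in> S1 \<inter> \<Omega>" "v x = u x"
      using AE_obtain_in_open[OF vu m, of "S1 \<inter> \<Omega>"] S12 ab \<Omega> by auto
    obtain y where y: "y \<in> S2 \<inter> \<Omega>" "v y = u y"
      using AE_obtain_in_open[OF vu m, of "S2 \<inter> \<Omega>"] S12 ab \<Omega> by auto
    have xy: "c < r (x, y)" "x \<noteq> y" using S(3)[of "(x, y)"] S12 x y by auto
    have "ennreal c \<le> ennreal (\<bar>v x - v y\<bar> / norm (x - y) powr st)"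
      using xy x y by (intro ennreal_leI) (simp add: r_def)
    also have "\<dots> \<le> (SUP (x, y)\<in>{(x, y). x \<in> \<Omega> \<and> y \<in> \<Omega> \<and> x \<noteq> y}. ennreal (\<bar>v x - v y\<bar> / norm (x - y) powr st))"
      using x y xy by (intro SUP_upper2[of "(x, y)"]) auto
    also have "\<dots> \<le> holder_norm st \<Omega> v" by (simp add: holder_norm_def)
    finally show ?thesis .
  qed
  then show ?thesis using st by (simp add: sobolev_norm_def le_INF_iff)
qed

text \<open>Only pairs with \<open>y\<close> close to the translate \<open>x + w\<close> are kept.
  The displacement \<open>w\<close> will be half a period for waves, and a shift out of the support
  for bumps.\<close>

lemma iterated_integral_ge:
  fixes \<Omega> :: "(real^'n) set" and F :: "real^'n \<Rightarrow> real^'n \<Rightarrow> ennreal"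
  assumes \<Omega>: "\<Omega> \<in> sets lebesgue" and A: "A \<in> sets lebesgue" "A \<subseteq> \<Omega>" and "0 \<le> \<rho>"
    and B: "\<And>x. x \<in> A \<Longrightarrow> cball (x + w) \<rho> \<subseteq> \<Omega>"
    and F: "\<And>x y. x \<in> A \<Longrightarrow> y \<in> cball (x + w) \<rho> \<Longrightarrow> c \<le> F x y"
  shows "c * ennreal (unit_ball_vol (real CARD('n)) * \<rho> ^ CARD('n)) * emeasure lebesgue A
    \<le> (\<integral>\<^sup>+x. (\<integral>\<^sup>+y. F x y \<partial>lebesgue_on \<Omega>) \<partial>lebesgue_on \<Omega>)"
proof -
  define d where "d = c * ennreal (unit_ball_vol (real CARD('n)) * \<rho> ^ CARD('n))"
  have inner: "d \<le> (\<integral>\<^sup>+y. F x y \<partial>lebesgue_on \<Omega>)" if "x \<in> A" for x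
  proof -
    have "d = (\<integral>\<^sup>+y. c * indicator (cball (x + w) \<rho>) y \<partial>lebesgue)"
      using emeasure_lebesgue_cball[OF \<open>0 \<le> \<rho>\<close>, of "x + w"]
      by (subst nn_integral_cmult_indicator) (simp_all add: d_def)
    also have "\<dots> \<le> (\<integral>\<^sup>+y. F x y * indicator \<Omega> y \<partial>lebesgue)"
      using B[OF that] F[OF that] by (intro nn_integral_mono) (auto simp: indicator_def)
    also have "\<dots> = (\<integral>\<^sup>+y. F x y \<partial>lebesgue_on \<Omega>)"
      using \<Omega> by (intro nn_integral_restrict_space[symmetric]) simp
    finally show ?thesis .
  qed
  have "d * emeasure lebesgue A = (\<integral>\<^sup>+x. d * indicator A x \<partial>lebesgue)"
    using A by (simp add: nn_integral_cmult_indicator)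
  also have "\<dots> \<le> (\<integral>\<^sup>+x. (\<integral>\<^sup>+y. F x y \<partial>lebesgue_on \<Omega>) * indicator \<Omega> x \<partial>lebesgue)"
    using A inner by (intro nn_integral_mono) (auto simp: indicator_def)
  also have "\<dots> = (\<integral>\<^sup>+x. (\<integral>\<^sup>+y. F x y \<partial>lebesgue_on \<Omega>) \<partial>lebesgue_on \<Omega>)"
    using \<Omega> by (intro nn_integral_restrict_space[symmetric]) simp
  finally show ?thesis by (simp add: d_def)
qed

lemma sobolev_norm_ge_gagliardo:
  fixes \<Omega> :: "(real^'n) set"
  assumes \<Omega>: "\<Omega> \<in> lmeasurable" and st: "0 < st" "st < 1" and q: "1 \<le> q"
    and u: "u \<in> borel_measurable (lebesgue_on \<Omega>)" and w: "w \<in> borel_measurable (lebesgue_on \<Omega>)"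
    and ae: "AE x in lebesgue_on \<Omega>. w x = u x" and "0 \<le> B"
    and B: "ennreal B \<le> (\<integral>\<^sup>+x. (\<integral>\<^sup>+y. ennreal (\<bar>u x - u y\<bar> powr q / norm (x - y) powr (real CARD('n) + st * q))
      \<partial>lebesgue_on \<Omega>) \<partial>lebesgue_on \<Omega>)"
  shows "ennreal ((gagliardo_const CARD('n) st q * B) powr (1 / q)) \<le> sobolev_norm st (ereal q) \<Omega> w"
proof -
  have g: "0 < gagliardo_const CARD('n) st q"
    using gagliardo_const_pos[OF st q, of "CARD('n)"] by (simp add: Suc_le_eq)
  have "ennreal (gagliardo_const CARD('n) st q * B) = ennreal (gagliardo_const CARD('n) st q) * ennreal B"
    using g by (simp add: ennreal_mult')
  also have "\<dots> \<le> ennreal (gagliardo_const CARD('n) st q) * (\<integral>\<^sup>+(x, y). ennreal (\<bar>w x - w y\<bar> powr q /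
      norm (x - y) powr (real CARD('n) + st * q)) \<partial>(lebesgue_on \<Omega> \<Otimes>\<^sub>M lebesgue_on \<Omega>))"
    unfolding gagliardo_integral_AE_cong[OF \<Omega> u w ae] gagliardo_integral_iterated[OF \<Omega> u]
    by (intro mult_left_mono B) simp
  finally have "enn_powr (ennreal (gagliardo_const CARD('n) st q * B)) (1 / q) \<le> sobolev_seminorm st q \<Omega> w"
    using st q by (simp add: sobolev_seminorm_def enn_powr_mono)
  also have "\<dots> \<le> sobolev_norm st (ereal q) \<Omega> w" using st q by (intro sobolev_norm_ge) auto
  finally show ?thesis using g \<open>0 \<le> B\<close> by (simp add: enn_powr_ennreal)
qed

section \<open>Uniformly small sequences and a criterion for non-compactness\<close>

text \<open>The Sobolev norm dominates its Lebesgue part, and pointwise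
  \<open>\<bar>v x\<bar> \<le> \<bar>w k x - v x\<bar> + e k\<close>. Both terms on the right become
  small, the first in the Lebesgue norm and the second uniformly.\<close>

lemma sobolev_limit_AE_eq_0:
  fixes \<Omega> :: "(real^'n) set"
  assumes \<Omega>: "\<Omega> \<in> lmeasurable" and st: "0 < st" and pt: "1 \<le> pt"
    and meas: "\<And>k. w k \<in> borel_measurable (lebesgue_on \<Omega>)" "v \<in> borel_measurable (lebesgue_on \<Omega>)"
    and w: "\<And>k x. \<bar>w k x\<bar> \<le> e k" "e \<longlonglongrightarrow> 0"
    and lim: "(\<lambda>k. sobolev_norm st pt \<Omega> (\<lambda>x. w k x - v x)) \<longlonglongrightarrow> 0"
  shows "AE x in lebesgue_on \<Omega>. v x = 0"
proof -
  have ex: "\<exists>k. sobolev_norm st pt \<Omega> (\<lambda>x. w k x - v x) < ennreal d \<and> e k \<le> d" if "0 < d" for d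
  proof -
    have "\<forall>\<^sub>F k in sequentially. sobolev_norm st pt \<Omega> (\<lambda>x. w k x - v x) < ennreal d"
      using lim that by (intro order_tendstoD) auto
    moreover have "\<forall>\<^sub>F k in sequentially. e k < d" using w(2) that by (intro order_tendstoD)
    ultimately have "\<forall>\<^sub>F k in sequentially. sobolev_norm st pt \<Omega> (\<lambda>x. w k x - v x) < ennreal d \<and> e k \<le> d"
      by eventually_elim simp
    then show ?thesis by (simp add: eventually_sequentially) blast
  qed
  show ?thesis
  proof (cases "pt = \<infinity>")
    case True
    have "AE x in lebesgue_on \<Omega>. \<bar>v x\<bar> \<le> 2 * d" if d: "0 < d" for d :: real
    proof -
      obtain k where k: "sobolev_norm st \<infinity> \<Omega> (\<lambda>x. w k x - v x) < ennreal d" "e k \<le> d"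
        using ex[OF d] True by blast
      then obtain z where z: "AE x in lebesgue_on \<Omega>. w k x - v x = z x" "holder_norm st \<Omega> z < ennreal d"
        using st by (auto simp: sobolev_norm_def INF_less_iff)
      have "Linf_norm \<Omega> z \<le> holder_norm st \<Omega> z" by (simp add: holder_norm_def)
      then have "esssup (lebesgue_on \<Omega>) (\<lambda>x. ennreal \<bar>z x\<bar>) \<le> ennreal d"
        using z(2) by (simp add: Linf_norm_def)
      then have "AE x in lebesgue_on \<Omega>. ennreal \<bar>z x\<bar> \<le> ennreal d"
        using esssup_AE[of "\<lambda>x. ennreal \<bar>z x\<bar>" "lebesgue_on \<Omega>"] by (auto elim!: eventually_mono intro: order.trans)
      with z(1) show ?thesis
      proof eventually_elim
        case (elim x)
        then have "\<bar>w k x - v x\<bar> \<le> d" using that by simp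
        then show ?case using w(1)[of k x] k(2) by linarith
      qed
    qed
    \<comment> \<open>Restricting \<open>d\<close> to a sequence tending to 0 leaves countably many
      exceptional null sets to unite.\<close>
    then have "AE x in lebesgue_on \<Omega>. \<forall>n. \<bar>v x\<bar> \<le> 2 * inverse (real (Suc n))"
      unfolding AE_all_countable by simp
    then show ?thesis
    proof eventually_elim
      case (elim x)
      have "(\<lambda>n. 2 * inverse (real (Suc n))) \<longlonglongrightarrow> 2 * 0"
        by (intro tendsto_mult tendsto_const LIMSEQ_inverse_real_of_nat)
      then have "\<bar>v x\<bar> \<le> 2 * 0"
        by (rule LIMSEQ_le_const) (use elim in blast)
      then show ?case by simp
    qed
  next
    case False
    obtain q where q: "pt = ereal q" "1 \<le> q"
      using pt False by (cases pt) auto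
    define m where "m = measure lebesgue \<Omega>"
    have m: "emeasure lebesgue \<Omega> = ennreal m" using \<Omega> by (simp add: m_def emeasure_eq_measure2)
    define I where "I = (\<integral>\<^sup>+x. ennreal (\<bar>v x\<bar> powr q) \<partial>lebesgue_on \<Omega>)"
    \<comment> \<open>Integrate \<open>\<bar>v\<bar> powr q \<le> 2 powr q * (\<bar>w k - v\<bar>
      powr q + d powr q)\<close>: the first term contributes at most \<open>d powr q\<close>, the
      constant one \<open>m * d powr q\<close>. As \<open>d\<close> is arbitrary,
      \<open>I = 0\<close>.\<close>
    have bd: "I \<le> ennreal (2 powr q * (1 + m) * d powr q)" if d: "0 < d" for d
    proof -
      obtain k where k: "sobolev_norm st (ereal q) \<Omega> (\<lambda>x. w k x - v x) < ennreal d" "e k \<le> d"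
        using ex[OF d] q by blast
      have "Lp_norm q \<Omega> (\<lambda>x. w k x - v x) \<le> ennreal d"
        using sobolev_norm_ge(2)[of st q \<Omega> "\<lambda>x. w k x - v x"] k st q by simp
      then have "enn_powr (Lp_norm q \<Omega> (\<lambda>x. w k x - v x)) q \<le> enn_powr (ennreal d) q"
        using q by (intro enn_powr_mono) auto
      then have J: "(\<integral>\<^sup>+x. ennreal (\<bar>w k x - v x\<bar> powr q) \<partial>lebesgue_on \<Omega>) \<le> ennreal (d powr q)"
        using that q enn_powr_inverse[of "1 / q"] by (simp add: Lp_norm_def enn_powr_ennreal)
      have pt: "ennreal (\<bar>v x\<bar> powr q) \<le> ennreal (2 powr q) * (ennreal (\<bar>w k x - v x\<bar> powr q) + ennreal (d powr q))" for x
      proof -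
        have "\<bar>v x\<bar> \<le> \<bar>w k x - v x\<bar> + d" using w(1)[of k x] k(2) by linarith
        also have "\<dots> \<le> 2 * max \<bar>w k x - v x\<bar> d" by (auto simp: max_def)
        finally have "\<bar>v x\<bar> powr q \<le> (2 * max \<bar>w k x - v x\<bar> d) powr q" using q by (intro powr_mono2) auto
        also have "\<dots> = 2 powr q * (max \<bar>w k x - v x\<bar> d) powr q" using that by (intro powr_mult)
        also have "\<dots> \<le> 2 powr q * (\<bar>w k x - v x\<bar> powr q + d powr q)"
          by (intro mult_left_mono) (auto simp: max_def)
        finally show ?thesis
          by (simp add: ennreal_plus[symmetric] ennreal_mult[symmetric] ennreal_leI del: ennreal_plus)
      qed
      have [measurable]: "(\<lambda>x. w k x - v x) \<in> borel_measurable (lebesgue_on \<Omega>)"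
        using meas by measurable
      have "I \<le> (\<integral>\<^sup>+x. ennreal (2 powr q) * (ennreal (\<bar>w k x - v x\<bar> powr q) + ennreal (d powr q)) \<partial>lebesgue_on \<Omega>)"
        unfolding I_def by (intro nn_integral_mono pt)
      also have "\<dots> = ennreal (2 powr q) * ((\<integral>\<^sup>+x. ennreal (\<bar>w k x - v x\<bar> powr q) \<partial>lebesgue_on \<Omega>) +
          ennreal (d powr q) * ennreal m)"
        using fmeasurableD[OF \<Omega>] m
        by (subst nn_integral_cmult, measurable, subst nn_integral_add) (simp_all add: emeasure_restrict_space)
      also have "\<dots> \<le> ennreal (2 powr q) * (ennreal (d powr q) + ennreal (d powr q) * ennreal m)"
        by (intro mult_left_mono add_mono J) auto
      also have "\<dots> = ennreal (2 powr q * (1 + m) * d powr q)"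
        by (simp add: ennreal_plus[symmetric] ennreal_mult[symmetric] m_def algebra_simps del: ennreal_plus)
      finally show ?thesis .
    qed
    have "I \<le> ennreal 0"
    proof (rule LIMSEQ_le_const)
      have "(\<lambda>n. 2 powr q * (1 + m) * inverse (real (Suc n)) powr q) \<longlonglongrightarrow> 2 powr q * (1 + m) * 0 powr q"
        using q by (intro tendsto_mult tendsto_const tendsto_powr2 LIMSEQ_inverse_real_of_nat) auto
      then show "(\<lambda>n. ennreal (2 powr q * (1 + m) * inverse (real (Suc n)) powr q)) \<longlonglongrightarrow> ennreal 0"
        by (intro tendsto_ennrealI) simp
    qed (use bd in auto)
    then have "I = 0" by simp
    then have "AE x in lebesgue_on \<Omega>. ennreal (\<bar>v x\<bar> powr q) = 0"
      unfolding I_def using meas(2) by (subst (asm) nn_integral_0_iff_AE) measurable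
    then show ?thesis by (rule eventually_mono) simp
  qed
qed

text \<open>A limit \<open>v\<close> of a subsequence vanishes a.e., so each difference with
  \<open>v\<close> is an a.e. copy of a member of the sequence. Since the lower bound is assumed for
  all such copies, these norms cannot tend to 0.\<close>

lemma not_compactly_embedded_sobolevI:
  fixes \<Omega> :: "(real^'n) set"
  assumes \<Omega>: "\<Omega> \<in> lmeasurable" and st: "0 < st" and pt: "1 \<le> pt" and "0 < c" and e: "e \<longlonglongrightarrow> 0"
    and u: "\<And>k::nat. \<exists>u\<in>sobolev_space s p \<Omega>. sobolev_norm s p \<Omega> u \<le> ennreal R \<and> (\<forall>x. \<bar>u x\<bar> \<le> e k) \<and>
      (\<forall>w\<in>borel_measurable (lebesgue_on \<Omega>). (AE x in lebesgue_on \<Omega>. w x = u x) \<longrightarrow> ennreal c \<le> sobolev_norm st pt \<Omega> w)"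
  shows "\<not> compactly_embedded (sobolev_space s p \<Omega>) (sobolev_norm s p \<Omega>) (sobolev_space st pt \<Omega>) (sobolev_norm st pt \<Omega>)"
proof
  assume ce: "compactly_embedded (sobolev_space s p \<Omega>) (sobolev_norm s p \<Omega>) (sobolev_space st pt \<Omega>) (sobolev_norm st pt \<Omega>)"
  obtain u where u: "\<And>k. u k \<in> sobolev_space s p \<Omega>" "\<And>k. sobolev_norm s p \<Omega> (u k) \<le> ennreal R"
      "\<And>k x. \<bar>u k x\<bar> \<le> e k"
    and low: "\<And>k w. w \<in> borel_measurable (lebesgue_on \<Omega>) \<Longrightarrow> (AE x in lebesgue_on \<Omega>. w x = u k x) \<Longrightarrow>
        ennreal c \<le> sobolev_norm st pt \<Omega> w"
    using u unfolding Bex_def by metis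
  obtain v r where v: "v \<in> sobolev_space st pt \<Omega>" and r: "strict_mono (r :: nat \<Rightarrow> nat)"
    and lim: "(\<lambda>k. sobolev_norm st pt \<Omega> (\<lambda>x. u (r k) x - v x)) \<longlonglongrightarrow> 0"
    using ce u(1,2) unfolding compactly_embedded_def by meson
  have um: "u k \<in> borel_measurable (lebesgue_on \<Omega>)" for k using u(1) by (simp add: sobolev_space_def)
  have vm: "v \<in> borel_measurable (lebesgue_on \<Omega>)" using v by (simp add: sobolev_space_def)
  have "AE x in lebesgue_on \<Omega>. v x = 0"
    using LIMSEQ_subseq_LIMSEQ[OF e r]
    by (intro sobolev_limit_AE_eq_0[OF \<Omega> st pt um vm u(3) _ lim]) (simp add: o_def)
  then have "AE x in lebesgue_on \<Omega>. u (r k) x - v x = u (r k) x" for k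
    by eventually_elim simp
  then have "ennreal c \<le> sobolev_norm st pt \<Omega> (\<lambda>x. u (r k) x - v x)" for k
    using um vm by (intro low[of _ "r k"]) auto
  then have "ennreal c \<le> 0" by (intro LIMSEQ_le_const[OF lim]) auto
  with \<open>0 < c\<close> show False by simp
qed

section \<open>Test functions and a lower bound for weak gradients\<close>

text \<open>Differentiating the cosine shifts its argument by \<open>pi / 2\<close>, which provides
  the sequence of derivatives for \<open>Ck_affine_coordinate\<close>.\<close>

lemma Ck_cos_affine: "Ck k (\<lambda>x::real^'n. cos (a * x $ j + b))"
proof -
  have "((\<lambda>t. cos (t + real m * (pi / 2))) has_real_derivative cos (t + real (Suc m) * (pi / 2))) (at t)" for m t
  proof -
    have e: "cos (t + real (Suc m) * (pi / 2)) = - sin (t + real m * (pi / 2))"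
      unfolding minus_sin_cos_eq by (simp add: field_simps)
    show ?thesis unfolding e by (auto intro!: derivative_eq_intros)
  qed
  from Ck_affine_coordinate[of "\<lambda>m t. cos (t + real m * (pi / 2))", OF this, where k = k and m = 0 and a = a and j = j and b = b]
  show ?thesis by simp
qed

text \<open>The half side \<open>d / N\<close> puts the cube inside the ball of radius
  \<open>d\<close>, because the Euclidean norm is at most the sum of the \<open>N\<close> absolute
  coordinates.\<close>

lemma test_function_box_bump_mult:
  fixes \<Omega> :: "(real^'n) set"
  assumes f: "\<And>k. Ck k f" and d: "0 < d" "cball x0 d \<subseteq> \<Omega>"
  shows "test_function \<Omega> (\<lambda>x. box_bump x0 (d / real CARD('n)) x * f x)"
proof -
  let ?S = "{x. box_bump x0 (d / real CARD('n)) x * f x \<noteq> 0}"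
  have "?S \<subseteq> cball x0 d"
  proof
    fix x assume "x \<in> ?S"
    then have "box_bump x0 (d / real CARD('n)) x \<noteq> 0" by simp
    then have i: "\<bar>x $ i - x0 $ i\<bar> < d / real CARD('n)" for i
      using d by (subst (asm) box_bump_nonzero_iff) auto
    have "norm (x - x0) \<le> (\<Sum>i\<in>UNIV. \<bar>(x - x0) $ i\<bar>)" by (rule norm_le_l1_cart)
    also have "\<dots> \<le> (\<Sum>i\<in>(UNIV::'n set). d / real CARD('n))"
      using i by (intro sum_mono) (auto intro: less_imp_le)
    finally show "x \<in> cball x0 d" by (simp add: dist_norm norm_minus_commute)
  qed
  then have sub: "closure ?S \<subseteq> cball x0 d" by (intro closure_minimal) auto
  then have "compact (closure ?S)"
    using bounded_subset[OF bounded_cball] by (auto simp: compact_eq_bounded_closed)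
  moreover have "Ck k (\<lambda>x. box_bump x0 (d / real CARD('n)) x * f x)" for k
    by (intro Ck_mult Ck_box_bump f)
  ultimately show ?thesis
    using sub d unfolding test_function_def by blast
qed

text \<open>A nonnegative function with zero integral vanishes a.e., but the bump is nonzero on an
  open set containing \<open>a\<close>.\<close>

lemma integral_box_bump_pos:
  assumes "0 < r"
  shows "0 < (LINT x|lborel. box_bump (a :: real^'n) r x)"
proof -
  have c: "continuous_on UNIV (box_bump a r)" by (rule Ck_continuous[OF Ck_box_bump])
  define R where "R = real CARD('n) * r + norm a"
  have supp: "box_bump a r x = 0" if "x \<notin> cball 0 R" for x
  proof (rule ccontr)
    assume "box_bump a r x \<noteq> 0"
    then have i: "\<bar>x $ i - a $ i\<bar> < r" for i using assms box_bump_nonzero_iff by blast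
    have "norm (x - a) \<le> (\<Sum>i\<in>UNIV. \<bar>(x - a) $ i\<bar>)" by (rule norm_le_l1_cart)
    also have "\<dots> \<le> (\<Sum>i\<in>(UNIV::'n set). r)"
      using i by (intro sum_mono) (auto intro: less_imp_le)
    finally have "norm x \<le> R" using norm_triangle_sub[of x a] by (simp add: R_def)
    then show False using that by simp
  qed
  have int: "integrable lborel (box_bump a r)"
    by (rule integrable_continuous_bounded_support[OF c supp])
  have "(LINT x|lborel. box_bump a r x) \<noteq> 0"
  proof
    assume "(LINT x|lborel. box_bump a r x) = 0"
    then have "AE x in lborel. box_bump a r x = 0"
      using int by (subst (asm) integral_nonneg_eq_0_iff_AE) (auto simp: box_bump_bounds)
    then have ae: "AE x in lebesgue_on UNIV. box_bump a r x = 0"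
      unfolding lebesgue_on_UNIV_eq by (rule AE_completion)
    have o: "open {x. box_bump a r x \<noteq> 0}"
      using c by (intro open_Collect_neq) auto
    have "a \<in> {x. box_bump a r x \<noteq> 0}" using assms by (simp add: box_bump_nonzero_iff)
    then show False using AE_obtain_in_open[OF ae _ o] by auto
  qed
  moreover have "0 \<le> (LINT x|lborel. box_bump a r x)"
    by (intro Bochner_Integration.integral_nonneg box_bump_bounds)
  ultimately show ?thesis by simp
qed

text \<open>
  Testing a weak gradient with \<open>\<eta>\<close> bounds it from below; the pointwise inequality
  \<open>t \<le> t\<^sup>q / d\<^sup>q\<^sup>-\<^sup>1 + d\<close> replaces Hoelder's inequality.
\<close>

lemma sobolev_norm_1_ge_test:
  fixes \<Omega> :: "(real^'n) set"
  assumes \<Omega>: "\<Omega> \<in> lmeasurable" and q: "1 \<le> q" and "0 < \<kappa>"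
  obtains c where "0 < c" and "\<And>u w \<eta> i. \<lbrakk>test_function \<Omega> \<eta>; \<And>x. \<bar>\<eta> x\<bar> \<le> 1; continuous_on UNIV u;
      w \<in> borel_measurable (lebesgue_on \<Omega>); AE x in lebesgue_on \<Omega>. w x = u x;
      \<kappa> \<le> - (LINT x|lebesgue_on \<Omega>. u x * partial_deriv i \<eta> x)\<rbrakk> \<Longrightarrow> ennreal c \<le> sobolev_norm 1 (ereal q) \<Omega> w"
proof -
  define m where "m = measure lebesgue \<Omega>"
  have m: "emeasure lebesgue \<Omega> = ennreal m" "0 \<le> m" using \<Omega> by (simp_all add: m_def emeasure_eq_measure2)
  \<comment> \<open>With this \<open>d\<close> the additive term of the pointwise inequality
    integrates to at most half of \<kappa>; the \<open>+ 1\<close> keeps the denominator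
    positive.\<close>
  define d where "d = \<kappa> / (2 * (m + 1))"
  have d: "0 < d" "d * m \<le> \<kappa> / 2"
  proof -
    show "0 < d" using \<open>0 < \<kappa>\<close> m by (simp add: d_def)
    have "d * (m + 1) = \<kappa> / 2" using m by (simp add: d_def field_simps)
    then show "d * m \<le> \<kappa> / 2" using \<open>0 < d\<close> by (simp add: distrib_left)
  qed
  \<comment> \<open>Solve \<open>\<kappa> / 2 \<le> d powr (1 - q) * I\<close> for the energy
    \<open>I\<close> of the weak gradient and take the \<open>q\<close>-th root.\<close>
  define c where "c = (\<kappa> / 2 * d powr (q - 1)) powr (1 / q)"
  show ?thesis
  proof (rule that[of c])
    show "0 < c" using \<open>0 < \<kappa>\<close> d by (simp add: c_def)
    fix u w :: "real^'n \<Rightarrow> real" and \<eta> i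
    assume t: "test_function \<Omega> \<eta>" and \<eta>: "\<And>x. \<bar>\<eta> x\<bar> \<le> 1" and u: "continuous_on UNIV u"
      and w: "w \<in> borel_measurable (lebesgue_on \<Omega>)" and ae: "AE x in lebesgue_on \<Omega>. w x = u x"
      and \<kappa>: "\<kappa> \<le> - (LINT x|lebesgue_on \<Omega>. u x * partial_deriv i \<eta> x)"
    have "Ck 1 \<eta>" using t unfolding test_function_def by blast
    then have "continuous_on UNIV (partial_deriv i \<eta>)" by simp
    then have dm: "partial_deriv i \<eta> \<in> borel_measurable (lebesgue_on \<Omega>)"
      by (rule measurable_lebesgue_on_continuous)
    have um: "u \<in> borel_measurable (lebesgue_on \<Omega>)" by (rule measurable_lebesgue_on_continuous[OF u])
    have "(LINT x|lebesgue_on \<Omega>. w x * partial_deriv i \<eta> x) = (LINT x|lebesgue_on \<Omega>. u x * partial_deriv i \<eta> x)"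
      using ae by (intro integral_cong_AE borel_measurable_times w um dm) (auto elim: eventually_mono)
    then have \<kappa>w: "\<kappa> \<le> - (LINT x|lebesgue_on \<Omega>. w x * partial_deriv i \<eta> x)" using \<kappa> by simp
    have "ennreal c \<le> Lp_norm q \<Omega> (\<lambda>x. norm (g x))" if g: "has_weak_gradient \<Omega> w g" for g
    proof -
      define f where "f x = g x $ i * \<eta> x" for x
      have "\<kappa> \<le> (LINT x|lebesgue_on \<Omega>. f x)"
        using g t \<kappa>w unfolding has_weak_gradient_def f_def by simp
      \<comment> \<open>A non-integrable \<open>f\<close> would have integral 0 by convention,
        contrary to the lower bound \<open>\<kappa> > 0\<close>.\<close>
      moreover have f: "integrable (lebesgue_on \<Omega>) f"
        using not_integrable_integral_eq[of "lebesgue_on \<Omega>" f] calculation \<open>0 < \<kappa>\<close> by fastforce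
      ultimately have "\<kappa> \<le> (LINT x|lebesgue_on \<Omega>. \<bar>f x\<bar>)"
        using integral_abs_bound[of "lebesgue_on \<Omega>" f] by linarith
      moreover have "ennreal (LINT x|lebesgue_on \<Omega>. \<bar>f x\<bar>) = (\<integral>\<^sup>+x. ennreal \<bar>f x\<bar> \<partial>lebesgue_on \<Omega>)"
        using f by (intro nn_integral_eq_integral[symmetric]) auto
      ultimately have "ennreal \<kappa> \<le> (\<integral>\<^sup>+x. ennreal \<bar>f x\<bar> \<partial>lebesgue_on \<Omega>)"
        by (metis ennreal_leI)
      also have "\<dots> \<le> (\<integral>\<^sup>+x. ennreal (d powr (1 - q)) * ennreal (\<bar>f x\<bar> powr q) + ennreal d \<partial>lebesgue_on \<Omega>)"
      proof (intro nn_integral_mono)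
        fix x
        have "\<bar>f x\<bar> \<le> d powr (1 - q) * \<bar>f x\<bar> powr q + d"
        proof (cases "\<bar>f x\<bar> \<le> d")
          case True
          then show ?thesis by (simp add: add_increasing)
        next
          case False
          have "\<bar>f x\<bar> = \<bar>f x\<bar> powr (1 - q) * \<bar>f x\<bar> powr q"
            using False d by (simp add: powr_add[symmetric])
          also have "\<dots> \<le> d powr (1 - q) * \<bar>f x\<bar> powr q"
            using False d q by (intro mult_right_mono powr_mono2') auto
          finally show ?thesis using d by simp
        qed
        then show "ennreal \<bar>f x\<bar> \<le> ennreal (d powr (1 - q)) * ennreal (\<bar>f x\<bar> powr q) + ennreal d"
          using d by (simp add: ennreal_plus[symmetric] ennreal_mult[symmetric] ennreal_leI del: ennreal_plus)
      qed
      also have "\<dots> = ennreal (d powr (1 - q)) * (\<integral>\<^sup>+x. ennreal (\<bar>f x\<bar> powr q) \<partial>lebesgue_on \<Omega>) + ennreal d * ennreal m"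
        using borel_measurable_integrable[OF f] fmeasurableD[OF \<Omega>] m
        by (subst nn_integral_add) (simp_all add: nn_integral_cmult emeasure_restrict_space)
      also have "\<dots> \<le> ennreal (d powr (1 - q)) * (\<integral>\<^sup>+x. ennreal (\<bar>norm (g x)\<bar> powr q) \<partial>lebesgue_on \<Omega>) + ennreal (\<kappa> / 2)"
      proof (intro add_mono mult_left_mono nn_integral_mono)
        fix x
        have "\<bar>f x\<bar> \<le> \<bar>g x $ i\<bar> * 1"
          unfolding f_def abs_mult by (intro mult_left_mono \<eta>) simp
        also have "\<dots> \<le> norm (g x)" using component_le_norm_cart by simp
        finally show "ennreal (\<bar>f x\<bar> powr q) \<le> ennreal (\<bar>norm (g x)\<bar> powr q)"
          using q by (intro ennreal_leI powr_mono2) auto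
        show "ennreal d * ennreal m \<le> ennreal (\<kappa> / 2)"
          using d m by (simp add: ennreal_mult[symmetric] ennreal_leI)
      qed simp
      finally have 1: "ennreal \<kappa> \<le> ennreal (d powr (1 - q)) * (\<integral>\<^sup>+x. ennreal (\<bar>norm (g x)\<bar> powr q) \<partial>lebesgue_on \<Omega>) + ennreal (\<kappa> / 2)" .
      have "ennreal (\<kappa> / 2 * d powr (q - 1)) \<le> (\<integral>\<^sup>+x. ennreal (\<bar>norm (g x)\<bar> powr q) \<partial>lebesgue_on \<Omega>)"
      proof (cases "\<integral>\<^sup>+x. ennreal (\<bar>norm (g x)\<bar> powr q) \<partial>lebesgue_on \<Omega>")
        case (real r)
        have "ennreal \<kappa> \<le> ennreal (d powr (1 - q) * r + \<kappa> / 2)"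
          using 1 real \<open>0 < \<kappa>\<close> by (simp add: ennreal_mult)
        then have "\<kappa> \<le> d powr (1 - q) * r + \<kappa> / 2"
          using real \<open>0 < \<kappa>\<close> by (subst (asm) ennreal_le_iff) auto
        then have "\<kappa> / 2 \<le> d powr (1 - q) * r" by simp
        then have "\<kappa> / 2 * d powr (q - 1) \<le> d powr (1 - q) * r * d powr (q - 1)"
          by (intro mult_right_mono) auto
        also have "\<dots> = r * (d powr (1 - q) * d powr (q - 1))" by simp
        also have "\<dots> = r" using d by (simp add: powr_add[symmetric])
        finally show ?thesis using real by (simp add: ennreal_leI)
      qed simp
      then have "enn_powr (ennreal (\<kappa> / 2 * d powr (q - 1))) (1 / q) \<le> Lp_norm q \<Omega> (\<lambda>x. norm (g x))"
        unfolding Lp_norm_def using q by (intro enn_powr_mono) auto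
      then show ?thesis using \<open>0 < \<kappa>\<close> by (simp add: enn_powr_ennreal c_def)
    qed
    \<comment> \<open>If \<open>w\<close> has no weak gradient, the infimum is over the empty set
      and equals \<infinity>, so the bound still holds.\<close>
    then have "ennreal c \<le> sobolev_seminorm 1 q \<Omega> w"
      unfolding sobolev_seminorm_def by (auto intro!: INF_greatest)
    also have "\<dots> \<le> sobolev_norm 1 (ereal q) \<Omega> w" using q by (intro sobolev_norm_ge) auto
    finally show "ennreal c \<le> sobolev_norm 1 (ereal q) \<Omega> w" .
  qed
qed

section \<open>Oscillating waves, for \<open>st \<ge> s\<close>\<close>

definition wave :: "'n \<Rightarrow> real \<Rightarrow> real \<Rightarrow> real \<Rightarrow> real^'n \<Rightarrow> real" where
  "wave i s lam th x = lam powr (- s) * sin (lam * x $ i + th)"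

definition wave_gradient :: "'n \<Rightarrow> real \<Rightarrow> real \<Rightarrow> real \<Rightarrow> real^'n \<Rightarrow> real^'n" where
  "wave_gradient i s lam th x = (lam powr (- s) * (cos (lam * x $ i + th) * lam)) *\<^sub>R axis i 1"

lemma has_derivative_wave:
  "(wave i s lam th has_derivative (\<lambda>h. wave_gradient i s lam th x \<bullet> h)) (at x)"
proof -
  have "((\<lambda>x. lam powr (- s) * sin (lam * x $ i + th)) has_derivative
      (\<lambda>h. lam powr (- s) * (cos (lam * x $ i + th) * (lam * h $ i)))) (at x)"
    by (intro has_derivative_mult_right has_derivative_affine_coordinate DERIV_sin)
  then show ?thesis
    by (simp add: wave_def[abs_def] wave_gradient_def inner_axis' mult_ac)
qed

lemma continuous_wave: "continuous_on UNIV (wave i s lam th)"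
  unfolding wave_def by (intro continuous_intros)

lemma continuous_wave_gradient: "continuous_on UNIV (wave_gradient i s lam th)"
  unfolding wave_gradient_def by (intro continuous_intros)

lemma wave_bound: "\<bar>wave i s lam th x\<bar> \<le> lam powr (- s)"
  using mult_left_mono[OF abs_sin_le_one, of "lam powr (- s)"] by (simp add: wave_def abs_mult)

text \<open>The slack factor 2 matches the common format of the profile estimates, which also has to
  accommodate the bumps.\<close>

lemma wave_gradient_bound:
  assumes "0 \<le> lam"
  shows "norm (wave_gradient i s lam th x) \<le> 2 * lam powr (- s) * lam"
proof -
  have "norm (wave_gradient i s lam th x) = (lam powr (- s) * lam) * \<bar>cos (lam * x $ i + th)\<bar>"
    using assms by (simp add: wave_gradient_def abs_mult)
  also have "\<dots> \<le> (lam powr (- s) * lam) * 2"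
    using assms abs_cos_le_one[of "lam * x $ i + th"]
    by (intro mult_left_mono mult_nonneg_nonneg) (linarith, auto)
  finally show ?thesis by simp
qed

text \<open>The amplitude \<open>M = lam powr (- s)\<close> gives
  \<open>M powr P * lam powr (s * P) = 1\<close>. The set carrying the wave is all of \<Omega>, so
  its energy parameter is the measure of \<Omega> for every frequency.\<close>

lemma wave_sobolev_bound:
  fixes \<Omega> :: "(real^'n) set"
  assumes s: "0 < s" "s \<le> 1" and p: "1 \<le> p" and \<Omega>: "\<Omega> \<in> lmeasurable"
  obtains R where "\<And>i lam th. 1 \<le> lam \<Longrightarrow>
    wave i s lam th \<in> sobolev_space s p \<Omega> \<and> sobolev_norm s p \<Omega> (wave i s lam th) \<le> ennreal R"
proof (cases "p = \<infinity>")
  case True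
  have "wave i s lam th \<in> sobolev_space s p \<Omega> \<and> sobolev_norm s p \<Omega> (wave i s lam th) \<le> ennreal 3" if "1 \<le> lam" for i lam th
    unfolding True
  proof (rule holder_norm_profile_bound[OF s])
    show "0 \<le> lam powr (- s)" by simp
    show "lam powr (- s) \<le> 1" using that s by (simp add: powr_minus_divide ge_one_powr_ge_zero)
    show "0 < lam" using that by simp
    show "lam powr (- s) * lam powr s \<le> 1" using that by (simp add: powr_add[symmetric])
  qed (use that in \<open>auto intro!: has_derivative_wave wave_bound wave_gradient_bound\<close>)
  then show ?thesis by (rule that)
next
  case False
  then obtain P where P: "p = ereal P" "1 \<le> P" using p by (cases p) auto
  define m where "m = measure lebesgue \<Omega>"
  have m: "emeasure lebesgue \<Omega> = ennreal m" "0 \<le> m" using \<Omega> by (simp_all add: m_def emeasure_eq_measure2)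
  obtain R where R: "\<And>M lam m' A u Du. \<lbrakk>0 \<le> M; 1 \<le> lam; 0 \<le> m'; A \<in> sets lebesgue; emeasure lebesgue A \<le> ennreal m';
      m' * M powr P * lam powr (s * P) \<le> m; \<And>x. (u has_derivative (\<lambda>h. Du x \<bullet> h)) (at x); continuous_on UNIV Du;
      \<And>x. \<bar>u x\<bar> \<le> M; \<And>x. norm (Du x) \<le> 2 * M * lam; \<And>x. x \<in> \<Omega> - A \<Longrightarrow> u x = 0 \<and> Du x = 0\<rbrakk>
    \<Longrightarrow> u \<in> sobolev_space s (ereal P) \<Omega> \<and> sobolev_norm s (ereal P) \<Omega> u \<le> ennreal R"
    using sobolev_norm_profile_bound[OF s P(2) \<Omega> m(2)] by blast
  have "wave i s lam th \<in> sobolev_space s p \<Omega> \<and> sobolev_norm s p \<Omega> (wave i s lam th) \<le> ennreal R" if "1 \<le> lam" for i lam th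
    unfolding P
  proof (rule R[of "lam powr (- s)" lam m \<Omega> _ "wave_gradient i s lam th"])
    have "(lam powr (- s)) powr P * lam powr (s * P) = 1"
      using that by (simp add: powr_powr powr_add[symmetric])
    then show "m * (lam powr (- s)) powr P * lam powr (s * P) \<le> m" by (simp add: mult.assoc)
  qed (use that m fmeasurableD[OF \<Omega>] in
      \<open>auto intro!: has_derivative_wave wave_bound wave_gradient_bound continuous_wave_gradient\<close>)
  then show ?thesis by (rule that)
qed

text \<open>A crest and the next trough differ by \<open>2 * lam powr (- s)\<close> at distance
  \<open>pi / lam\<close>. Since \<open>pi powr st \<le> pi < 4\<close> and
  \<open>s \<le> st\<close>, the Hoelder quotient exceeds 1/2.\<close>

lemma wave_holder_lower:
  fixes \<Omega> :: "(real^'n) set"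
  assumes \<Omega>: "open \<Omega>" and s: "0 < s" "s \<le> st" "st \<le> 1" and ball: "cball x0 \<delta> \<subseteq> \<Omega>" "0 < \<delta>"
    and lam: "1 \<le> lam" "pi / lam \<le> \<delta>"
  shows "\<exists>th. \<forall>w. (AE x in lebesgue_on \<Omega>. w x = wave i s lam th x) \<longrightarrow> ennreal (1 / 2) \<le> sobolev_norm st \<infinity> \<Omega> w"
proof (intro exI allI impI)
  \<comment> \<open>This phase makes the sine argument \<open>pi / 2\<close> at \<open>x0\<close>,
    hence \<open>3 / 2 * pi\<close> at the point \<open>?b\<close> half a period further.\<close>
  let ?th = "pi / 2 - lam * x0 $ i"
  let ?b = "x0 + (pi / lam) *\<^sub>R axis i 1"
  fix w assume w: "AE x in lebesgue_on \<Omega>. w x = wave i s lam ?th x"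
  have ua: "wave i s lam ?th x0 = lam powr (- s)" by (simp add: wave_def)
  have e: "lam * ?b $ i + ?th = 3 / 2 * pi" using lam by (simp add: distrib_left)
  have ub: "wave i s lam ?th ?b = - (lam powr (- s))"
    unfolding wave_def e sin_3over2_pi by simp
  have n: "norm (x0 - ?b) = pi / lam" using lam by simp
  have lt: "(pi / lam) powr st < 4 * lam powr (- s)"
  proof -
    have "pi powr st \<le> pi powr 1" using s pi_gt3 by (intro powr_mono) auto
    then have "pi powr st < 4" using pi_less_4 by simp
    moreover have "lam powr (- st) \<le> lam powr (- s)" using s lam by (intro powr_mono) auto
    moreover have "0 < lam powr (- st)" using lam by simp
    ultimately have "pi powr st * lam powr (- st) < 4 * lam powr (- s)"
      by (intro mult_less_le_imp_less) auto
    then show ?thesis using lam by (simp add: powr_divide powr_minus_divide)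
  qed
  have pos: "0 < (pi / lam) powr st" using lam by simp
  have "1 / 2 < 2 * lam powr (- s) / (pi / lam) powr st"
    using lt pos by (simp add: pos_less_divide_eq)
  moreover have "\<bar>wave i s lam ?th x0 - wave i s lam ?th ?b\<bar> = 2 * lam powr (- s)"
    unfolding ua ub by simp
  ultimately have "1 / 2 < \<bar>wave i s lam ?th x0 - wave i s lam ?th ?b\<bar> / norm (x0 - ?b) powr st"
    unfolding n by simp
  moreover have "x0 \<in> \<Omega>" "?b \<in> \<Omega>"
    using ball lam n by (auto simp: dist_norm subset_eq)
  moreover have "x0 \<noteq> ?b" using lam by (metis n norm_zero right_minus_eq divide_eq_0_iff pi_neq_zero not_one_le_zero)
  ultimately show "ennreal (1 / 2) \<le> sobolev_norm st \<infinity> \<Omega> w"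
    using s w by (intro sobolev_norm_infinity_ge[OF \<Omega> _ continuous_wave, of _ x0 ?b]) auto
qed

text \<open>The two differences are the coordinates of a chord of the unit circle between the angles
  \<open>a\<close> and \<open>a + t\<close>. Its squared length \<open>2 - 2 * cos t\<close> is at
  least 2, because \<open>t\<close> lies within 1, hence within \<open>pi / 2\<close>, of
  \<open>pi\<close>.\<close>

lemma sin_or_cos_diff_ge_1:
  fixes a t :: real
  assumes "\<bar>t - pi\<bar> \<le> 1"
  shows "1 \<le> \<bar>sin a - sin (a + t)\<bar> \<or> 1 \<le> \<bar>cos a - cos (a + t)\<bar>"
proof (rule ccontr)
  assume "\<not> ?thesis"
  then have "\<bar>sin a - sin (a + t)\<bar>\<^sup>2 < 1" "\<bar>cos a - cos (a + t)\<bar>\<^sup>2 < 1"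
    by (auto simp: abs_square_less_1)
  then have "(sin a - sin (a + t))\<^sup>2 + (cos a - cos (a + t))\<^sup>2 < 2" by simp
  moreover have "(sin a - sin (a + t))\<^sup>2 + (cos a - cos (a + t))\<^sup>2 = 2 - 2 * cos t"
  proof -
    have "cos t = cos ((a + t) - a)" by simp
    also have "\<dots> = cos (a + t) * cos a + sin (a + t) * sin a" by (rule cos_diff)
    finally have c: "cos t = cos (a + t) * cos a + sin (a + t) * sin a" .
    have "(sin a - sin (a + t))\<^sup>2 + (cos a - cos (a + t))\<^sup>2 =
        ((sin a)\<^sup>2 + (cos a)\<^sup>2) + ((sin (a + t))\<^sup>2 + (cos (a + t))\<^sup>2) - 2 * (cos (a + t) * cos a + sin (a + t) * sin a)"
      by (simp add: power2_diff algebra_simps del: sin_cos_squared_add sin_cos_squared_add2)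
    then show ?thesis by (simp add: c)
  qed
  moreover have "cos t \<le> 0"
  proof -
    have "0 \<le> cos (t - pi)" using assms pi_gt3 by (intro cos_ge_zero) (auto simp: abs_le_iff)
    then show ?thesis by (simp add: cos_diff)
  qed
  ultimately show False by simp
qed

text \<open>For points roughly half a period apart one of the two phases contributes, but which one
  depends on the pair. So the energies of both phases are added, the sum is bounded below by
  \<open>B\<close>, and only then is one phase selected. The powers of \<open>lam\<close> combine to
  \<open>lam powr ((st - s) * q) \<ge> 1\<close>.\<close>

lemma wave_gagliardo_lower:
  fixes \<Omega> :: "(real^'n) set"
  assumes \<Omega>: "\<Omega> \<in> lmeasurable" and s: "0 < s" "s \<le> st" "st < 1" and q: "1 \<le> q"
    and ball: "cball x0 (3 * \<delta>) \<subseteq> \<Omega>" "0 < \<delta>"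
  obtains c where "0 < c" and "\<And>i lam. 1 \<le> lam \<Longrightarrow> 5 / lam \<le> \<delta> \<Longrightarrow>
    \<exists>th. \<forall>w\<in>borel_measurable (lebesgue_on \<Omega>). (AE x in lebesgue_on \<Omega>. w x = wave i s lam th x) \<longrightarrow>
      ennreal c \<le> sobolev_norm st (ereal q) \<Omega> w"
proof -
  define N where "N = CARD('n)"
  define V where "V = unit_ball_vol (real N)"
  define b where "b = real N + st * q"
  have b: "0 < b" using s q by (auto simp: b_def intro: add_nonneg_pos)
  \<comment> \<open>The 5 bounds \<open>pi + 1\<close>: the points compared are at most
    \<open>pi / lam + 1 / lam\<close> apart. One factor \<open>V\<close> belongs to the ball of
    \<open>y\<close>, the other to the ball of \<open>x\<close>.\<close>
  define B where "B = 5 powr (- b) * V * (V * \<delta> ^ N)"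
  have V: "0 < V" by (simp add: V_def)
  have B: "0 < B" using V ball by (simp add: B_def)
  define c where "c = (gagliardo_const N st q * (B / 2)) powr (1 / q)"
  have g: "0 < gagliardo_const N st q"
    using gagliardo_const_pos[of st q N] s q by (simp add: N_def Suc_le_eq)
  show ?thesis
  proof (rule that[of c])
    show "0 < c" using g B by (simp add: c_def)
    fix i lam assume lam: "(1::real) \<le> lam" "5 / lam \<le> \<delta>"
    define F where "F th x y = ennreal (\<bar>wave i s lam th x - wave i s lam th y\<bar> powr q / norm (x - y) powr b)" for th and x y :: "real^'n"
    define J where "J th = (\<integral>\<^sup>+x. (\<integral>\<^sup>+y. F th x y \<partial>lebesgue_on \<Omega>) \<partial>lebesgue_on \<Omega>)" for th
    define v where "v = ((pi / lam) *\<^sub>R axis i 1 :: real^'n)"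
    define C where "C = lam powr (- s * q) / (5 / lam) powr b"
    have mw: "wave i s lam th \<in> borel_measurable (lebesgue_on \<Omega>)" for th
      by (rule measurable_lebesgue_on_continuous[OF continuous_wave])
    have pt: "ennreal C \<le> F 0 x y + F (pi / 2) x y \<and> y \<in> \<Omega>"
      if x: "x \<in> cball x0 \<delta>" and y: "y \<in> cball (x + v) (1 / lam)" for x y
    proof -
      have d: "norm (y - (x + v)) \<le> 1 / lam" using y by (simp add: dist_norm norm_minus_commute)
      have nv: "norm v = pi / lam" using lam by (simp add: v_def)
      have "norm (x - y) \<le> norm v + norm (y - (x + v))"
        using norm_triangle_ineq[of v "y - (x + v)"] by (simp add: norm_minus_commute)
      also have "\<dots> \<le> pi / lam + 1 / lam" using d nv by simp
      also have "\<dots> \<le> 5 / lam" using pi_less_4 lam by (simp add: add_divide_distrib[symmetric] divide_right_mono)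
      finally have xy5: "norm (x - y) \<le> 5 / lam" .
      define t where "t = lam * (y $ i - x $ i)"
      have vi: "v $ i = pi / lam" by (simp add: v_def)
      have "t - pi = lam * (y - (x + v)) $ i"
        using lam by (simp add: t_def vi algebra_simps)
      then have "\<bar>t - pi\<bar> = lam * \<bar>(y - (x + v)) $ i\<bar>" using lam by (simp add: abs_mult)
      also have "\<dots> \<le> lam * (1 / lam)"
        using component_le_norm_cart[of "y - (x + v)" i] d lam by (intro mult_left_mono) linarith+
      finally have "\<bar>t - pi\<bar> \<le> 1" using lam by simp
      from sin_or_cos_diff_ge_1[OF this, of "lam * x $ i"]
      have "\<exists>th\<in>{0, pi / 2}. 1 \<le> \<bar>sin (lam * x $ i + th) - sin (lam * y $ i + th)\<bar>"
        by (simp add: t_def right_diff_distrib sin_add)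
      then obtain th where th: "th \<in> {0, pi / 2}" "1 \<le> \<bar>sin (lam * x $ i + th) - sin (lam * y $ i + th)\<bar>"
        by blast
      have "lam powr (- s) * 1 \<le> lam powr (- s) * \<bar>sin (lam * x $ i + th) - sin (lam * y $ i + th)\<bar>"
        by (intro mult_left_mono th) simp
      also have "\<dots> = \<bar>lam powr (- s) * (sin (lam * x $ i + th) - sin (lam * y $ i + th))\<bar>"
        by (simp add: abs_mult)
      also have "\<dots> = \<bar>wave i s lam th x - wave i s lam th y\<bar>"
        by (simp add: wave_def right_diff_distrib)
      finally have w: "lam powr (- s) \<le> \<bar>wave i s lam th x - wave i s lam th y\<bar>" by simp
      have "x \<noteq> y" using th by auto
      have "lam powr (- s * q) = (lam powr (- s)) powr q" by (simp add: powr_powr)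
      also have "\<dots> \<le> \<bar>wave i s lam th x - wave i s lam th y\<bar> powr q"
        using w q by (intro powr_mono2) auto
      finally have "C \<le> \<bar>wave i s lam th x - wave i s lam th y\<bar> powr q / norm (x - y) powr b"
        unfolding C_def using xy5 b \<open>x \<noteq> y\<close> by (intro frac_le powr_mono2) auto
      then have "ennreal C \<le> F th x y" unfolding F_def by (rule ennreal_leI)
      also have "\<dots> \<le> F 0 x y + F (pi / 2) x y"
        using th(1) by (elim insertE emptyE; hypsubst; simp)
      finally have "ennreal C \<le> F 0 x y + F (pi / 2) x y" .
      moreover have "y \<in> cball x0 (3 * \<delta>)"
      proof -
        have "norm (x0 - x) \<le> \<delta>" using x by (simp add: dist_norm)
        then have "norm (x0 - y) \<le> \<delta> + \<delta>"
          using norm_triangle_ineq[of "x0 - x" "x - y"] xy5 lam(2) by simp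
        then show ?thesis using ball(2) by (simp add: dist_norm)
      qed
      ultimately show ?thesis using ball(1) by blast
    qed
    have mF: "(\<lambda>(x, y). F th x y) \<in> borel_measurable (lebesgue_on \<Omega> \<Otimes>\<^sub>M lebesgue_on \<Omega>)" for th
      unfolding F_def by (rule measurable_gagliardo_kernel[OF mw])
    interpret L: sigma_finite_measure "lebesgue_on \<Omega>" by (rule sigma_finite_lebesgue_on[OF \<Omega>])
    have mFx: "F th x \<in> borel_measurable (lebesgue_on \<Omega>)" if "x \<in> space (lebesgue_on \<Omega>)" for th x
      using measurable_compose[OF measurable_Pair1'[OF that] mF[of th]] by simp
    have "(\<integral>\<^sup>+x. (\<integral>\<^sup>+y. F 0 x y + F (pi / 2) x y \<partial>lebesgue_on \<Omega>) \<partial>lebesgue_on \<Omega>) =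
        (\<integral>\<^sup>+x. (\<integral>\<^sup>+y. F 0 x y \<partial>lebesgue_on \<Omega>) + (\<integral>\<^sup>+y. F (pi / 2) x y \<partial>lebesgue_on \<Omega>) \<partial>lebesgue_on \<Omega>)"
      by (intro nn_integral_cong nn_integral_add mFx)
    also have "\<dots> = J 0 + J (pi / 2)"
      using L.borel_measurable_nn_integral_fst[OF mF] unfolding J_def
      by (intro nn_integral_add) simp_all
    finally have sum: "(\<integral>\<^sup>+x. (\<integral>\<^sup>+y. F 0 x y + F (pi / 2) x y \<partial>lebesgue_on \<Omega>) \<partial>lebesgue_on \<Omega>) = J 0 + J (pi / 2)" .
    have "cball x0 \<delta> \<subseteq> cball x0 (3 * \<delta>)" using ball(2) by (intro subset_cball) simp
    then have "ennreal C * ennreal (V * (1 / lam) ^ N) * emeasure lebesgue (cball x0 \<delta>) \<le> J 0 + J (pi / 2)"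
      unfolding sum[symmetric] V_def N_def using pt lam ball fmeasurableD[OF \<Omega>]
      by (intro iterated_integral_ge[where w = v]) auto
    moreover have "emeasure lebesgue (cball x0 \<delta>) = ennreal (V * \<delta> ^ N)"
      using emeasure_lebesgue_cball[of \<delta> x0] ball(2) by (simp add: V_def N_def)
    moreover have "ennreal C * ennreal (V * (1 / lam) ^ N) * ennreal (V * \<delta> ^ N) = ennreal (C * (V * (1 / lam) ^ N) * (V * \<delta> ^ N))"
      using V ball(2) lam by (simp add: ennreal_mult[symmetric] C_def)
    moreover have "B \<le> C * (V * (1 / lam) ^ N) * (V * \<delta> ^ N)"
    proof -
      have "C * (1 / lam) ^ N = 5 powr (- b) * (lam powr (- s * q) * lam powr b * lam powr (- real N))"
        using lam by (simp add: C_def powr_divide powr_minus_divide powr_realpow power_one_over)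
      also have "\<dots> = 5 powr (- b) * lam powr ((st - s) * q)"
        unfolding powr_add[symmetric] by (simp add: b_def algebra_simps)
      also have "\<dots> \<ge> 5 powr (- b) * 1"
        using lam s q by (intro mult_left_mono ge_one_powr_ge_zero) auto
      finally have "5 powr (- b) \<le> C * (1 / lam) ^ N" by simp
      then have "5 powr (- b) * (V * (V * \<delta> ^ N)) \<le> C * (1 / lam) ^ N * (V * (V * \<delta> ^ N))"
        using V ball(2) by (intro mult_right_mono) auto
      then show ?thesis by (simp add: B_def mult_ac)
    qed
    ultimately have BJ: "ennreal B \<le> J 0 + J (pi / 2)"
      by (metis ennreal_leI order.trans)
    have "\<exists>th. ennreal (B / 2) \<le> J th"
    proof (rule ccontr)
      assume "\<not> ?thesis"
      then have "J 0 + J (pi / 2) < ennreal (B / 2) + ennreal (B / 2)"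
        by (intro add_strict_mono) (auto simp: not_le)
      also have "\<dots> = ennreal B" using B by (subst ennreal_plus[symmetric]) auto
      finally show False using BJ by simp
    qed
    then obtain th where th: "ennreal (B / 2) \<le> J th" by blast
    have "ennreal c \<le> sobolev_norm st (ereal q) \<Omega> w"
      if "w \<in> borel_measurable (lebesgue_on \<Omega>)" "AE x in lebesgue_on \<Omega>. w x = wave i s lam th x" for w
      using sobolev_norm_ge_gagliardo[OF \<Omega> _ _ q mw that, of st "B / 2"] s B th
      by (simp add: c_def J_def F_def b_def N_def)
    then show "\<exists>th. \<forall>w\<in>borel_measurable (lebesgue_on \<Omega>). (AE x in lebesgue_on \<Omega>. w x = wave i s lam th x) \<longrightarrow>
      ennreal c \<le> sobolev_norm st (ereal q) \<Omega> w" by blast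
  qed
qed

text \<open>The test function is the derivative profile of the wave itself, cut off by \<psi>.
  Summed over both phases the pairing equals \<open>lam powr (1 - s)\<close> times the integral of
  \<psi>, which is at least \<open>2 * \<kappa>\<close>; so one phase reaches \<kappa>.\<close>

lemma wave_weak_gradient_lower:
  fixes \<Omega> :: "(real^'n) set"
  assumes \<Omega>: "\<Omega> \<in> lmeasurable" and s: "s \<le> 1" and q: "1 \<le> q" and ball: "cball x0 \<delta> \<subseteq> \<Omega>" "0 < \<delta>"
  obtains c where "0 < c" and "\<And>i lam. 1 \<le> lam \<Longrightarrow>
    \<exists>th. \<forall>w\<in>borel_measurable (lebesgue_on \<Omega>). (AE x in lebesgue_on \<Omega>. w x = wave i s lam th x) \<longrightarrow>
      ennreal c \<le> sobolev_norm 1 (ereal q) \<Omega> w"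
proof -
  define r where "r = \<delta> / real CARD('n)"
  define \<psi> where "\<psi> = (box_bump x0 r :: real^'n \<Rightarrow> real)"
  define \<kappa> where "\<kappa> = (LINT x|lborel. \<psi> x) / 2"
  have \<kappa>: "0 < \<kappa>" using integral_box_bump_pos[of r x0] ball(2) by (simp add: \<kappa>_def \<psi>_def r_def)
  obtain c where c: "0 < c" "\<And>u w \<eta> i. \<lbrakk>test_function \<Omega> \<eta>; \<And>x. \<bar>\<eta> x\<bar> \<le> 1; continuous_on UNIV u;
      w \<in> borel_measurable (lebesgue_on \<Omega>); AE x in lebesgue_on \<Omega>. w x = u x;
      \<kappa> \<le> - (LINT x|lebesgue_on \<Omega>. u x * partial_deriv i \<eta> x)\<rbrakk> \<Longrightarrow> ennreal c \<le> sobolev_norm 1 (ereal q) \<Omega> w"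
    using sobolev_norm_1_ge_test[OF \<Omega> q \<kappa>] by blast
  show ?thesis
  proof (rule that[OF c(1)])
    fix i lam assume lam: "(1::real) \<le> lam"
    define \<eta> where "\<eta> th x = \<psi> x * cos (lam * x $ i + th)" for th x
    define J where "J th = - (LINT x|lebesgue_on \<Omega>. wave i s lam th x * partial_deriv i (\<eta> th) x)" for th
    \<comment> \<open>A ball about the origin that contains the support, in the form required by
      \<open>integrable_continuous_bounded_support\<close>.\<close>
    define R where "R = norm x0 + \<delta>"
    have "cball x0 \<delta> \<subseteq> cball 0 R" by (simp add: cball_subset_cball_iff R_def dist_norm)
    then have tR: "test_function (cball 0 R) (\<eta> th)" for th
      unfolding \<eta>_def \<psi>_def r_def by (intro test_function_box_bump_mult Ck_cos_affine ball(2))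
    have t: "test_function \<Omega> (\<eta> th)" for th
      unfolding \<eta>_def \<psi>_def r_def by (intro test_function_box_bump_mult Ck_cos_affine ball)
    have "Ck 1 (\<eta> th)" for th using t unfolding test_function_def by blast
    then have cd: "continuous_on UNIV (partial_deriv i (\<eta> th))" for th by simp
    have cf: "continuous_on UNIV (\<lambda>x. wave i s lam th x * partial_deriv i (\<eta> th) x)" for th
      by (intro continuous_on_mult continuous_wave cd)
    have J: "J th = - (LINT x|lborel. wave i s lam th x * partial_deriv i (\<eta> th) x)" for th
      unfolding J_def using test_function_zero_outside[OF t]
      by (subst integral_lebesgue_on_eq_lborel[OF fmeasurableD[OF \<Omega>] cf]) auto
    have int: "integrable lborel (\<lambda>x. wave i s lam th x * partial_deriv i (\<eta> th) x)" for th
      using test_function_zero_outside[OF tR]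
      by (intro integrable_continuous_bounded_support[OF cf, of R]) auto
    have pd: "partial_deriv i (\<eta> th) x = \<psi> x * (- sin (lam * x $ i + th) * lam)
        + partial_deriv i \<psi> x * cos (lam * x $ i + th)" for th x
    proof -
      have D: "((\<lambda>x. cos (lam * x $ i + th)) has_derivative (\<lambda>h. - sin (lam * x $ i + th) * (lam * h $ i))) (at x)"
        by (rule has_derivative_affine_coordinate[OF DERIV_cos])
      have "\<psi> differentiable (at x)" unfolding \<psi>_def by (rule Ck_differentiable[OF Ck_box_bump])
      then have "partial_deriv i (\<lambda>x. \<psi> x * cos (lam * x $ i + th)) x =
          \<psi> x * partial_deriv i (\<lambda>x. cos (lam * x $ i + th)) x + partial_deriv i \<psi> x * cos (lam * x $ i + th)"
        using D by (intro partial_deriv_mult) (auto simp: differentiable_def)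
      then show ?thesis unfolding \<eta>_def partial_deriv_eqI[OF D] by simp
    qed
    text \<open>The terms with a derivative of \<open>\<psi>\<close> cancel between the two phases.\<close>
    have "J 0 + J (pi / 2) = (LINT x|lborel. - (wave i s lam 0 x * partial_deriv i (\<eta> 0) x)
        - wave i s lam (pi / 2) x * partial_deriv i (\<eta> (pi / 2)) x)"
      unfolding J using int by simp
    also have "\<dots> = (LINT x|lborel. (lam powr (- s) * lam) * \<psi> x)"
    proof (intro Bochner_Integration.integral_cong refl)
      fix x
      have sc: "sin a * sin a + cos a * cos a = 1" for a :: real
        using sin_cos_squared_add3[of a] by (simp add: add.commute)
      define S where "S = sin (lam * x $ i)"
      define C where "C = cos (lam * x $ i)"
      have "- (wave i s lam 0 x * partial_deriv i (\<eta> 0) x) - wave i s lam (pi / 2) x * partial_deriv i (\<eta> (pi / 2)) x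
          = (lam powr (- s) * lam) * \<psi> x * (S * S + C * C)"
        unfolding pd wave_def by (simp add: sin_add cos_add S_def[symmetric] C_def[symmetric] algebra_simps)
      then show "- (wave i s lam 0 x * partial_deriv i (\<eta> 0) x) - wave i s lam (pi / 2) x * partial_deriv i (\<eta> (pi / 2)) x
          = (lam powr (- s) * lam) * \<psi> x"
        by (simp add: S_def C_def sc)
    qed
    also have "\<dots> = lam powr (1 - s) * (2 * \<kappa>)"
      using lam by (simp add: \<kappa>_def powr_diff powr_minus_divide)
    also have "\<dots> \<ge> 1 * (2 * \<kappa>)"
      using lam s \<kappa> by (intro mult_right_mono ge_one_powr_ge_zero) auto
    finally have "\<exists>th. \<kappa> \<le> J th" by (metis add_strict_mono mult_1 mult_2 not_le)
    then obtain th where th: "\<kappa> \<le> J th" ..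
    have \<eta>1: "\<bar>\<eta> th x\<bar> \<le> 1" for x
      unfolding \<eta>_def abs_mult \<psi>_def by (intro mult_le_one) (simp_all add: box_bump_bounds)
    have "ennreal c \<le> sobolev_norm 1 (ereal q) \<Omega> w"
      if "w \<in> borel_measurable (lebesgue_on \<Omega>)" "AE x in lebesgue_on \<Omega>. w x = wave i s lam th x" for w
      by (rule c(2)[OF t \<eta>1 continuous_wave that th[unfolded J_def]])
    then show "\<exists>th. \<forall>w\<in>borel_measurable (lebesgue_on \<Omega>). (AE x in lebesgue_on \<Omega>. w x = wave i s lam th x) \<longrightarrow>
      ennreal c \<le> sobolev_norm 1 (ereal q) \<Omega> w" by blast
  qed
qed

text \<open>Three estimates share the target norms: Hoelder quotients for
  \<open>pt = \<infinity>\<close>, Gagliardo energies for finite \<open>pt\<close> and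
  \<open>st < 1\<close>, weak gradients for finite \<open>pt\<close> and \<open>st = 1\<close>. The
  threshold \<open>L\<close> keeps the points that are compared inside one ball in \<Omega>.\<close>

lemma wave_lower:
  fixes \<Omega> :: "(real^'n) set"
  assumes \<Omega>: "open \<Omega>" "\<Omega> \<in> lmeasurable" "\<Omega> \<noteq> {}" and s: "0 < s" "s \<le> st" "st \<le> 1" and pt: "1 \<le> pt"
  obtains c L where "0 < c" "1 \<le> L" and "\<And>i lam. L \<le> lam \<Longrightarrow>
    \<exists>th. \<forall>w\<in>borel_measurable (lebesgue_on \<Omega>). (AE x in lebesgue_on \<Omega>. w x = wave i s lam th x) \<longrightarrow>
      ennreal c \<le> sobolev_norm st pt \<Omega> w"
proof -
  obtain x0 where "x0 \<in> \<Omega>" using \<Omega> by blast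
  then obtain e where e: "0 < e" "cball x0 e \<subseteq> \<Omega>"
    using \<Omega>(1) open_contains_cball by blast
  define \<delta> where "\<delta> = e / 3"
  have \<delta>: "0 < \<delta>" "cball x0 (3 * \<delta>) \<subseteq> \<Omega>" using e by (simp_all add: \<delta>_def)
  have \<delta>': "cball x0 \<delta> \<subseteq> \<Omega>" using \<delta> subset_cball[of \<delta> "3 * \<delta>" x0] by auto
  define L where "L = max 1 (5 / \<delta>)"
  have L: "1 \<le> lam" "5 / lam \<le> \<delta>" "pi / lam \<le> \<delta>" if "L \<le> lam" for lam
  proof -
    show 1: "1 \<le> lam" using that by (simp add: L_def)
    show 2: "5 / lam \<le> \<delta>" using that 1 \<delta> by (simp add: L_def field_simps)
    have "pi / lam \<le> 5 / lam" using 1 pi_less_4 by (intro divide_right_mono) auto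
    with 2 show "pi / lam \<le> \<delta>" by linarith
  qed
  have "1 \<le> L" by (simp add: L_def)
  consider "pt = \<infinity>" | q where "pt = ereal q" "1 \<le> q" "st < 1" | q where "pt = ereal q" "1 \<le> q" "st = 1"
  proof (cases pt)
    case (real q)
    then show ?thesis using that pt s(3) by (cases "st = 1") auto
  qed (use that pt in auto)
  then show ?thesis
  proof cases
    case 1
    have "\<exists>th. \<forall>w\<in>borel_measurable (lebesgue_on \<Omega>). (AE x in lebesgue_on \<Omega>. w x = wave i s lam th x) \<longrightarrow>
        ennreal (1 / 2) \<le> sobolev_norm st pt \<Omega> w" if "L \<le> lam" for i lam
      using wave_holder_lower[OF \<Omega>(1) s \<delta>' \<delta>(1) L(1)[OF that] L(3)[OF that]] unfolding 1 by blast
    then show ?thesis using that[of "1 / 2" L] \<open>1 \<le> L\<close> by simp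
  next
    case (2 q)
    obtain c where "0 < c" and "\<And>i lam. 1 \<le> lam \<Longrightarrow> 5 / lam \<le> \<delta> \<Longrightarrow>
      \<exists>th. \<forall>w\<in>borel_measurable (lebesgue_on \<Omega>). (AE x in lebesgue_on \<Omega>. w x = wave i s lam th x) \<longrightarrow>
        ennreal c \<le> sobolev_norm st (ereal q) \<Omega> w"
      using wave_gagliardo_lower[OF \<Omega>(2) s(1,2) 2(3,2) \<delta>(2,1)] by blast
    then show ?thesis by (intro that[of c L] \<open>1 \<le> L\<close>) (simp_all add: L 2)
  next
    case (3 q)
    obtain c where "0 < c" and "\<And>i lam. 1 \<le> lam \<Longrightarrow>
      \<exists>th. \<forall>w\<in>borel_measurable (lebesgue_on \<Omega>). (AE x in lebesgue_on \<Omega>. w x = wave i s lam th x) \<longrightarrow>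
        ennreal c \<le> sobolev_norm st (ereal q) \<Omega> w"
      using wave_weak_gradient_lower[OF \<Omega>(2) s(2)[unfolded 3(3)] 3(2) \<delta>' \<delta>(1)] unfolding 3(3) by blast
    then show ?thesis by (intro that[of c L] \<open>1 \<le> L\<close>) (simp_all add: L 3)
  qed
qed

lemma not_compactly_embedded_waves:
  fixes \<Omega> :: "(real^'n) set"
  assumes \<Omega>: "open \<Omega>" "\<Omega> \<in> lmeasurable" "\<Omega> \<noteq> {}" and s: "0 < s" "s \<le> st" "st \<le> 1" and p: "1 \<le> p" "1 \<le> pt"
  shows "\<not> compactly_embedded (sobolev_space s p \<Omega>) (sobolev_norm s p \<Omega>) (sobolev_space st pt \<Omega>) (sobolev_norm st pt \<Omega>)"
proof -
  obtain c L where c: "0 < c" and L: "1 \<le> L" and low: "\<And>i lam. L \<le> lam \<Longrightarrow>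
    \<exists>th. \<forall>w\<in>borel_measurable (lebesgue_on \<Omega>). (AE x in lebesgue_on \<Omega>. w x = wave i s lam th x) \<longrightarrow>
      ennreal c \<le> sobolev_norm st pt \<Omega> w"
    using wave_lower[OF \<Omega> s p(2)] by blast
  have "s \<le> 1" using s by simp
  then obtain R where R: "\<And>i lam th. 1 \<le> lam \<Longrightarrow>
    wave i s lam th \<in> sobolev_space s p \<Omega> \<and> sobolev_norm s p \<Omega> (wave i s lam th) \<le> ennreal R"
    using wave_sobolev_bound[OF s(1) _ p(1) \<Omega>(2)] by blast
  \<comment> \<open>Any coordinate direction serves; \<open>undefined\<close> names one.\<close>
  define i where "i = (undefined :: 'n)"
  define e where "e k = (L + real k) powr (- s)" for k
  have "filterlim (\<lambda>k. L + real k) at_top sequentially"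
    by (rule filterlim_tendsto_add_at_top[OF tendsto_const filterlim_real_sequentially])
  then have e0: "e \<longlonglongrightarrow> 0"
    unfolding e_def using s(1) by (intro tendsto_neg_powr) auto
  show ?thesis
  proof (rule not_compactly_embedded_sobolevI[OF \<Omega>(2) _ p(2) c e0])
    show "0 < st" using s by simp
    fix k :: nat
    have lam: "L \<le> L + real k" "1 \<le> L + real k" using L by auto
    obtain th where "\<forall>w\<in>borel_measurable (lebesgue_on \<Omega>).
        (AE x in lebesgue_on \<Omega>. w x = wave i s (L + real k) th x) \<longrightarrow> ennreal c \<le> sobolev_norm st pt \<Omega> w"
      using low[OF lam(1)] by blast
    then show "\<exists>u\<in>sobolev_space s p \<Omega>. sobolev_norm s p \<Omega> u \<le> ennreal R \<and> (\<forall>x. \<bar>u x\<bar> \<le> e k) \<and>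
      (\<forall>w\<in>borel_measurable (lebesgue_on \<Omega>). (AE x in lebesgue_on \<Omega>. w x = u x) \<longrightarrow> ennreal c \<le> sobolev_norm st pt \<Omega> w)"
      using R[OF lam(2), of i th] wave_bound[of i s "L + real k" th] unfolding e_def by blast
  qed
qed

section \<open>Concentrating bumps, for \<open>s - N / p < st < s\<close>\<close>

text \<open>The profile is \<open>(1 - \<bar>z\<bar>^2)^2\<close> on the unit ball, continued by 0.
  Squaring the positive part makes it C1 across the unit sphere, and the inner product instead of
  the norm keeps it differentiable at the centre.\<close>

definition rescaled_bump :: "'a::euclidean_space \<Rightarrow> real \<Rightarrow> real \<Rightarrow> 'a \<Rightarrow> real" where
  "rescaled_bump x0 M lam x = M * (max 0 (1 - (lam *\<^sub>R (x - x0)) \<bullet> (lam *\<^sub>R (x - x0))))\<^sup>2"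

definition rescaled_bump_gradient :: "'a::euclidean_space \<Rightarrow> real \<Rightarrow> real \<Rightarrow> 'a \<Rightarrow> 'a" where
  "rescaled_bump_gradient x0 M lam x =
    (- 4 * M * lam * max 0 (1 - (lam *\<^sub>R (x - x0)) \<bullet> (lam *\<^sub>R (x - x0)))) *\<^sub>R (lam *\<^sub>R (x - x0))"

lemma has_derivative_max_0_power2:
  "((\<lambda>r::real. (max 0 (1 - r))\<^sup>2) has_real_derivative - 2 * max 0 (1 - t)) (at t)"
proof -
  consider "t < 1" | "1 < t" | "t = 1" by linarith
  then show ?thesis
  proof cases
    case 1
    have E: "\<forall>\<^sub>F r in nhds t. (max 0 (1 - r))\<^sup>2 = (1 - r)\<^sup>2"
      using eventually_nhds_in_open[OF open_lessThan, of t 1] 1 by (auto elim!: eventually_mono)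
    have "((\<lambda>r::real. (1 - r)\<^sup>2) has_real_derivative - 2 * max 0 (1 - t)) (at t)"
      using 1 by (auto intro!: derivative_eq_intros)
    then show ?thesis by (subst DERIV_cong_ev[OF refl E refl])
  next
    case 2
    have E: "\<forall>\<^sub>F r in nhds t. (max 0 (1 - r))\<^sup>2 = 0"
      using eventually_nhds_in_open[OF open_greaterThan, of t 1] 2 by (auto elim!: eventually_mono)
    have "((\<lambda>r::real. 0) has_real_derivative - 2 * max 0 (1 - t)) (at t)"
      using 2 by simp
    then show ?thesis by (subst DERIV_cong_ev[OF refl E refl])
  next
    case 3
    \<comment> \<open>At the kink of the positive part the square leaves a difference quotient of
      size at most \<open>\<bar>h\<bar>\<close>.\<close>
    have "((\<lambda>h. (max 0 (1 - (1 + h)))\<^sup>2 / h) \<longlongrightarrow> (0::real)) (at 0)"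
    proof (rule Lim_null_comparison)
      show "\<forall>\<^sub>F h in at (0::real). norm ((max 0 (1 - (1 + h)))\<^sup>2 / h) \<le> \<bar>h\<bar>"
        by (intro always_eventually allI) (auto simp: max_def power2_eq_square)
      show "((\<lambda>h::real. \<bar>h\<bar>) \<longlongrightarrow> 0) (at 0)" by (intro tendsto_eq_intros) auto
    qed
    then show ?thesis unfolding 3 DERIV_def by simp
  qed
qed

lemma has_derivative_rescaled_bump:
  "(rescaled_bump x0 M lam has_derivative (\<lambda>h. rescaled_bump_gradient x0 M lam x \<bullet> h)) (at x)"
proof -
  have "((\<lambda>x. lam *\<^sub>R (x - x0)) has_derivative (\<lambda>h. lam *\<^sub>R h)) (at x)"
    by (auto intro!: derivative_eq_intros)
  from has_derivative_inner[OF this this]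
  have "((\<lambda>x. (lam *\<^sub>R (x - x0)) \<bullet> (lam *\<^sub>R (x - x0))) has_derivative
      (\<lambda>h. (lam *\<^sub>R (x - x0)) \<bullet> (lam *\<^sub>R h) + (lam *\<^sub>R h) \<bullet> (lam *\<^sub>R (x - x0)))) (at x)" .
  from has_derivative_compose[OF this has_derivative_max_0_power2[unfolded has_field_derivative_def]]
  have "((\<lambda>x. M * (max 0 (1 - (lam *\<^sub>R (x - x0)) \<bullet> (lam *\<^sub>R (x - x0))))\<^sup>2) has_derivative
      (\<lambda>h. M * (- 2 * max 0 (1 - (lam *\<^sub>R (x - x0)) \<bullet> (lam *\<^sub>R (x - x0))) *
        ((lam *\<^sub>R (x - x0)) \<bullet> (lam *\<^sub>R h) + (lam *\<^sub>R h) \<bullet> (lam *\<^sub>R (x - x0)))))) (at x)"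
    by (rule has_derivative_mult_right)
  moreover have "(\<lambda>h. M * (- 2 * max 0 (1 - (lam *\<^sub>R (x - x0)) \<bullet> (lam *\<^sub>R (x - x0))) *
        ((lam *\<^sub>R (x - x0)) \<bullet> (lam *\<^sub>R h) + (lam *\<^sub>R h) \<bullet> (lam *\<^sub>R (x - x0))))) =
      (\<lambda>h. rescaled_bump_gradient x0 M lam x \<bullet> h)"
  proof -
    have "M * (- 2 * m * (z \<bullet> (lam *\<^sub>R h) + (lam *\<^sub>R h) \<bullet> z)) = ((- 4 * M * lam * m) *\<^sub>R z) \<bullet> h"
      for m and z h :: 'a
      unfolding inner_scaleR_left inner_scaleR_right inner_commute[of h z] by (simp add: algebra_simps)
    then show ?thesis unfolding rescaled_bump_gradient_def by blast
  qed
  ultimately show ?thesis unfolding rescaled_bump_def[abs_def] by simp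
qed

lemma continuous_rescaled_bump_gradient: "continuous_on UNIV (rescaled_bump_gradient x0 M lam)"
  unfolding rescaled_bump_gradient_def by (intro continuous_intros)

lemma continuous_rescaled_bump: "continuous_on UNIV (rescaled_bump x0 M lam)"
  unfolding rescaled_bump_def by (intro continuous_intros)

lemma rescaled_bump_bounds:
  assumes "0 \<le> M"
  shows "0 \<le> rescaled_bump x0 M lam x" "rescaled_bump x0 M lam x \<le> M"
proof -
  define z where "z = lam *\<^sub>R (x - x0)"
  have "(max 0 (1 - z \<bullet> z))\<^sup>2 \<le> 1\<^sup>2"
    by (intro power_mono) auto
  from mult_left_mono[OF this assms] show "rescaled_bump x0 M lam x \<le> M"
    unfolding rescaled_bump_def z_def[symmetric] by simp
qed (use assms in \<open>simp add: rescaled_bump_def\<close>)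

lemma rescaled_bump_outside:
  assumes "0 < lam" "1 / lam \<le> norm (x - x0)"
  shows "rescaled_bump x0 M lam x = 0" "rescaled_bump_gradient x0 M lam x = 0"
proof -
  have "1 \<le> norm (lam *\<^sub>R (x - x0))"
    unfolding norm_scaleR using assms by (simp add: field_simps)
  then have "1\<^sup>2 \<le> (norm (lam *\<^sub>R (x - x0)))\<^sup>2" by (intro power_mono) auto
  then have "max 0 (1 - (lam *\<^sub>R (x - x0)) \<bullet> (lam *\<^sub>R (x - x0))) = 0"
    unfolding power2_norm_eq_inner by simp
  then show "rescaled_bump x0 M lam x = 0" "rescaled_bump_gradient x0 M lam x = 0"
    unfolding rescaled_bump_def rescaled_bump_gradient_def by simp_all
qed

text \<open>Within half the radius \<open>1 - z \<bullet> z\<close> is at least 3/4, whose square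
  9/16 exceeds 1/2.\<close>

lemma rescaled_bump_center:
  assumes "0 \<le> M" "0 < lam" "norm (x - x0) \<le> 1 / (2 * lam)"
  shows "M / 2 \<le> rescaled_bump x0 M lam x"
proof -
  define z where "z = lam *\<^sub>R (x - x0)"
  have "norm z \<le> 1 / 2"
    unfolding z_def norm_scaleR using assms by (simp add: field_simps)
  then have "(norm z)\<^sup>2 \<le> (1 / 2)\<^sup>2" by (intro power_mono) auto
  then have "z \<bullet> z \<le> 1 / 4"
    unfolding power2_norm_eq_inner by (simp add: power2_eq_square)
  then have "3 / 4 \<le> max 0 (1 - z \<bullet> z)"
    using max.cobounded2[of "1 - z \<bullet> z" 0] by linarith
  then have "(3 / 4)\<^sup>2 \<le> (max 0 (1 - z \<bullet> z))\<^sup>2"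
    by (rule power_mono) simp
  then have "1 / 2 \<le> (max 0 (1 - z \<bullet> z))\<^sup>2"
    by (simp add: power2_eq_square[of "3 / 4 :: real"])
  from mult_left_mono[OF this assms(1)] show ?thesis
    unfolding rescaled_bump_def z_def[symmetric] by simp
qed

lemma rescaled_bump_gradient_bound:
  assumes "0 \<le> M" "0 < lam"
  shows "norm (rescaled_bump_gradient x0 M lam x) \<le> 2 * M * lam"
proof -
  define t where "t = norm (lam *\<^sub>R (x - x0))"
  have t: "0 \<le> t" by (simp add: t_def)
  have tt: "(lam *\<^sub>R (x - x0)) \<bullet> (lam *\<^sub>R (x - x0)) = t\<^sup>2"
    unfolding t_def power2_norm_eq_inner ..
  have "(1 - t\<^sup>2) * t \<le> 1 / 2"
  proof -
    \<comment> \<open>The number 3/5 is a rational approximation of \<open>1 / sqrt 3\<close>, where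
      \<open>(1 - t^2) * t\<close> is largest. The double root there and the factor
      \<open>t + 6 / 5\<close> give a cubic without quadratic term that certifies the bound.\<close>
    have "0 \<le> (t - 3 / 5)\<^sup>2 * (t + 6 / 5)" using t by simp
    also have "\<dots> = 1 / 2 - (1 - t\<^sup>2) * t - (8 / 100 * t + 68 / 1000)"
      by (simp add: power2_eq_square field_simps)
    finally show ?thesis using t by linarith
  qed
  then have b: "max 0 (1 - t\<^sup>2) * t \<le> 1 / 2" by (simp add: max_def)
  have "norm (rescaled_bump_gradient x0 M lam x) = 4 * M * lam * (max 0 (1 - t\<^sup>2) * t)"
    unfolding rescaled_bump_gradient_def tt norm_scaleR[of _ "lam *\<^sub>R (x - x0)"] t_def[symmetric]
    using assms by (simp add: abs_mult)
  also have "\<dots> \<le> 4 * M * lam * (1 / 2)"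
    using assms by (intro mult_left_mono b) simp
  finally show ?thesis by simp
qed

text \<open>The support has measure \<open>V * lam powr (- N)\<close>, and the amplitude is chosen
  so that the powers of \<open>lam\<close> in \<open>m * M powr P * lam powr (s * P)\<close> cancel
  and leave \<open>V\<close>.\<close>

lemma rescaled_bump_sobolev_bound:
  fixes \<Omega> :: "(real^'n) set"
  assumes s: "0 < s" "s \<le> 1" and P: "1 \<le> P" and \<Omega>: "\<Omega> \<in> lmeasurable"
  obtains R where "\<And>x0 lam. 1 \<le> lam \<Longrightarrow>
    rescaled_bump x0 (lam powr (real CARD('n) / P - s)) lam \<in> sobolev_space s (ereal P) \<Omega> \<and>
    sobolev_norm s (ereal P) \<Omega> (rescaled_bump x0 (lam powr (real CARD('n) / P - s)) lam) \<le> ennreal R"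
proof -
  define N where "N = CARD('n)"
  define V where "V = unit_ball_vol (real N)"
  have V: "0 \<le> V" by (simp add: V_def)
  obtain R where R: "\<And>M lam m A u Du. \<lbrakk>0 \<le> M; 1 \<le> lam; 0 \<le> m; A \<in> sets lebesgue; emeasure lebesgue A \<le> ennreal m;
      m * M powr P * lam powr (s * P) \<le> V; \<And>x. (u has_derivative (\<lambda>h. Du x \<bullet> h)) (at x); continuous_on UNIV Du;
      \<And>x. \<bar>u x\<bar> \<le> M; \<And>x. norm (Du x) \<le> 2 * M * lam; \<And>x. x \<in> \<Omega> - A \<Longrightarrow> u x = 0 \<and> Du x = 0\<rbrakk>
    \<Longrightarrow> u \<in> sobolev_space s (ereal P) \<Omega> \<and> sobolev_norm s (ereal P) \<Omega> u \<le> ennreal R"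
    using sobolev_norm_profile_bound[OF s P \<Omega> V] by blast
  show ?thesis
  proof (rule that)
    fix x0 :: "real^'n" and lam :: real assume lam: "1 \<le> lam"
    define M where "M = lam powr (real CARD('n) / P - s)"
    have M: "0 \<le> M" by (simp add: M_def)
    show "rescaled_bump x0 M lam \<in> sobolev_space s (ereal P) \<Omega> \<and>
      sobolev_norm s (ereal P) \<Omega> (rescaled_bump x0 M lam) \<le> ennreal R"
    proof (rule R[OF M lam, of "V * (1 / lam) ^ N" "cball x0 (1 / lam)"])
      show "0 \<le> V * (1 / lam) ^ N" using V lam by simp
      show "emeasure lebesgue (cball x0 (1 / lam)) \<le> ennreal (V * (1 / lam) ^ N)"
        using emeasure_lebesgue_cball[of "1 / lam" x0] lam by (simp add: V_def N_def)
      have "(1 / lam) ^ N = lam powr (- real N)"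
        using lam by (simp add: powr_minus_divide powr_realpow power_one_over)
      then have "V * (1 / lam) ^ N * M powr P * lam powr (s * P) =
          V * (lam powr (- real N) * lam powr ((real N / P - s) * P) * lam powr (s * P))"
        by (simp add: M_def powr_powr N_def)
      also have "\<dots> = V * lam powr 0"
        unfolding powr_add[symmetric] using P by (simp add: left_diff_distrib)
      also have "\<dots> = V" using lam by simp
      finally show "V * (1 / lam) ^ N * M powr P * lam powr (s * P) \<le> V" by (rule eq_refl)
      show "\<bar>rescaled_bump x0 M lam x\<bar> \<le> M" for x
        using rescaled_bump_bounds[OF M, of x0 lam x] by simp
      show "norm (rescaled_bump_gradient x0 M lam x) \<le> 2 * M * lam" for x
        using lam by (intro rescaled_bump_gradient_bound M) simp
      show "rescaled_bump x0 M lam x = 0 \<and> rescaled_bump_gradient x0 M lam x = 0" if "x \<in> \<Omega> - cball x0 (1 / lam)" for x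
        using that lam rescaled_bump_outside[of lam x x0 M] by (simp add: dist_norm norm_minus_commute)
    qed (auto intro: has_derivative_rescaled_bump continuous_rescaled_bump_gradient)
  qed
qed

text \<open>The centre and a boundary point of the support, at distance \<open>1 / lam\<close>, have
  Hoelder quotient \<open>lam powr (a + st) \<ge> 1\<close>.\<close>

lemma rescaled_bump_holder_lower:
  fixes \<Omega> :: "(real^'n) set"
  assumes \<Omega>: "open \<Omega>" and st: "0 < st" and ball: "cball x0 (4 / lam) \<subseteq> \<Omega>" and lam: "1 \<le> lam" and a: "0 \<le> a + st"
    and w: "AE x in lebesgue_on \<Omega>. w x = rescaled_bump x0 (lam powr a) lam x"
  shows "ennreal (1 / 2) \<le> sobolev_norm st \<infinity> \<Omega> w"
proof -
  let ?u = "rescaled_bump x0 (lam powr a) lam"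
  obtain e :: "real^'n" where e: "norm e = 1" using vector_choose_size[of 1] by auto
  let ?b = "x0 + (1 / lam) *\<^sub>R e"
  have n: "norm (x0 - ?b) = 1 / lam" using lam e by simp
  have ua: "?u x0 = lam powr a" by (simp add: rescaled_bump_def)
  have ub: "?u ?b = 0" using lam n by (intro rescaled_bump_outside) (simp_all add: norm_minus_commute)
  have "1 \<le> lam powr (a + st)" using lam a by (intro ge_one_powr_ge_zero) auto
  also have "\<dots> = \<bar>?u x0 - ?u ?b\<bar> / norm (x0 - ?b) powr st"
    unfolding ua ub n using lam by (simp add: powr_add powr_divide)
  finally have "1 / 2 < \<bar>?u x0 - ?u ?b\<bar> / norm (x0 - ?b) powr st" by linarith
  moreover have "?b \<in> cball x0 (4 / lam)" "x0 \<in> cball x0 (4 / lam)"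
    using n lam by (simp_all add: dist_norm divide_right_mono)
  moreover have "x0 \<noteq> ?b"
  proof
    assume "x0 = ?b"
    then have "norm (x0 - ?b) = 0" by (metis right_minus_eq norm_zero)
    then show False using n lam by simp
  qed
  ultimately show ?thesis
    using ball w st by (intro sobolev_norm_infinity_ge[OF \<Omega> _ continuous_rescaled_bump, of _ x0 ?b]) auto
qed

text \<open>Pair points near the centre, where the bump is at least half its height, with points
  just off the support. The energy of these pairs is at least a constant times
  \<open>lam powr ((a + st) * q - N)\<close>, and the hypothesis on \<open>a\<close> makes the
  exponent nonnegative.\<close>

lemma rescaled_bump_gagliardo_lower:
  fixes \<Omega> :: "(real^'n) set"
  assumes \<Omega>: "\<Omega> \<in> lmeasurable" and st: "0 < st" "st < 1" and q: "1 \<le> q" and a: "real CARD('n) \<le> (a + st) * q"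
  obtains c where "0 < c" and "\<And>x0 lam w. \<lbrakk>1 \<le> lam; cball x0 (4 / lam) \<subseteq> \<Omega>; w \<in> borel_measurable (lebesgue_on \<Omega>);
      AE x in lebesgue_on \<Omega>. w x = rescaled_bump x0 (lam powr a) lam x\<rbrakk> \<Longrightarrow> ennreal c \<le> sobolev_norm st (ereal q) \<Omega> w"
proof -
  define N where "N = CARD('n)"
  define V where "V = unit_ball_vol (real N)"
  define b where "b = real N + st * q"
  have b: "0 < b" using st q by (auto simp: b_def intro: add_nonneg_pos)
  \<comment> \<open>The factor \<open>2 powr (- q)\<close> comes from half the height,
    \<open>3 powr (- b)\<close> from \<open>norm (x - y) \<le> 3 / lam\<close>, and each
    \<open>(1 / 2) ^ N\<close> from a ball of radius \<open>1 / (2 * lam)\<close>.\<close>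
  define B where "B = 2 powr (- q) * 3 powr (- b) * (V * (1 / 2) ^ N) * (V * (1 / 2) ^ N)"
  have V: "0 < V" by (simp add: V_def)
  have B: "0 < B" using V by (simp add: B_def)
  define c where "c = (gagliardo_const N st q * B) powr (1 / q)"
  have g: "0 < gagliardo_const N st q"
    using gagliardo_const_pos[of st q N] st q by (simp add: N_def Suc_le_eq)
  show ?thesis
  proof (rule that[of c])
    show "0 < c" using g B by (simp add: c_def)
    fix x0 :: "real^'n" and lam :: real and w
    assume lam: "1 \<le> lam" and ball: "cball x0 (4 / lam) \<subseteq> \<Omega>" and w: "w \<in> borel_measurable (lebesgue_on \<Omega>)"
      and ae: "AE x in lebesgue_on \<Omega>. w x = rescaled_bump x0 (lam powr a) lam x"
    define u where "u = rescaled_bump x0 (lam powr a) lam"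
    define F where "F x y = ennreal (\<bar>u x - u y\<bar> powr q / norm (x - y) powr b)" for x y
    define \<rho> where "\<rho> = 1 / (2 * lam)"
    have \<rho>: "0 < \<rho>" "1 / lam = 2 * \<rho>" "3 / lam = 6 * \<rho>" "4 / lam = 8 * \<rho>" using lam by (simp_all add: \<rho>_def)
    obtain e :: "real^'n" where e: "norm e = 1" using vector_choose_size[of 1] by auto
    \<comment> \<open>The shift by \<open>4 * \<rho>\<close> loses at most \<rho> for each of the
      two balls, so \<open>y\<close> stays at least \<open>2 * \<rho> = 1 / lam\<close> away from
      \<open>x0\<close>, where the bump is 0, and at most \<open>6 * \<rho>\<close>, inside the
      given ball.\<close>
    define v where "v = (4 * \<rho>) *\<^sub>R e"
    have nv: "norm v = 4 * \<rho>" using e \<rho> by (simp add: v_def)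
    define C where "C = (lam powr a / 2) powr q / (3 / lam) powr b"
    have geo: "norm (x - y) \<le> 5 * \<rho>" "3 * \<rho> \<le> norm (x - y)" "norm (y - x0) \<le> 6 * \<rho>" "2 * \<rho> \<le> norm (y - x0)"
      if x: "x \<in> cball x0 \<rho>" and y: "y \<in> cball (x + v) \<rho>" for x y
    proof -
      have x': "norm (x - x0) \<le> \<rho>" using x by (simp add: dist_norm norm_minus_commute)
      have d: "norm (y - (x + v)) \<le> \<rho>" using y by (simp add: dist_norm norm_minus_commute)
      have "norm (y - x) \<le> norm v + norm (y - (x + v))"
        using norm_triangle_ineq[of v "y - (x + v)"] by simp
      then show 1: "norm (x - y) \<le> 5 * \<rho>" using nv d by (simp add: norm_minus_commute)
      have "norm v - norm (y - (x + v)) \<le> norm (y - x)"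
        using norm_diff_ineq[of v "y - (x + v)"] by simp
      then show 2: "3 * \<rho> \<le> norm (x - y)" using nv d by (simp add: norm_minus_commute)
      show "norm (y - x0) \<le> 6 * \<rho>"
        using norm_triangle_ineq[of "y - x" "x - x0"] 1 x' by (simp add: norm_minus_commute)
      show "2 * \<rho> \<le> norm (y - x0)"
        using norm_diff_ineq[of "y - x" "x - x0"] 2 x' by (simp add: norm_minus_commute)
    qed
    have pt: "ennreal C \<le> F x y" if x: "x \<in> cball x0 \<rho>" and y: "y \<in> cball (x + v) \<rho>" for x y
    proof -
      have "lam powr a / 2 \<le> u x"
        unfolding u_def using lam x by (intro rescaled_bump_center) (simp_all add: dist_norm norm_minus_commute \<rho>_def)
      moreover have "u y = 0"
        unfolding u_def using lam geo(4)[OF x y] \<rho> by (intro rescaled_bump_outside) auto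
      ultimately have num: "(lam powr a / 2) powr q \<le> \<bar>u x - u y\<bar> powr q"
        using q by (intro powr_mono2) auto
      have "0 < norm (x - y)" "norm (x - y) \<le> 3 / lam"
        using geo(1,2)[OF x y] \<rho>(1,3) by linarith+
      then have "0 < norm (x - y) powr b" "norm (x - y) powr b \<le> (3 / lam) powr b"
        using b by (auto intro!: powr_mono2)
      then show ?thesis
        unfolding F_def C_def by (intro ennreal_leI frac_le num) auto
    qed
    have sub: "cball (x + v) \<rho> \<subseteq> \<Omega>" if "x \<in> cball x0 \<rho>" for x
    proof
      fix y assume "y \<in> cball (x + v) \<rho>"
      from geo(3)[OF that this] have "y \<in> cball x0 (4 / lam)"
        using \<rho> by (simp add: dist_norm norm_minus_commute)
      then show "y \<in> \<Omega>" using ball by blast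
    qed
    have sub0: "cball x0 \<rho> \<subseteq> \<Omega>" using ball subset_cball[of \<rho> "4 / lam" x0] \<rho> by auto
    have "ennreal C * ennreal (V * \<rho> ^ N) * emeasure lebesgue (cball x0 \<rho>)
        \<le> (\<integral>\<^sup>+x. (\<integral>\<^sup>+y. F x y \<partial>lebesgue_on \<Omega>) \<partial>lebesgue_on \<Omega>)"
      unfolding V_def N_def using pt sub sub0 \<rho>(1) fmeasurableD[OF \<Omega>]
      by (intro iterated_integral_ge[where w = v]) auto
    also have "emeasure lebesgue (cball x0 \<rho>) = ennreal (V * \<rho> ^ N)"
      using emeasure_lebesgue_cball[of \<rho> x0] \<rho> by (simp add: V_def N_def)
    also have "ennreal C * ennreal (V * \<rho> ^ N) * ennreal (V * \<rho> ^ N) = ennreal (C * (V * \<rho> ^ N) * (V * \<rho> ^ N))"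
      using V \<rho> by (simp add: ennreal_mult[symmetric] C_def)
    finally have I: "ennreal (C * (V * \<rho> ^ N) * (V * \<rho> ^ N)) \<le> (\<integral>\<^sup>+x. (\<integral>\<^sup>+y. F x y \<partial>lebesgue_on \<Omega>) \<partial>lebesgue_on \<Omega>)" .
    have "B \<le> C * (V * \<rho> ^ N) * (V * \<rho> ^ N)"
    proof -
      have r: "\<rho> ^ N = (1 / 2) ^ N * lam powr (- real N)"
        using lam by (simp add: \<rho>_def powr_minus_divide powr_realpow power_one_over power_mult_distrib)
      have "C * lam powr (- real N) * lam powr (- real N) =
          2 powr (- q) * 3 powr (- b) * (lam powr (a * q) * lam powr b * lam powr (- real N) * lam powr (- real N))"
        using lam by (simp add: C_def powr_divide powr_minus_divide powr_powr)
      also have "\<dots> = 2 powr (- q) * 3 powr (- b) * lam powr ((a + st) * q - real N)"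
        unfolding powr_add[symmetric] by (simp add: b_def algebra_simps)
      also have "\<dots> \<ge> 2 powr (- q) * 3 powr (- b) * 1"
        using lam a by (intro mult_left_mono ge_one_powr_ge_zero) (auto simp: N_def)
      finally have "2 powr (- q) * 3 powr (- b) \<le> C * lam powr (- real N) * lam powr (- real N)" by simp
      then have "2 powr (- q) * 3 powr (- b) * ((V * (1 / 2) ^ N) * (V * (1 / 2) ^ N)) \<le>
          C * lam powr (- real N) * lam powr (- real N) * ((V * (1 / 2) ^ N) * (V * (1 / 2) ^ N))"
        using V by (intro mult_right_mono) auto
      then show ?thesis unfolding B_def r by (simp only: mult_ac)
    qed
    then have "ennreal B \<le> (\<integral>\<^sup>+x. (\<integral>\<^sup>+y. F x y \<partial>lebesgue_on \<Omega>) \<partial>lebesgue_on \<Omega>)"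
      using I by (rule order.trans[OF ennreal_leI])
    then show "ennreal c \<le> sobolev_norm st (ereal q) \<Omega> w"
      using sobolev_norm_ge_gagliardo[OF \<Omega> st q measurable_lebesgue_on_continuous[OF continuous_rescaled_bump] w ae, of B] B
      by (simp add: c_def F_def b_def N_def u_def)
  qed
qed

lemma not_compactly_embedded_rescaled_bumps:
  fixes \<Omega> :: "(real^'n) set"
  assumes \<Omega>: "open \<Omega>" "\<Omega> \<in> lmeasurable" "\<Omega> \<noteq> {}" and s: "s \<le> 1" and P: "1 \<le> P" "real CARD('n) / P < s"
    and st: "s - real CARD('n) / P < st" "st < s"
    and pt: "1 \<le> pt" "ereal (real CARD('n) * P / (real CARD('n) - (s - st) * P)) \<le> pt"
  shows "\<not> compactly_embedded (sobolev_space s (ereal P) \<Omega>) (sobolev_norm s (ereal P) \<Omega>) (sobolev_space st pt \<Omega>) (sobolev_norm st pt \<Omega>)"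
proof -
  define N where "N = real CARD('n)"
  define a where "a = N / P - s"
  \<comment> \<open>The sign of \<open>a\<close> encodes \<open>s * P > N\<close> and makes the
    amplitude tend to 0; the sign of \<open>a + st\<close> encodes
    \<open>s - N / P < st\<close>.\<close>
  have a: "a < 0" "0 < a + st" using P st by (simp_all add: a_def N_def)
  have "0 < N / P" using P by (simp add: N_def)
  then have s0: "0 < s" "0 < st" "st < 1" using P st s by (simp_all add: N_def)
  obtain x0 where "x0 \<in> \<Omega>" using \<Omega> by blast
  then obtain d where d: "0 < d" "cball x0 d \<subseteq> \<Omega>"
    using \<Omega>(1) open_contains_cball by blast
  define L where "L = max 1 (4 / d)"
  have L: "1 \<le> L" by (simp add: L_def)
  have ball: "cball x0 (4 / lam) \<subseteq> \<Omega>" if "L \<le> lam" for lam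
  proof -
    have "1 \<le> lam" "4 / d \<le> lam" using that by (simp_all add: L_def)
    then have "4 / lam \<le> d" using d by (simp add: field_simps)
    then show ?thesis using d subset_cball[of "4 / lam" d x0] by auto
  qed
  have "\<exists>c>0. \<forall>lam\<ge>L. \<forall>w\<in>borel_measurable (lebesgue_on \<Omega>).
      (AE x in lebesgue_on \<Omega>. w x = rescaled_bump x0 (lam powr a) lam x) \<longrightarrow> ennreal c \<le> sobolev_norm st pt \<Omega> w"
  proof (cases "pt = \<infinity>")
    case True
    have "ennreal (1 / 2) \<le> sobolev_norm st pt \<Omega> w"
      if "L \<le> lam" "AE x in lebesgue_on \<Omega>. w x = rescaled_bump x0 (lam powr a) lam x" for lam w
      unfolding True using that L a by (intro rescaled_bump_holder_lower[OF \<Omega>(1) s0(2) ball]) auto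
    then show ?thesis by (intro exI[of _ "1 / 2"]) auto
  next
    case False
    then obtain q where q: "pt = ereal q" "1 \<le> q" using pt(1) by (cases pt) auto
    \<comment> \<open>The denominator equals \<open>(a + st) * P\<close>, so being at least critical
      means \<open>N \<le> (a + st) * q\<close>, the hypothesis of the Gagliardo lower
      bound.\<close>
    have "0 < N - (s - st) * P" using st(1) P(1) by (simp add: N_def field_simps)
    then have "N * P \<le> q * (N - (s - st) * P)"
      using pt(2) by (simp add: q N_def pos_divide_le_eq)
    also have "\<dots> = ((a + st) * q) * P" using P by (simp add: a_def field_simps)
    finally have "real CARD('n) \<le> (a + st) * q" using P by (simp add: N_def)
    then obtain c where "0 < c" and low: "\<And>x0 lam w. \<lbrakk>1 \<le> lam; cball x0 (4 / lam) \<subseteq> \<Omega>; w \<in> borel_measurable (lebesgue_on \<Omega>);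
      AE x in lebesgue_on \<Omega>. w x = rescaled_bump x0 (lam powr a) lam x\<rbrakk> \<Longrightarrow> ennreal c \<le> sobolev_norm st (ereal q) \<Omega> w"
      using rescaled_bump_gagliardo_lower[OF \<Omega>(2) s0(2,3) q(2)] by blast
    have "ennreal c \<le> sobolev_norm st pt \<Omega> w"
      if "L \<le> lam" "w \<in> borel_measurable (lebesgue_on \<Omega>)"
        "AE x in lebesgue_on \<Omega>. w x = rescaled_bump x0 (lam powr a) lam x" for lam w
      unfolding q(1) by (rule low[OF order.trans[OF L that(1)] ball[OF that(1)] that(2,3)])
    with \<open>0 < c\<close> show ?thesis by blast
  qed
  then obtain c where c: "0 < c" "\<And>lam w. \<lbrakk>L \<le> lam; w \<in> borel_measurable (lebesgue_on \<Omega>);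
      AE x in lebesgue_on \<Omega>. w x = rescaled_bump x0 (lam powr a) lam x\<rbrakk> \<Longrightarrow> ennreal c \<le> sobolev_norm st pt \<Omega> w"
    by blast
  obtain R where R: "\<And>x0 lam. 1 \<le> lam \<Longrightarrow>
      rescaled_bump x0 (lam powr a) lam \<in> sobolev_space s (ereal P) \<Omega> \<and>
      sobolev_norm s (ereal P) \<Omega> (rescaled_bump x0 (lam powr a) lam) \<le> ennreal R"
    using rescaled_bump_sobolev_bound[OF s0(1) s P(1) \<Omega>(2)] unfolding a_def N_def by blast
  define e where "e k = (L + real k) powr a" for k
  have "filterlim (\<lambda>k. L + real k) at_top sequentially"
    by (rule filterlim_tendsto_add_at_top[OF tendsto_const filterlim_real_sequentially])
  then have e0: "e \<longlonglongrightarrow> 0"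
    unfolding e_def using a(1) by (intro tendsto_neg_powr) auto
  show ?thesis
  proof (rule not_compactly_embedded_sobolevI[OF \<Omega>(2) s0(2) pt(1) c(1) e0])
    fix k :: nat
    let ?u = "rescaled_bump x0 ((L + real k) powr a) (L + real k)"
    have lam: "L \<le> L + real k" "1 \<le> L + real k" using L by auto
    have "\<bar>?u x\<bar> \<le> e k" for x
      using rescaled_bump_bounds[of "(L + real k) powr a" x0 "L + real k" x] by (simp add: e_def)
    then show "\<exists>u\<in>sobolev_space s (ereal P) \<Omega>. sobolev_norm s (ereal P) \<Omega> u \<le> ennreal R \<and> (\<forall>x. \<bar>u x\<bar> \<le> e k) \<and>
      (\<forall>w\<in>borel_measurable (lebesgue_on \<Omega>). (AE x in lebesgue_on \<Omega>. w x = u x) \<longrightarrow> ennreal c \<le> sobolev_norm st pt \<Omega> w)"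
      using R[OF lam(2), of x0] c(2)[OF lam(1)] by blast
  qed
qed

section \<open>Sorting the excluded exponents into the two regimes\<close>

theorem proposition2p16:
  fixes \<Omega> :: "(real^'n) set" and s st :: real and p pt :: ereal
  assumes "0 < s" "s \<le> 1" and "1 \<le> p" and "ereal s * p > ereal (real CARD('n))"
    and "bounded_lipschitz_domain \<Omega>"
    and "0 \<le> st" "st \<le> 1" and "1 \<le> pt"
    and "\<not> ((0 \<le> st \<and> ereal st \<le> ereal s - ereal (real CARD('n)) / p \<and> 1 \<le> pt \<and> pt \<le> \<infinity>) \<or>
            (ereal s - ereal (real CARD('n)) / p < ereal st \<and> st < s \<and> 1 \<le> pt \<and>
             pt < ereal (real CARD('n)) * p / (ereal (real CARD('n)) - ereal (s - st) * p)))"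
  shows "\<not> compactly_embedded (sobolev_space s p \<Omega>) (sobolev_norm s p \<Omega>)
             (sobolev_space st pt \<Omega>) (sobolev_norm st pt \<Omega>)"
proof (cases "s \<le> st")
  case True
  have \<Omega>: "open \<Omega>" "\<Omega> \<in> lmeasurable" "\<Omega> \<noteq> {}"
    using assms(5) by (auto simp: bounded_lipschitz_domain_def intro: lmeasurable_open)
  show ?thesis
    using not_compactly_embedded_waves[OF \<Omega> assms(1) True assms(7,3,8)] .
next
  case False
  have \<Omega>: "open \<Omega>" "\<Omega> \<in> lmeasurable" "\<Omega> \<noteq> {}"
    using assms(5) by (auto simp: bounded_lipschitz_domain_def intro: lmeasurable_open)
  \<comment> \<open>For \<open>p = \<infinity>\<close> the first alternative reads
    \<open>0 \<le> st \<le> s\<close>, which would hold since \<open>st < s\<close>.\<close>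
  have "p \<noteq> \<infinity>" using assms(6,8,9) False by auto
  then obtain P where P: "p = ereal P" "1 \<le> P" using assms(3) by (cases p) auto
  have sP: "real CARD('n) / P < s" using assms(4) P by (simp add: divide_less_eq)
  \<comment> \<open>Failure of the first alternative gives this strict bound; together with
    \<open>st < s\<close> it leaves the bound on \<open>pt\<close> as the only way for the second
    alternative to fail.\<close>
  have st: "s - real CARD('n) / P < st" using assms(6,8,9) P by (auto simp: not_le)
  then have "real CARD('n) - (s - st) * P > 0" using P by (simp add: field_simps)
  then have "ereal (real CARD('n) * P / (real CARD('n) - (s - st) * P)) \<le> pt"
    using assms(8,9) P st False by (auto simp: not_less)
  then show ?thesis
    using not_compactly_embedded_rescaled_bumps[OF \<Omega> assms(2) P(2) sP st _ assms(8)] False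
    by (simp add: P)
qed

end
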